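(* Let $G$ be a computable amenable group, let $A$ be a finite set, and let $X \subset A^G$ be a nonempty subshift. Let $\mathcal{F} = (F_i)$ be a modest Følner sequence in $G$. Then: (1) for every $x \in X$, $\overline{AC}_{\mathcal{F}}(x) \le h_G^{top}(X)$; (2) if $\mathcal{F}$ is also tempered, then there is a point $y \in X$ such that $$\overline{AC}_{\mathcal{F}}(y) = \underline{AC}_{\mathcal{F}}(y) = h_G^{top}(X);$$ (3) if $\mathcal{F}$ is tempered and in addition $X$ has the cardinality of the continuum, then the set of points $y \in X$ satisfying $\overline{AC}_{\mathcal{F}}(y) = \underline{AC}_{\mathcal{F}}(y) = h_G^{top}(X)$ has the cardinality of the continuum.
   Context: All logarithms are to base 2. Group notions. A computable group is a countable group whose set of elements is the set $\mathbb{N}$ of natural numbers and whose multiplication $(g,h)\mapsto gh$ is a computable function (we may assume that $0$ is the identity). A Følner sequence in $G$ is a sequence $(F_i)$ of finite nonempty subsets of $G$ with $\lim_{i\to\infty} |gF_i \setminus F_i|/|F_i| = 0$ for every $g\in G$; $G$ is amenable if it has a Følner sequence. $(F_i)$ is tempered if there is $K>0$ with $\left|\bigcup_{j<i} F_j^{-1}F_i\right| \le K|F_i|$ for all $i$. $(F_i)$ is modest if $C(F_i) = o(|F_i|)$, where $C$ is Kolmogorov complexity. Kolmogorov complexity. Let $2^*$ be the set of finite binary strings and $|x|$ the length of $x$. For a partial computable $f:2^*\to 2^*$ let $C_f(x)=\min\{|y| : f(y)=x\}$ ($+\infty$ if there is no such $y$). Fix an optimal $f$: for every partial computable $f'$ there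 is a constant $K$ with $C_f(x) < C_{f'}(x)+K$ for all $x$; put $C(x)=C_f(x)$. Complexity of natural numbers is defined by identifying $2^*$ with $\mathbb{N}$ via the length-then-lexicographic enumeration. Complexity of a finite subset of $\mathbb{N}$ is the complexity of its index under a fixed natural enumeration, i.e. an injection $q$ from the finite subsets of $\mathbb{N}$ onto a decidable subset of $\mathbb{N}$ for which $(q(w),u)\mapsto q(w\cup\{u\})$ is computable. Complexity of a partial map $t$ from $G$ to a finite set $A$ with finite domain is defined likewise, using an injection $q$ onto a decidable subset of $\mathbb{N}$ for which $(q(t),u,a)\mapsto q(t[u:=a])$ is computable, where $t[u:=a]$ is $t$ with its value at $u$ set (or overridden) to $a$. Different choices of $q$ change complexities only by $O(1)$. Dynamics. $A^G$ carries the product topology ($A$ discrete) and the shift-action $(gx)(h)=x(hg)$. A subshift is a closed $G$-invariant subset of $A^G$. For $F\subset G$, $\mathrm{pr}_F : A^G\to A^F$ is the restriction map. The topological entropy of a subshift $X$ is $h_G^{top}(X)=\lim_{i\to\infty} \frac{\log|\mathrm{pr}_{F_i}(X)|}{|F_i|}$ for any Følner sequence $(F_i)$ (the limit exists and does not depend on the sequence). Asymptotic complexity. For $x\in A^G$, $\overline{AC}_{\mathcal{F}}(x)=\limsup_{i\to\infty} \frac{C(\mathrm{pr}_{F_i}(x))}{|F_i|}$ and $\underline{AC}_{\mathcal{F}}(x)=\liminf_{i\to\infty} \frac{C(\mathrm{pr}_{F_i}(x))}{|F_i|}$. *)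

theory Defs
  imports "HOL-Analysis.Analysis" "HOL-Algebra.Coset"
begin

section \<open>Partial recursive functions\<close>

text \<open>
  Terms for the partial recursive functions of all arities.  The arity is not part of the term;
  it is the length of the argument list, and a mismatch makes the value undefined.
\<close>

datatype recf =
    Zero
  | Succ
  | Proj nat
  | Comp recf "recf list"
  | PrimRec recf recf
  | Mu recf

fun eval :: "recf \<Rightarrow> nat list \<Rightarrow> nat option" where
  "eval Zero xs = Some 0"
| "eval Succ xs = (case xs of [x] \<Rightarrow> Some (Suc x) | _ \<Rightarrow> None)"
| "eval (Proj i) xs = (if i < length xs then Some (xs ! i) else None)"
| "eval (Comp f gs) xs =
     (if \<forall>g\<in>set gs. eval g xs \<noteq> None then eval f (map (\<lambda>g. the (eval g xs)) gs) else None)"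
| "eval (PrimRec f g) xs =
     (case xs of
        [] \<Rightarrow> None
      | n # ys \<Rightarrow>
          rec_nat (eval f ys) (\<lambda>m r. case r of None \<Rightarrow> None | Some y \<Rightarrow> eval g (m # y # ys)) n)"
| "eval (Mu f) xs =
     (if \<exists>n. eval f (n # xs) = Some 0 \<and> (\<forall>m<n. eval f (m # xs) \<noteq> None)
      then Some (LEAST n. eval f (n # xs) = Some 0) else None)"

definition computable2 :: "(nat \<Rightarrow> nat \<Rightarrow> nat) \<Rightarrow> bool" where
  "computable2 h \<longleftrightarrow> (\<exists>r. \<forall>x y. eval r [x, y] = Some (h x y))"

definition decidable :: "nat set \<Rightarrow> bool" where
  "decidable S \<longleftrightarrow> (\<exists>r. \<forall>x. eval r [x] = Some (of_bool (x \<in> S)))"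


section \<open>Kolmogorov complexity\<close>

text \<open>
  The position of a binary string in the length-then-lexicographic enumeration
  (\<open>[]\<close>, \<open>0\<close>, \<open>1\<close>, \<open>00\<close>, \<open>01\<close>, \<dots>, starting from position \<open>0\<close>); appending a
  digit \<open>b\<close> sends \<open>n\<close> to \<open>2 * n + 1 + b\<close>.  The lemmas \<open>bij_str_index\<close> and
  \<open>str_index_mono\<close> below confirm that this is the order isomorphism onto \<open>nat\<close>.
\<close>

definition str_index :: "bool list \<Rightarrow> nat" where
  "str_index = foldl (\<lambda>n b. 2 * n + 1 + of_bool b) 0"

lemma str_index_simps [simp]:
  "str_index [] = 0"
  "str_index (w @ [b]) = 2 * str_index w + 1 + of_bool b"
  by (simp_all add: str_index_def)

lemma bij_str_index: "bij str_index"
proof (rule bijI)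
  have "str_index v = str_index w \<Longrightarrow> v = w" for v w
  proof (induction v arbitrary: w rule: rev_induct)
    case Nil
    then show ?case by (cases w rule: rev_cases) auto
  next
    case (snoc b v)
    show ?case
    proof (cases w rule: rev_cases)
      case Nil
      with snoc.prems show ?thesis by simp
    next
      case (snoc w' c)
      with snoc.prems have eq: "2 * str_index v + of_bool b = 2 * str_index w' + (of_bool c :: nat)"
        by simp
      then have "b = c" "str_index v = str_index w'"
        by (cases b; cases c; simp; presburger)+
      with snoc.IH snoc show ?thesis by auto
    qed
  qed
  then show "inj str_index" by (rule injI)
next
  have "\<exists>w. str_index w = n" for n
  proof (induction n rule: less_induct)
    case (less n)
    show ?case
    proof (cases "n = 0")
      case True
      then show ?thesis by (intro exI[of _ "[]"]) simp
    next
      case False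
      then have "(n - 1) div 2 < n" by linarith
      then obtain w where w: "str_index w = (n - 1) div 2"
        using less.IH by blast
      have "str_index (w @ [even n]) = n"
        using False w by (cases "even n"; simp; presburger)
      then show ?thesis ..
    qed
  qed
  then show "surj str_index" by (metis surjI)
qed

lemma str_index_bounds: "2 ^ length w \<le> str_index w + 1 \<and> str_index w + 1 < 2 ^ Suc (length w)"
  by (induction w rule: rev_induct) auto

lemma str_index_append: "str_index (v @ w) = 2 ^ length w * str_index v + str_index w"
  by (induction w rule: rev_induct)
     (simp_all flip: append_assoc add: algebra_simps)

lemma str_index_mono:
  assumes "(v, w) \<in> lenlex {(False, True)}"
  shows "str_index v < str_index w"
proof (cases "length v < length w")
  case True
  then have "(2::nat) ^ Suc (length v) \<le> 2 ^ length w"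
    by (intro power_increasing) auto
  with str_index_bounds[of v] str_index_bounds[of w] show ?thesis by linarith
next
  case False
  with assms obtain u v' w' where
    eq: "v = u @ False # v'" "w = u @ True # w'" and len: "length v' = length w'"
    by (auto simp: lenlex_conv lex_conv)
  have 1: "str_index (b # z) = 2 ^ length z * (1 + of_bool b) + str_index z" for b z
    using str_index_append[of "[b]" z] by (simp add: str_index_def)
  show ?thesis
    using str_index_bounds[of v'] str_index_bounds[of w'] len
    by (simp add: eq str_index_append 1)
qed

definition partial_computable :: "(bool list \<Rightarrow> bool list option) \<Rightarrow> bool" where
  "partial_computable f \<longleftrightarrow>
     (\<exists>r. \<forall>w. eval r [str_index w] = map_option str_index (f w))"

text \<open>The infimum over the empty set is \<open>\<infinity>\<close> in \<open>enat\<close>.\<close>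

definition complexity :: "(bool list \<Rightarrow> bool list option) \<Rightarrow> bool list \<Rightarrow> enat" where
  "complexity f x = (INF y\<in>{y. f y = Some x}. enat (length y))"

definition optimal :: "(bool list \<Rightarrow> bool list option) \<Rightarrow> bool" where
  "optimal f \<longleftrightarrow> partial_computable f \<and>
     (\<forall>f'. partial_computable f' \<longrightarrow>
        (\<exists>K::nat. \<forall>x. complexity f x < complexity f' x + enat K))"

definition nat_complexity :: "(bool list \<Rightarrow> bool list option) \<Rightarrow> nat \<Rightarrow> enat" where
  "nat_complexity f n = complexity f (inv_into UNIV str_index n)"

definition finite_set_enumeration :: "(nat set \<Rightarrow> nat) \<Rightarrow> bool" where
  "finite_set_enumeration q \<longleftrightarrow>
     inj_on q {w. finite w} \<and> decidable (q ` {w. finite w}) \<and>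
     (\<exists>r. \<forall>w u. finite w \<longrightarrow> eval r [q w, u] = Some (q (w \<union> {u})))"

definition finite_maps :: "'a set \<Rightarrow> (nat \<Rightarrow> 'a option) set" where
  "finite_maps A = {t. finite (dom t) \<and> ran t \<subseteq> A}"

text \<open>
  The finite set \<open>A\<close> enters computations through some numbering \<open>e\<close> of its elements;
  since \<open>A\<close> is finite, the choice of \<open>e\<close> does not matter.
\<close>

definition finite_map_enumeration :: "'a set \<Rightarrow> ((nat \<Rightarrow> 'a option) \<Rightarrow> nat) \<Rightarrow> bool" where
  "finite_map_enumeration A q \<longleftrightarrow>
     inj_on q (finite_maps A) \<and> decidable (q ` finite_maps A) \<and>
     (\<exists>e r. inj_on e A \<and>
        (\<forall>t\<in>finite_maps A. \<forall>u. \<forall>a\<in>A. eval r [q t, u, e a] = Some (q (t(u \<mapsto> a)))))"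


section \<open>Computable amenable groups\<close>

definition computable_group :: "nat monoid \<Rightarrow> bool" where
  "computable_group G \<longleftrightarrow> group G \<and> carrier G = UNIV \<and> computable2 (mult G)"

definition Folner_sequence :: "nat monoid \<Rightarrow> (nat \<Rightarrow> nat set) \<Rightarrow> bool" where
  "Folner_sequence G F \<longleftrightarrow>
     (\<forall>i. finite (F i) \<and> F i \<noteq> {} \<and> F i \<subseteq> carrier G) \<and>
     (\<forall>g\<in>carrier G. (\<lambda>i. real (card ((g <#\<^bsub>G\<^esub> F i) - F i)) / real (card (F i))) \<longlonglongrightarrow> 0)"

definition amenable :: "nat monoid \<Rightarrow> bool" where
  "amenable G \<longleftrightarrow> (\<exists>F. Folner_sequence G F)"

definition tempered :: "nat monoid \<Rightarrow> (nat \<Rightarrow> nat set) \<Rightarrow> bool" where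
  "tempered G F \<longleftrightarrow>
     (\<exists>K::real. K > 0 \<and>
        (\<forall>i. real (card (\<Union>j<i. set_inv\<^bsub>G\<^esub> (F j) <#>\<^bsub>G\<^esub> F i)) \<le> K * real (card (F i))))"

definition modest ::
  "(bool list \<Rightarrow> bool list option) \<Rightarrow> (nat set \<Rightarrow> nat) \<Rightarrow> (nat \<Rightarrow> nat set) \<Rightarrow> bool" where
  "modest f q F \<longleftrightarrow>
     (\<lambda>i. ereal_of_enat (nat_complexity f (q (F i))) / ereal (real (card (F i)))) \<longlonglongrightarrow> 0"


section \<open>Subshifts, entropy and asymptotic complexity\<close>

definition shift :: "nat monoid \<Rightarrow> nat \<Rightarrow> (nat \<Rightarrow> 'a) \<Rightarrow> nat \<Rightarrow> 'a" where
  "shift G g x = (\<lambda>h. x (h \<otimes>\<^bsub>G\<^esub> g))"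

definition subshift :: "nat monoid \<Rightarrow> 'a set \<Rightarrow> (nat \<Rightarrow> 'a) set \<Rightarrow> bool" where
  "subshift G A X \<longleftrightarrow>
     closedin (product_topology (\<lambda>_. discrete_topology A) (carrier G)) X \<and>
     (\<forall>g\<in>carrier G. \<forall>x\<in>X. shift G g x \<in> X)"

text \<open>Elements of \<open>A\<^sup>F\<close> are represented as partial maps with domain \<open>F\<close>.\<close>

definition pr :: "nat set \<Rightarrow> (nat \<Rightarrow> 'a) \<Rightarrow> nat \<Rightarrow> 'a option" where
  "pr F x = (Some \<circ> x) |` F"

definition top_entropy :: "nat monoid \<Rightarrow> (nat \<Rightarrow> 'a) set \<Rightarrow> real" where
  "top_entropy G X =
     (THE h. \<forall>F. Folner_sequence G F \<longrightarrow>
        (\<lambda>i. log 2 (real (card (pr (F i) ` X))) / real (card (F i))) \<longlonglongrightarrow> h)"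

definition upper_AC ::
  "(bool list \<Rightarrow> bool list option) \<Rightarrow> ((nat \<Rightarrow> 'a option) \<Rightarrow> nat) \<Rightarrow> (nat \<Rightarrow> nat set) \<Rightarrow>
     (nat \<Rightarrow> 'a) \<Rightarrow> ereal" where
  "upper_AC f q F x =
     limsup (\<lambda>i. ereal_of_enat (nat_complexity f (q (pr (F i) x))) / ereal (real (card (F i))))"

definition lower_AC ::
  "(bool list \<Rightarrow> bool list option) \<Rightarrow> ((nat \<Rightarrow> 'a option) \<Rightarrow> nat) \<Rightarrow> (nat \<Rightarrow> nat set) \<Rightarrow>
     (nat \<Rightarrow> 'a) \<Rightarrow> ereal" where
  "lower_AC f q F x =
     liminf (\<lambda>i. ereal_of_enat (nat_complexity f (q (pr (F i) x))) / ereal (real (card (F i))))"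

end

theory Submission
  imports Defs "HOL-Library.Nat_Bijection"
begin

text \<open>
  Write \<open>h\<close> for the infimum of \<open>log 2 (npat S X) / card S\<close> over finite nonempty \<open>S\<close>. Shearer's
  inequality, applied to the translates of \<open>S\<close> that meet \<open>E\<close>, bounds \<open>log 2 (npat E X)\<close> by
  \<open>h * card E\<close> up to a boundary term and an arbitrarily small error; so \<open>h\<close> is the topological
  entropy. The same bound holds for the patterns on \<open>E\<close> that are only required to look like
  \<open>X\<close> through the fixed window \<open>S\<close>, and those can be enumerated by a program that is given \<open>E\<close>.
  Since \<open>F\<close> is modest, this yields (1).

  For (2), fix \<open>s < h\<close> and call \<open>g\<close> bad for \<open>x\<close> if some \<open>F i\<close> (\<open>i \<ge> N\<close>) carries a pattern of
  complexity at most \<open>s * card (F i)\<close> in \<open>g x\<close>. If a positive proportion of \<open>D = F m\<close> is bad, a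
  Vitali-type argument based on temperedness finds almost disjoint bad tiles \<open>F i g\<close> that cover a
  positive proportion of \<open>D\<close>. On these tiles \<open>x\<close> has few patterns, and on the rest of \<open>D\<close> Shearer's
  inequality applies again, so the number of such patterns on \<open>D\<close> is at most
  \<open>2 powr ((h - c) * card D)\<close> for some \<open>c > 0\<close>. Hence, for sequences \<open>s k \<longlonglongrightarrow> h\<close> and summable proportions,
  some \<open>x\<close> and some \<open>g \<in> D\<close> avoid finitely many of these conditions at once, and compactness
  gives a point that avoids all of them. As single points may be added to the families to be avoided, the
  closed set of such points is uncountable if \<open>h > 0\<close>, and it contains a perfect set; if \<open>h = 0\<close> then
  (1) shows that all points of \<open>X\<close> qualify. This gives (3).
\<close>

section \<open>Combinatorial Shearer inequality\<close>

text \<open>The patterns of a subshift need not form a computable family, so a program cannot be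
  expected to list those of \<open>X\<close> on a given set. It can only contain the finite table of
  patterns on one window \<open>S\<close>; this forces the detour through locally admissible
  patterns in (1).

  In (2) the obstacle is the number of ways to place bad tiles of many sizes. They are not counted
  but weighted: a tile on \<open>F i\<close> gets the weight 2^(-s |F i|), so the sum over all
  configurations factors into (1 + a)^|D|. Here a is essentially the sum of 2^(-tau |F i|) over
  distinct sets \<open>F i\<close> with large \<open>i\<close>. No growth rate of |F i| in terms of
  \<open>i\<close> is available; instead modesty makes a small, since distinct sets have distinct
  programs, of length at most (tau / 4) |F i|, and the sum of 4^(-length) over all programs is at
  most 2.

  The chosen tiles may overlap by a proportion \<delta>, which raises the price of a tiled cell from
  s to s / (1 - \<delta>). This is affordable because s stays strictly below the entropy.\<close>

lemma pr_eq_iff: "pr E x = pr E y \<longleftrightarrow> (\<forall>d\<in>E. x d = y d)"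
  by (auto simp: pr_def fun_eq_iff restrict_map_def)

lemma pr_subset: "E' \<subseteq> E \<Longrightarrow> pr E' x = pr E x |` E'"
  by (auto simp: pr_def fun_eq_iff restrict_map_def)

lemma dom_pr [simp]: "dom (pr E x) = E"
  by (auto simp: pr_def)

lemma ran_pr [simp]: "ran (pr E x) = x ` E"
  by (force simp: pr_def ran_def restrict_map_def)

lemma pr_in_finite_maps:
  assumes "finite E" "range x \<subseteq> A"
  shows "pr E x \<in> finite_maps A"
  using assms by (auto simp: finite_maps_def)

definition npat :: "nat set \<Rightarrow> (nat \<Rightarrow> 'a) set \<Rightarrow> nat" where
  "npat E Y = card (pr E ` Y)"

lemma finite_pr_image:
  assumes "finite E" "finite A" "\<And>x. x \<in> Y \<Longrightarrow> range x \<subseteq> A"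
  shows "finite (pr E ` Y)"
proof (rule finite_subset)
  show "pr E ` Y \<subseteq> {m. dom m = E \<and> ran m \<subseteq> A}"
    using assms(3) by (auto simp: image_subset_iff)
  show "finite {m. dom m = E \<and> ran m \<subseteq> A}"
    by (rule finite_set_of_finite_maps[OF assms(1,2)])
qed

lemma npat_mono:
  assumes "finite (pr E ` Y)" "Y' \<subseteq> Y" "E' \<subseteq> E"
  shows "npat E' Y' \<le> npat E Y"
proof -
  have "pr E' ` Y' = (\<lambda>p. p |` E') ` (pr E ` Y')"
    using pr_subset[OF assms(3)] by (auto simp: image_image)
  moreover have "card (pr E ` Y') \<le> card (pr E ` Y)"
    by (rule card_mono) (use assms in auto)
  moreover have "finite (pr E ` Y')"
    by (rule finite_subset[OF _ assms(1)]) (use assms in auto)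
  ultimately show ?thesis
    unfolding npat_def by (metis card_image_le order_trans)
qed

lemma npat_pos: "finite (pr E ` Y) \<Longrightarrow> Y \<noteq> {} \<Longrightarrow> 0 < npat E Y"
  by (simp add: npat_def card_gt_0_iff)

lemma npat_split:
  assumes "finite A" "finite (pr S ` Y)" "d \<in> S" "\<And>x. x \<in> Y \<Longrightarrow> x d \<in> A"
  shows "npat S Y = (\<Sum>a\<in>A. npat S {x \<in> Y. x d = a})"
proof -
  have "pr S ` Y = (\<Union>a\<in>A. pr S ` {x \<in> Y. x d = a})"
    using assms(4) by auto
  moreover have "card (\<Union>a\<in>A. pr S ` {x \<in> Y. x d = a}) = (\<Sum>a\<in>A. card (pr S ` {x \<in> Y. x d = a}))"
  proof (rule card_UN_disjoint)
    show "\<forall>a\<in>A. finite (pr S ` {x \<in> Y. x d = a})"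
      by (intro ballI finite_subset[OF _ assms(2)]) auto
    show "\<forall>i\<in>A. \<forall>j\<in>A. i \<noteq> j \<longrightarrow> pr S ` {x \<in> Y. x d = i} \<inter> pr S ` {x \<in> Y. x d = j} = {}"
      using assms(3) by (auto simp: pr_eq_iff)
  qed fact
  ultimately show ?thesis by (simp add: npat_def)
qed

text \<open>Hoelder's inequality with equal exponents. After each \<open>u j\<close> is scaled to
  total one, the arithmetic-geometric mean inequality at each \<open>a\<close> bounds the sum by
  one. A vanishing total cannot be scaled and is treated first.\<close>

lemma Hoelder_roots:
  fixes u :: "'j \<Rightarrow> 'b \<Rightarrow> real"
  assumes J: "finite J" "J \<noteq> {}" and B: "finite B" and nn: "\<And>j a. 0 \<le> u j a"
  shows "(\<Sum>a\<in>B. root (card J) (\<Prod>j\<in>J. u j a)) ^ card J \<le> (\<Prod>j\<in>J. \<Sum>a\<in>B. u j a)"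
proof (cases "\<exists>j\<in>J. (\<Sum>a\<in>B. u j a) = 0")
  case True
  then obtain j where j: "j \<in> J" "(\<Sum>a\<in>B. u j a) = 0" by blast
  then have "\<forall>a\<in>B. u j a = 0"
    using B nn by (simp add: sum_nonneg_eq_0_iff)
  then have "(\<Prod>j\<in>J. u j a) = 0" if "a \<in> B" for a
    using that j(1) J(1) by (meson prod_zero)
  then have "(\<Sum>a\<in>B. root (card J) (\<Prod>j\<in>J. u j a)) = 0"
    by (intro sum.neutral) auto
  with J show ?thesis
    by (simp add: prod_nonneg sum_nonneg nn card_gt_0_iff power_0_left)
next
  case False
  define U where "U j = (\<Sum>a\<in>B. u j a)" for j
  have U: "0 < U j" if "j \<in> J" for j
    using False that nn by (metis U_def order_le_less sum_nonneg)
  define k where "k = card J"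
  have k: "k > 0" using J by (simp add: k_def card_gt_0_iff)
  have root_powr: "root k x = x powr (1 / k)" if "0 \<le> x" for x
    using that k by (cases "x = 0") (simp_all add: root_powr_inverse)
  have "(\<Sum>a\<in>B. root k (\<Prod>j\<in>J. u j a / U j)) \<le> (\<Sum>a\<in>B. \<Sum>j\<in>J. u j a / U j / k)"
  proof (rule sum_mono)
    fix a
    have *: "0 \<le> u j a / U j" if "j \<in> J" for j
      using U[OF that] nn[of j a] by simp
    show "root k (\<Prod>j\<in>J. u j a / U j) \<le> (\<Sum>j\<in>J. u j a / U j / k)"
      using arith_geom_mean[OF J, of "\<lambda>j. u j a / U j"] *
        root_powr[OF prod_nonneg, of J "\<lambda>j. u j a / U j"] by (simp add: k_def)
  qed
  also have "\<dots> = (\<Sum>j\<in>J. \<Sum>a\<in>B. u j a / U j) / k"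
    by (simp add: sum_divide_distrib sum.swap[of _ B J])
  also have "\<dots> = (\<Sum>j\<in>J. 1) / k"
    using U by (intro arg_cong[where f = "\<lambda>t. t / k"] sum.cong refl)
      (metis U_def divide_self less_irrefl sum_divide_distrib)
  also have "\<dots> = 1" using k by (simp add: k_def)
  finally have le1: "(\<Sum>a\<in>B. root k (\<Prod>j\<in>J. u j a / U j)) \<le> 1" .
  have "(\<Sum>a\<in>B. root k (\<Prod>j\<in>J. u j a)) = (\<Sum>a\<in>B. root k (\<Prod>j\<in>J. u j a / U j)) * root k (\<Prod>j\<in>J. U j)"
    unfolding sum_distrib_right
  proof (rule sum.cong[OF refl])
    fix a
    have "(\<Prod>j\<in>J. u j a) = (\<Prod>j\<in>J. u j a / U j) * (\<Prod>j\<in>J. U j)"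
      unfolding prod.distrib[symmetric] by (rule prod.cong) (use U in force)+
    then show "root k (\<Prod>j\<in>J. u j a) = root k (\<Prod>j\<in>J. u j a / U j) * root k (\<Prod>j\<in>J. U j)"
      by (simp only: real_root_mult)
  qed
  also have "\<dots> \<le> 1 * root k (\<Prod>j\<in>J. U j)"
    by (intro mult_right_mono le1) (use k U in \<open>simp add: prod_nonneg less_imp_le\<close>)
  finally have "(\<Sum>a\<in>B. root k (\<Prod>j\<in>J. u j a)) ^ k \<le> root k (\<Prod>j\<in>J. U j) ^ k"
    by (intro power_mono) (auto intro!: sum_nonneg prod_nonneg nn simp: k)
  also have "\<dots> = (\<Prod>j\<in>J. U j)"
    using k U by (intro real_root_pow_pos2 prod_nonneg) (auto simp: less_imp_le)
  finally show ?thesis by (simp add: U_def k_def)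
qed

text \<open>Induction on \<open>E\<close>: \<open>Y\<close> is sliced by the symbol at a new point
  \<open>d\<close>, and the induction hypothesis applies to each slice. For a set through
  \<open>d\<close> the pattern counts of the slices add up to that of \<open>Y\<close>, so Hoelder's
  inequality recombines the slices.\<close>

theorem Shearer_counting:
  fixes Y :: "(nat \<Rightarrow> 'a) set"
  assumes A: "finite A" and "finite E" and J: "finite J"
    and S: "\<And>j. j \<in> J \<Longrightarrow> finite (S j)"
    and k: "0 < k"
    and cover: "\<And>d. d \<in> E \<Longrightarrow> k \<le> card {j\<in>J. d \<in> S j}"
    and Y: "\<And>x. x \<in> Y \<Longrightarrow> range x \<subseteq> A"
  shows "npat E Y ^ k \<le> (\<Prod>j\<in>J. npat (S j) Y)"
proof (cases "Y = {}")
  case True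
  then show ?thesis using k by (simp add: npat_def power_0_left)
next
  case False
  with \<open>finite E\<close> show ?thesis
    using cover Y
  proof (induction E arbitrary: Y rule: finite_induct)
    case empty
    have "pr {} ` Y = {Map.empty}" using empty.prems(1) by (auto simp: pr_def)
    then have "npat {} Y = 1" by (simp add: npat_def)
    moreover have "1 \<le> (\<Prod>j\<in>J. npat (S j) Y)"
      using npat_pos[OF finite_pr_image[OF S A]] empty.prems
      by (intro prod_ge_1) (simp add: Suc_le_eq)
    ultimately show ?case by simp
  next
    case (insert d E)
    have fin: "finite (pr T ` Z)" if "finite T" "Z \<subseteq> Y" for T Z
      by (rule finite_pr_image[OF that(1) A]) (use insert.prems that in auto)
    define Ya where "Ya a = {x \<in> Y. x d = a}" for a
    define B where "B = {a\<in>A. Ya a \<noteq> {}}"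
    have B: "finite B" using A by (simp add: B_def)
    have YB: "x d \<in> B" if "x \<in> Y" for x
      using that insert.prems(3)[OF that] by (auto simp: B_def Ya_def)
    have "k \<le> card {j\<in>J. d \<in> S j}" using insert.prems by simp
    \<comment> \<open>Exactly \<open>k\<close> of the sets through \<open>d\<close> are kept, so
      that the number of Hoelder factors equals the exponent \<open>k\<close>. All other sets go
      into \<open>R\<close>, where slices are bounded by the whole of \<open>Y\<close>.\<close>
    then obtain I where I: "I \<subseteq> {j\<in>J. d \<in> S j}" "card I = k" "finite I"
      by (rule obtain_subset_with_card_n) (use that in blast)
    then have IJ: "I \<subseteq> J" by auto
    have I0: "I \<noteq> {}" using I k by auto
    define R where "R = (\<Prod>j\<in>J - I. real (npat (S j) Y))"
    have IH: "real (npat E (Ya a)) \<le> root k R * root k (\<Prod>j\<in>I. real (npat (S j) (Ya a)))" if a: "a \<in> B" for a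
    proof -
      have "npat E (Ya a) ^ k \<le> (\<Prod>j\<in>J. npat (S j) (Ya a))"
      proof (rule insert.IH)
        show "Ya a \<noteq> {}" using a by (simp add: B_def)
        show "k \<le> card {j\<in>J. e \<in> S j}" if "e \<in> E" for e
          using insert.prems(2)[of e] that by simp
        show "range x \<subseteq> A" if "x \<in> Ya a" for x
          using insert.prems(3)[of x] that by (simp add: Ya_def)
      qed
      then have "real (npat E (Ya a)) ^ k \<le> (\<Prod>j\<in>J. real (npat (S j) (Ya a)))"
        by (metis of_nat_le_iff of_nat_power of_nat_prod)
      also have "\<dots> = (\<Prod>j\<in>J - I. real (npat (S j) (Ya a))) * (\<Prod>j\<in>I. real (npat (S j) (Ya a)))"
        by (rule prod.subset_diff[OF IJ J])
      also have "\<dots> \<le> R * (\<Prod>j\<in>I. real (npat (S j) (Ya a)))"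
        unfolding R_def
        by (intro mult_right_mono prod_mono prod_nonneg conjI)
          (auto intro!: npat_mono fin S simp: Ya_def)
      finally have "root k (real (npat E (Ya a)) ^ k) \<le> root k (R * (\<Prod>j\<in>I. real (npat (S j) (Ya a))))"
        using k by (subst real_root_le_iff) auto
      then show ?thesis
        using k by (simp add: real_root_mult real_root_power_cancel)
    qed
    have split: "npat T Y = (\<Sum>a\<in>B. npat T (Ya a))" if "finite T" "d \<in> T" for T
      unfolding Ya_def by (rule npat_split) (use that B YB fin in auto)
    \<comment> \<open>The symbol at \<open>d\<close> is constant on a slice, so adding
      \<open>d\<close> to the domain creates no new patterns.\<close>
    have eq: "npat (insert d E) (Ya a) = npat E (Ya a)" for a
    proof -
      have "pr (insert d E) x = (pr E x)(d \<mapsto> a)" if "x \<in> Ya a" for x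
        using that by (auto simp: pr_def Ya_def restrict_map_def fun_eq_iff)
      then have im: "pr (insert d E) ` Ya a = (\<lambda>p. p(d \<mapsto> a)) ` (pr E ` Ya a)"
        by (auto simp: image_image)
      have "npat (insert d E) (Ya a) \<le> npat E (Ya a)"
        unfolding npat_def im by (rule card_image_le) (use fin insert.hyps in \<open>auto simp: Ya_def\<close>)
      moreover have "npat E (Ya a) \<le> npat (insert d E) (Ya a)"
        by (rule npat_mono) (use fin insert.hyps in \<open>auto simp: Ya_def\<close>)
      ultimately show ?thesis by simp
    qed
    have R0: "0 \<le> R" unfolding R_def by (intro prod_nonneg) auto
    have "real (npat (insert d E) Y) = (\<Sum>a\<in>B. real (npat E (Ya a)))"
      using split[of "insert d E"] insert.hyps by (simp add: eq)
    also have "\<dots> \<le> (\<Sum>a\<in>B. root k R * root k (\<Prod>j\<in>I. real (npat (S j) (Ya a))))"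
      by (intro sum_mono IH)
    also have "\<dots> = root k R * (\<Sum>a\<in>B. root k (\<Prod>j\<in>I. real (npat (S j) (Ya a))))"
      by (simp add: sum_distrib_left)
    finally have "real (npat (insert d E) Y) ^ k \<le> (root k R * (\<Sum>a\<in>B. root k (\<Prod>j\<in>I. real (npat (S j) (Ya a))))) ^ k"
      by (intro power_mono) auto
    also have "\<dots> = R * (\<Sum>a\<in>B. root k (\<Prod>j\<in>I. real (npat (S j) (Ya a)))) ^ k"
      using k R0 by (simp add: power_mult_distrib)
    also have "\<dots> \<le> R * (\<Prod>j\<in>I. \<Sum>a\<in>B. real (npat (S j) (Ya a)))"
      using Hoelder_roots[OF I(3) I0 B, of "\<lambda>j a. real (npat (S j) (Ya a))"] R0 I(2)
      by (intro mult_left_mono) auto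
    also have "(\<Prod>j\<in>I. \<Sum>a\<in>B. real (npat (S j) (Ya a))) = (\<Prod>j\<in>I. real (npat (S j) Y))"
      by (rule prod.cong) (use I S split in auto)
    also have "R * \<dots> = (\<Prod>j\<in>J. real (npat (S j) Y))"
      unfolding R_def by (rule prod.subset_diff[OF IJ J, symmetric])
    finally show ?case
      by (metis of_nat_le_iff of_nat_power of_nat_prod)
  qed
qed

section \<open>Computability\<close>

text \<open>The environment \<open>\<rho>\<close> holds the variables in de Bruijn style: a newly
  bound variable becomes \<open>\<rho> 0\<close> and shifts the others. Computability of a compound
  expression then follows by backward application of closure rules.\<close>

definition comp_fn :: "nat \<Rightarrow> ((nat \<Rightarrow> nat) \<Rightarrow> nat) \<Rightarrow> bool" where
  "comp_fn n h \<longleftrightarrow> (\<exists>r. \<forall>\<rho>. eval r (map \<rho> [0..<n]) = Some (h \<rho>))"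

abbreviation comp_pred :: "nat \<Rightarrow> ((nat \<Rightarrow> nat) \<Rightarrow> bool) \<Rightarrow> bool" where
  "comp_pred n P \<equiv> comp_fn n (\<lambda>\<rho>. of_bool (P \<rho>))"

lemma map_case_nat_upt: "map (case_nat x \<rho>) [0..<Suc n] = x # map \<rho> [0..<n]"
  by (simp add: upt_conv_Cons map_Suc_upt[symmetric] del: upt_Suc)

lemma comp_fn_var: "i < n \<Longrightarrow> comp_fn n (\<lambda>\<rho>. \<rho> i)"
  unfolding comp_fn_def by (rule exI[of _ "Proj i"]) simp

lemma comp_fn_app1:
  assumes "comp_fn 1 (\<lambda>\<rho>. h (\<rho> 0))" "comp_fn n f"
  shows "comp_fn n (\<lambda>\<rho>. h (f \<rho>))"
proof -
  obtain r where r: "\<And>\<rho>. eval r (map \<rho> [0..<1]) = Some (h (\<rho> 0))"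
    using assms(1) by (auto simp: comp_fn_def)
  have r': "eval r [x] = Some (h x)" for x
    using r[of "\<lambda>_. x"] by simp
  obtain rf where rf: "\<And>\<rho>. eval rf (map \<rho> [0..<n]) = Some (f \<rho>)"
    using assms(2) by (auto simp: comp_fn_def)
  show ?thesis
    unfolding comp_fn_def by (rule exI[of _ "Comp r [rf]"]) (simp add: rf r')
qed

lemma comp_fn_app2:
  assumes "comp_fn 2 (\<lambda>\<rho>. h (\<rho> 0) (\<rho> 1))" "comp_fn n f" "comp_fn n g"
  shows "comp_fn n (\<lambda>\<rho>. h (f \<rho>) (g \<rho>))"
proof -
  obtain r where r: "\<And>\<rho>. eval r (map \<rho> [0..<2]) = Some (h (\<rho> 0) (\<rho> 1))"
    using assms(1) by (auto simp: comp_fn_def)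
  have r': "eval r [x, y] = Some (h x y)" for x y
    using r[of "\<lambda>i. [x, y] ! i"] by (simp add: upt_rec numeral_2_eq_2)
  obtain rf rg where rf: "\<And>\<rho>. eval rf (map \<rho> [0..<n]) = Some (f \<rho>)"
    and rg: "\<And>\<rho>. eval rg (map \<rho> [0..<n]) = Some (g \<rho>)"
    using assms(2,3) by (auto simp: comp_fn_def)
  show ?thesis
    unfolding comp_fn_def by (rule exI[of _ "Comp r [rf, rg]"]) (simp add: rf rg r')
qed

lemma comp_fn_computable2: "computable2 m \<Longrightarrow> comp_fn 2 (\<lambda>\<rho>. m (\<rho> 0) (\<rho> 1))"
  by (force simp: comp_fn_def computable2_def upt_rec numeral_2_eq_2)

lemma comp_fn_Suc: "comp_fn n f \<Longrightarrow> comp_fn n (\<lambda>\<rho>. Suc (f \<rho>))"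
proof (rule comp_fn_app1[where h = Suc])
  show "comp_fn 1 (\<lambda>\<rho>. Suc (\<rho> 0))"
    unfolding comp_fn_def by (rule exI[of _ Succ]) simp
qed

lemma comp_fn_const: "comp_fn n (\<lambda>\<rho>. c)"
proof (induction c)
  case 0
  show ?case unfolding comp_fn_def by (rule exI[of _ Zero]) simp
qed (rule comp_fn_Suc)

text \<open>The step need only be defined along the values \<open>H j \<rho>\<close> that actually occur.\<close>

lemma comp_fn_recursion:
  assumes "comp_fn n (H 0)"
    and step: "\<exists>r. \<forall>\<rho> j. eval r (j # H j \<rho> # map \<rho> [0..<n]) = Some (H (Suc j) \<rho>)"
    and "comp_fn n g"
  shows "comp_fn n (\<lambda>\<rho>. H (g \<rho>) \<rho>)"
proof -
  obtain ra rb rg where ra: "\<And>\<rho>. eval ra (map \<rho> [0..<n]) = Some (H 0 \<rho>)"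
    and rb: "\<And>\<rho> j. eval rb (j # H j \<rho> # map \<rho> [0..<n]) = Some (H (Suc j) \<rho>)"
    and rg: "\<And>\<rho>. eval rg (map \<rho> [0..<n]) = Some (g \<rho>)"
    using assms by (auto simp: comp_fn_def)
  have rec: "rec_nat (eval ra ys) (\<lambda>m r. case r of None \<Rightarrow> None | Some y \<Rightarrow> eval rb (m # y # ys)) j
      = Some (H j \<rho>)" if "ys = map \<rho> [0..<n]" for j \<rho> ys
    using that by (induction j) (simp_all add: ra rb)
  have args: "map ((\<lambda>t. the (eval t (map \<rho> [0..<n]))) \<circ> Proj) [0..<n] = map \<rho> [0..<n]" for \<rho>
    by (rule map_cong[OF refl]) simp
  show ?thesis
    unfolding comp_fn_def
    by (rule exI[of _ "Comp (PrimRec ra rb) (rg # map Proj [0..<n])"]) (simp add: rg rec args)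
qed

lemma comp_fn_rec_nat:
  assumes "comp_fn n a" "comp_fn (Suc (Suc n)) (\<lambda>\<rho>. b (\<rho> 0) (\<rho> (Suc 0)) (\<lambda>i. \<rho> (Suc (Suc i))))"
    and "comp_fn n g"
  shows "comp_fn n (\<lambda>\<rho>. rec_nat (a \<rho>) (\<lambda>j acc. b j acc \<rho>) (g \<rho>))"
proof (rule comp_fn_recursion[where H = "\<lambda>j \<rho>. rec_nat (a \<rho>) (\<lambda>j acc. b j acc \<rho>) j"])
  obtain r where r: "\<And>\<rho>. eval r (map \<rho> [0..<Suc (Suc n)]) = Some (b (\<rho> 0) (\<rho> (Suc 0)) (\<lambda>i. \<rho> (Suc (Suc i))))"
    using assms(2) by (auto simp: comp_fn_def)
  have "eval r (j # acc # map \<rho> [0..<n]) = Some (b j acc \<rho>)" for j acc \<rho>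
    using r[of "case_nat j (case_nat acc \<rho>)"] unfolding map_case_nat_upt by simp
  then show "\<exists>r. \<forall>\<rho> j. eval r (j # rec_nat (a \<rho>) (\<lambda>j acc. b j acc \<rho>) j # map \<rho> [0..<n]) =
      Some (rec_nat (a \<rho>) (\<lambda>j acc. b j acc \<rho>) (Suc j))"
    by auto
qed (use assms in simp_all)

text \<open>\<open>Mu\<close> searches for a zero, so \<open>P\<close> is the negation of the
  property sought. The search may diverge, hence a value is claimed only where a witness
  exists.\<close>

lemma comp_fn_Mu:
  assumes "comp_fn (Suc n) (\<lambda>\<rho>. of_bool (P (\<rho> 0) (\<lambda>i. \<rho> (Suc i))))"
  shows "\<exists>r. \<forall>\<rho>. (\<exists>m. \<not> P m \<rho>) \<longrightarrow> eval r (map \<rho> [0..<n]) = Some (LEAST m. \<not> P m \<rho>)"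
proof -
  obtain r where r: "\<And>\<rho>. eval r (map \<rho> [0..<Suc n]) = Some (of_bool (P (\<rho> 0) (\<lambda>i. \<rho> (Suc i))))"
    using assms by (auto simp: comp_fn_def)
  have "eval r (m # map \<rho> [0..<n]) = Some (of_bool (P m \<rho>))" for m \<rho>
    using r[of "case_nat m \<rho>"] unfolding map_case_nat_upt by simp
  then show ?thesis
    by (intro exI[of _ "Mu r"]) auto
qed

section \<open>Arithmetic, comparisons and bounded quantifiers\<close>

lemma comp_fn_add: "comp_fn n f \<Longrightarrow> comp_fn n g \<Longrightarrow> comp_fn n (\<lambda>\<rho>. f \<rho> + g \<rho>)"
proof (rule comp_fn_app2[where h = "(+)"])
  have "rec_nat x (\<lambda>_. Suc) y = x + y" for x y by (induction y) auto
  moreover have "comp_fn 2 (\<lambda>\<rho>. rec_nat (\<rho> 0) (\<lambda>_ acc. Suc acc) (\<rho> 1))"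
    by (intro comp_fn_rec_nat comp_fn_Suc comp_fn_var) auto
  ultimately show "comp_fn 2 (\<lambda>\<rho>. \<rho> 0 + \<rho> 1)" by simp
qed

lemma comp_fn_mult: "comp_fn n f \<Longrightarrow> comp_fn n g \<Longrightarrow> comp_fn n (\<lambda>\<rho>. f \<rho> * g \<rho>)"
proof (rule comp_fn_app2[where h = times])
  have "rec_nat 0 (\<lambda>_ acc. acc + x) y = x * y" for x y :: nat by (induction y) auto
  moreover have "comp_fn 2 (\<lambda>\<rho>. rec_nat 0 (\<lambda>_ acc. acc + \<rho> 0) (\<rho> 1))"
    by (intro comp_fn_rec_nat comp_fn_add comp_fn_var comp_fn_const) auto
  ultimately show "comp_fn 2 (\<lambda>\<rho>. \<rho> 0 * \<rho> 1)" by simp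
qed

lemma comp_fn_power: "comp_fn n f \<Longrightarrow> comp_fn n g \<Longrightarrow> comp_fn n (\<lambda>\<rho>. f \<rho> ^ g \<rho>)"
proof (rule comp_fn_app2[where h = "(^)"])
  have "rec_nat 1 (\<lambda>_ acc. acc * x) y = x ^ y" for x y :: nat by (induction y) auto
  moreover have "comp_fn 2 (\<lambda>\<rho>. rec_nat 1 (\<lambda>_ acc. acc * \<rho> 0) (\<rho> 1))"
    by (intro comp_fn_rec_nat comp_fn_mult comp_fn_var comp_fn_const) auto
  ultimately show "comp_fn 2 (\<lambda>\<rho>. \<rho> 0 ^ \<rho> 1)" by simp
qed

lemma comp_fn_diff: "comp_fn n f \<Longrightarrow> comp_fn n g \<Longrightarrow> comp_fn n (\<lambda>\<rho>. f \<rho> - g \<rho>)"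
proof (rule comp_fn_app2[where h = "(-)"])
  have pred: "rec_nat 0 (\<lambda>j _. j) x = x - 1" for x by (cases x) auto
  have "comp_fn 1 (\<lambda>\<rho>. rec_nat 0 (\<lambda>j _. j) (\<rho> 0))"
    by (intro comp_fn_rec_nat comp_fn_var comp_fn_const) auto
  then have pred': "comp_fn k h \<Longrightarrow> comp_fn k (\<lambda>\<rho>. h \<rho> - 1)" for k h
    unfolding pred by (rule comp_fn_app1[where h = "\<lambda>x. x - 1"])
  have "rec_nat x (\<lambda>_ acc. acc - 1) y = x - y" for x y :: nat by (induction y) auto
  moreover have "comp_fn 2 (\<lambda>\<rho>. rec_nat (\<rho> 0) (\<lambda>_ acc. acc - 1) (\<rho> 1))"
    by (intro comp_fn_rec_nat pred' comp_fn_var) auto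
  ultimately show "comp_fn 2 (\<lambda>\<rho>. \<rho> 0 - \<rho> 1)" by simp
qed

lemma comp_pred_not: "comp_pred n P \<Longrightarrow> comp_pred n (\<lambda>\<rho>. \<not> P \<rho>)"
proof -
  assume "comp_pred n P"
  then have "comp_fn n (\<lambda>\<rho>. 1 - of_bool (P \<rho>))"
    by (intro comp_fn_diff comp_fn_const)
  moreover have "1 - of_bool (P \<rho>) = (of_bool (\<not> P \<rho>) :: nat)" for \<rho> by auto
  ultimately show ?thesis by simp
qed

lemma comp_pred_conj: "comp_pred n P \<Longrightarrow> comp_pred n Q \<Longrightarrow> comp_pred n (\<lambda>\<rho>. P \<rho> \<and> Q \<rho>)"
  unfolding of_bool_conj by (rule comp_fn_mult)

lemma comp_pred_disj: "comp_pred n P \<Longrightarrow> comp_pred n Q \<Longrightarrow> comp_pred n (\<lambda>\<rho>. P \<rho> \<or> Q \<rho>)"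
  using comp_pred_not[OF comp_pred_conj[OF comp_pred_not comp_pred_not], of n P Q] by simp

lemma comp_pred_imp: "comp_pred n P \<Longrightarrow> comp_pred n Q \<Longrightarrow> comp_pred n (\<lambda>\<rho>. P \<rho> \<longrightarrow> Q \<rho>)"
  unfolding imp_conv_disj by (intro comp_pred_disj comp_pred_not)

lemma comp_pred_le: "comp_fn n f \<Longrightarrow> comp_fn n g \<Longrightarrow> comp_pred n (\<lambda>\<rho>. f \<rho> \<le> g \<rho>)"
proof -
  assume "comp_fn n f" "comp_fn n g"
  then have "comp_fn n (\<lambda>\<rho>. 1 - (f \<rho> - g \<rho>))"
    by (intro comp_fn_diff comp_fn_const)
  moreover have "1 - (f \<rho> - g \<rho>) = of_bool (f \<rho> \<le> g \<rho>)" for \<rho> by auto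
  ultimately show ?thesis by simp
qed

lemma comp_pred_eq: "comp_fn n f \<Longrightarrow> comp_fn n g \<Longrightarrow> comp_pred n (\<lambda>\<rho>. f \<rho> = g \<rho>)"
  unfolding eq_iff by (intro comp_pred_conj comp_pred_le)

lemma comp_pred_less: "comp_fn n f \<Longrightarrow> comp_fn n g \<Longrightarrow> comp_pred n (\<lambda>\<rho>. f \<rho> < g \<rho>)"
  unfolding less_le_not_le by (intro comp_pred_conj comp_pred_le comp_pred_not)

lemma comp_fn_sum:
  assumes "comp_fn (Suc n) (\<lambda>\<rho>. f (\<rho> 0) (\<lambda>i. \<rho> (Suc i)))" "comp_fn n g"
  shows "comp_fn n (\<lambda>\<rho>. \<Sum>j<g \<rho>. f j \<rho>)"
proof -
  obtain r where r: "\<And>\<rho>. eval r (map \<rho> [0..<Suc n]) = Some (f (\<rho> 0) (\<lambda>i. \<rho> (Suc i)))"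
    using assms(1) by (auto simp: comp_fn_def)
  have r': "eval r (j # map \<rho> [0..<n]) = Some (f j \<rho>)" for j \<rho>
    using r[of "case_nat j \<rho>"] unfolding map_case_nat_upt by simp
  \<comment> \<open>In the recursion step variable 1 is the accumulator, which \<open>f\<close> must
    not see; the projections from 2 on skip it.\<close>
  have shift: "comp_fn (Suc (Suc n)) (\<lambda>\<rho>. f (\<rho> 0) (\<lambda>i. \<rho> (Suc (Suc i))))"
    unfolding comp_fn_def
  proof (rule exI[of _ "Comp r (Proj 0 # map Proj [2..<Suc (Suc n)])"], rule allI)
    fix \<rho> :: "nat \<Rightarrow> nat"
    have "map ((\<lambda>t. the (eval t (map \<rho> [0..<Suc (Suc n)]))) \<circ> Proj) [2..<Suc (Suc n)] = map \<rho> [2..<Suc (Suc n)]"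
      by (rule map_cong[OF refl]) (auto simp del: upt_Suc)
    also have "\<dots> = map (\<lambda>i. \<rho> (Suc (Suc i))) [0..<n]"
      by (rule nth_equalityI) (auto simp del: upt_Suc)
    finally show "eval (Comp r (Proj 0 # map Proj [2..<Suc (Suc n)])) (map \<rho> [0..<Suc (Suc n)])
        = Some (f (\<rho> 0) (\<lambda>i. \<rho> (Suc (Suc i))))"
      using r'[of "\<rho> 0" "\<lambda>i. \<rho> (Suc (Suc i))"] by (auto simp del: upt_Suc)
  qed
  have "comp_fn n (\<lambda>\<rho>. rec_nat 0 (\<lambda>j acc. acc + f j \<rho>) (g \<rho>))"
    by (intro comp_fn_rec_nat comp_fn_add comp_fn_var comp_fn_const shift assms) auto
  moreover have "rec_nat 0 (\<lambda>j acc. acc + f j \<rho>) m = (\<Sum>j<m. f j \<rho>)" for m \<rho>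
    by (induction m) (auto simp: add.commute)
  ultimately show ?thesis by simp
qed

lemma comp_pred_bex:
  assumes "comp_pred (Suc n) (\<lambda>\<rho>. P (\<rho> 0) (\<lambda>i. \<rho> (Suc i)))" "comp_fn n g"
  shows "comp_pred n (\<lambda>\<rho>. \<exists>j<g \<rho>. P j \<rho>)"
proof -
  have eq: "(\<exists>j<m. P j \<rho>) \<longleftrightarrow> \<not> (\<Sum>j<m. of_bool (P j \<rho>)) = (0::nat)" for m \<rho>
    by (subst sum_eq_0_iff) auto
  show ?thesis
    unfolding eq by (rule comp_pred_not, rule comp_pred_eq, rule comp_fn_sum)
      (rule assms comp_fn_const)+
qed

lemma comp_pred_ball:
  assumes "comp_pred (Suc n) (\<lambda>\<rho>. P (\<rho> 0) (\<lambda>i. \<rho> (Suc i)))" "comp_fn n g"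
  shows "comp_pred n (\<lambda>\<rho>. \<forall>j<g \<rho>. P j \<rho>)"
  using comp_pred_not[OF comp_pred_bex[OF comp_pred_not[OF assms(1)] assms(2)]] by simp

lemma comp_pred_finite_Bex:
  assumes "finite M" "\<And>x. x \<in> M \<Longrightarrow> comp_pred n (P x)"
  shows "comp_pred n (\<lambda>\<rho>. \<exists>x\<in>M. P x \<rho>)"
  using assms
proof (induction M rule: finite_induct)
  case (insert y M)
  then have "comp_pred n (\<lambda>\<rho>. P y \<rho> \<or> (\<exists>x\<in>M. P x \<rho>))"
    by (intro comp_pred_disj) auto
  then show ?case by (simp only: bex_simps)
qed (simp add: comp_fn_const)

lemma comp_pred_finite_Ball:
  assumes "finite M" "\<And>x. x \<in> M \<Longrightarrow> comp_pred n (P x)"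
  shows "comp_pred n (\<lambda>\<rho>. \<forall>x\<in>M. P x \<rho>)"
  using comp_pred_not[OF comp_pred_finite_Bex[OF assms(1) comp_pred_not[OF assms(2)]]] by simp

lemma comp_pred_in_finite:
  "finite M \<Longrightarrow> comp_fn n f \<Longrightarrow> comp_pred n (\<lambda>\<rho>. f \<rho> \<in> M)"
  using comp_pred_finite_Bex[of M n "\<lambda>x \<rho>. f \<rho> = x"] by (simp add: comp_pred_eq comp_fn_const)

text \<open>A function that is only applied to finitely many values can be hard-wired as a table, so
  \<open>h\<close> itself may be arbitrary. This handles the numbering of the alphabet, about which
  nothing effective is known.\<close>

lemma comp_fn_finite_table:
  assumes "comp_fn n f" and bound: "\<And>\<rho>. f \<rho> < b"
  shows "comp_fn n (\<lambda>\<rho>. h (f \<rho>))"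
proof -
  have "comp_fn n (\<lambda>\<rho>. \<Sum>x<m. of_bool (f \<rho> = x) * h x)" for m
    by (induction m) (auto intro!: comp_fn_add comp_fn_mult comp_pred_eq comp_fn_const assms)
  then have "comp_fn n (\<lambda>\<rho>. \<Sum>x<b. of_bool (f \<rho> = x) * h x)" .
  moreover have "(\<Sum>x<b. of_bool (f \<rho> = x) * h x) = h (f \<rho>)" for \<rho>
    using bound[of \<rho>] by (subst sum.remove[of _ "f \<rho>"]) (auto intro!: sum.neutral)
  ultimately show ?thesis by (simp only:)
qed

lemma comp_fn_div: "comp_fn n f \<Longrightarrow> comp_fn n g \<Longrightarrow> comp_fn n (\<lambda>\<rho>. f \<rho> div g \<rho>)"
proof (rule comp_fn_app2[where h = "(div)"])
  \<comment> \<open>The quotient counts the positive multiples of \<open>y\<close> up to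
    \<open>x\<close>; the guard \<open>0 < y\<close> reproduces the convention that division by 0
    gives 0.\<close>
  have eq: "(\<Sum>j<x. of_bool (0 < y \<and> Suc j * y \<le> x)) = x div y" for x y :: nat
  proof (cases "y = 0")
    case False
    then have "Suc j * y \<le> x \<longleftrightarrow> j < x div y" for j
      by (metis Suc_le_eq less_eq_div_iff_mult_less_eq neq0_conv)
    moreover have "j < x div y \<Longrightarrow> j < x" for j
      by (meson div_le_dividend less_le_trans)
    ultimately have "{..<x} \<inter> {j. 0 < y \<and> Suc j * y \<le> x} = {..<x div y}"
      using False by auto
    then show ?thesis by simp
  qed simp
  have "comp_fn 2 (\<lambda>\<rho>. \<Sum>j<\<rho> 0. of_bool (0 < \<rho> 1 \<and> Suc j * \<rho> 1 \<le> \<rho> 0))"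
    by (intro comp_fn_sum comp_pred_conj comp_pred_less comp_pred_le comp_fn_mult comp_fn_Suc
        comp_fn_var comp_fn_const) auto
  then show "comp_fn 2 (\<lambda>\<rho>. \<rho> 0 div \<rho> 1)" by (simp only: eq)
qed

lemma comp_fn_mod: "comp_fn n f \<Longrightarrow> comp_fn n g \<Longrightarrow> comp_fn n (\<lambda>\<rho>. f \<rho> mod g \<rho>)"
  unfolding minus_mult_div_eq_mod[symmetric] by (intro comp_fn_diff comp_fn_mult comp_fn_div)

lemma comp_pred_set_decode:
  "comp_fn n f \<Longrightarrow> comp_fn n g \<Longrightarrow> comp_pred n (\<lambda>\<rho>. f \<rho> \<in> set_decode (g \<rho>))"
  unfolding set_decode_def mem_Collect_eq odd_iff_mod_2_eq_one
  by (intro comp_pred_eq comp_fn_mod comp_fn_div comp_fn_power comp_fn_const)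

lemmas comp_intros = comp_fn_add comp_fn_mult comp_fn_power comp_fn_diff comp_fn_div comp_fn_mod
  comp_fn_Suc comp_fn_sum comp_pred_conj comp_pred_disj comp_pred_imp comp_pred_not comp_pred_le
  comp_pred_less comp_pred_eq comp_pred_bex comp_pred_ball comp_pred_set_decode
  comp_fn_var comp_fn_const

text \<open>\<open>Comp\<close> is strict, so both branches must be defined on the actual arguments.
  The rules for total functions do not cover this use, because the update program of an enumeration
  is specified only on codes.\<close>

lemma eval_if:
  assumes "comp_pred n P"
  shows "\<exists>r. \<forall>\<rho> y z. eval r1 (map \<rho> [0..<n]) = Some y \<longrightarrow> eval r2 (map \<rho> [0..<n]) = Some z \<longrightarrow>
    eval r (map \<rho> [0..<n]) = Some (if P \<rho> then y else z)"
proof -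
  obtain rP where rP: "\<And>\<rho>. eval rP (map \<rho> [0..<n]) = Some (of_bool (P \<rho>))"
    using assms by (auto simp: comp_fn_def)
  have "comp_fn 3 (\<lambda>\<rho>. \<rho> 0 * \<rho> 1 + (1 - \<rho> 0) * \<rho> 2)"
    by (intro comp_intros) auto
  then obtain ri where ri: "\<And>\<rho>. eval ri (map \<rho> [0..<3]) = Some (\<rho> 0 * \<rho> 1 + (1 - \<rho> 0) * \<rho> 2)"
    by (auto simp: comp_fn_def)
  have ri': "eval ri [x, y, z] = Some (x * y + (1 - x) * z)" for x y z
    using ri[of "\<lambda>i. [x, y, z] ! i"] by (simp add: upt_rec)
  show ?thesis
    by (rule exI[of _ "Comp ri [rP, r1, r2]"]) (auto simp: rP ri')
qed

lemma map_case_nat_upt2: "map (case_nat x (case_nat y \<rho>)) [0..<Suc (Suc n)] = x # y # map \<rho> [0..<n]"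
  by (simp only: map_case_nat_upt)

lemma set_decode_less: "u \<in> set_decode k \<Longrightarrow> u < k"
proof -
  assume "u \<in> set_decode k"
  then have "odd (k div 2 ^ u)" by (simp add: set_decode_def)
  then have "k div 2 ^ u \<noteq> 0" by (metis even_zero)
  then have "2 ^ u \<le> k" by (simp add: div_eq_0_iff)
  with less_exp[of u] show ?thesis by (rule less_le_trans)
qed

text \<open>An enumeration offers only the insertion of single elements, so the code is built up by
  running through the numbers below the canonical binary code. That many steps suffice, since every
  element of a set is smaller than its binary code.\<close>

lemma comp_fn_set_code:
  assumes "finite_set_enumeration q"
  shows "comp_fn 1 (\<lambda>\<rho>. q (set_decode (\<rho> 0)))"
proof -
  define H where "H j \<rho> = q (set_decode (\<rho> 0) \<inter> {..<j})" for j and \<rho> :: "nat \<Rightarrow> nat"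
  obtain rq where rq: "\<And>w u. finite w \<Longrightarrow> eval rq [q w, u] = Some (q (w \<union> {u}))"
    using assms by (auto simp: finite_set_enumeration_def)
  have "comp_pred 3 (\<lambda>\<rho>. \<rho> 0 \<in> set_decode (\<rho> 2))"
    by (intro comp_intros) auto
  from eval_if[OF this, of "Comp rq [Proj 1, Proj 0]" "Proj 1"]
  obtain r where r: "\<And>\<rho> y z. eval (Comp rq [Proj 1, Proj 0]) (map \<rho> [0..<3]) = Some y \<Longrightarrow>
      eval (Proj 1) (map \<rho> [0..<3]) = Some z \<Longrightarrow>
      eval r (map \<rho> [0..<3]) = Some (if \<rho> 0 \<in> set_decode (\<rho> 2) then y else z)"
    by blast
  have step: "eval r (j # H j \<rho> # map \<rho> [0..<1]) = Some (H (Suc j) \<rho>)" for \<rho> j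
  proof -
    have *: "map (case_nat j (case_nat (H j \<rho>) \<rho>)) [0..<3] = j # H j \<rho> # map \<rho> [0..<1]"
      using map_case_nat_upt2[of j "H j \<rho>" \<rho> 1] by (simp add: numeral_3_eq_3)
    have "eval r (j # H j \<rho> # map \<rho> [0..<1]) = Some (if j \<in> set_decode (\<rho> 0)
        then q ((set_decode (\<rho> 0) \<inter> {..<j}) \<union> {j}) else H j \<rho>)"
      using r[of "case_nat j (case_nat (H j \<rho>) \<rho>)"] unfolding *
      by (simp add: H_def rq numeral_2_eq_2)
    also have "\<dots> = Some (H (Suc j) \<rho>)"
      by (auto simp: H_def lessThan_Suc)
    finally show ?thesis .
  qed
  have "comp_fn 1 (\<lambda>\<rho>. H (\<rho> 0) \<rho>)"
  proof (rule comp_fn_recursion[where H = H])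
    have "H 0 = (\<lambda>_. q {})" by (simp add: H_def fun_eq_iff)
    then show "comp_fn 1 (H 0)" by (simp only: comp_fn_const)
    show "\<exists>r. \<forall>\<rho> j. eval r (j # H j \<rho> # map \<rho> [0..<1]) = Some (H (Suc j) \<rho>)"
      using step by blast
  qed (simp add: comp_fn_var)
  moreover have "set_decode k \<inter> {..<k} = set_decode k" for k
    using set_decode_less by auto
  ultimately show ?thesis by (simp add: H_def)
qed

section \<open>Words as numbers in base b, and codes of partial maps\<close>

definition digit :: "nat \<Rightarrow> nat \<Rightarrow> nat \<Rightarrow> nat" where
  "digit b m u = m div b ^ u mod b"

lemma exists_digits:
  assumes "\<And>u. u < n \<Longrightarrow> d u < b" "0 < b"
  shows "\<exists>m < b ^ n. \<forall>u<n. digit b m u = d u"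
  using assms(1)
proof (induction n)
  case 0
  then show ?case by simp
next
  case (Suc n)
  then obtain m where m: "m < b ^ n" "\<And>u. u < n \<Longrightarrow> digit b m u = d u"
    by (auto simp: less_Suc_eq)
  define m' where "m' = m + d n * b ^ n"
  have "m' < b ^ n + d n * b ^ n" using m by (simp add: m'_def)
  also have "\<dots> = Suc (d n) * b ^ n" by simp
  also have "\<dots> \<le> b * b ^ n" using Suc.prems[of n] by (intro mult_right_mono) auto
  finally have "m' < b ^ Suc n" by simp
  moreover have "digit b m' u = d u" if "u < Suc n" for u
  proof (cases "u = n")
    case True
    have "m' div b ^ n = d n" using m(1) assms(2) by (simp add: m'_def)
    then show ?thesis using True Suc.prems[of n] by (simp add: digit_def)
  next
    case False
    then have u: "u < n" using that by simp
    then have "b ^ n = b ^ u * (b * b ^ (n - Suc u))"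
      by (metis Suc_leI add_diff_inverse_nat linorder_not_le power_Suc power_Suc2 power_add mult.assoc)
    then have "m' = m + b ^ u * (b * (b ^ (n - Suc u) * d n))"
      by (simp add: m'_def mult.commute mult.left_commute)
    then have "m' div b ^ u = m div b ^ u + b * (b ^ (n - Suc u) * d n)"
      using assms(2) by simp
    then show ?thesis using m(2)[OF u] by (simp add: digit_def)
  qed
  ultimately show ?case by blast
qed

lemma comp_fn_digit:
  "comp_fn n f \<Longrightarrow> comp_fn n g \<Longrightarrow> comp_fn n (\<lambda>\<rho>. digit b (f \<rho>) (g \<rho>))"
  unfolding digit_def by (intro comp_fn_mod comp_fn_div comp_fn_power comp_fn_const)

text \<open>A finite pattern is presented by two numbers, the binary code of its domain and a number
  whose base \<open>b\<close> digits name the symbols; its code arises by one update per point of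
  the domain.\<close>

lemma comp_fn_map_code:
  fixes q :: "(nat \<Rightarrow> 'a option) \<Rightarrow> nat"
  assumes "finite_map_enumeration A q" and b: "0 < b" and al: "\<And>d. d < b \<Longrightarrow> al d \<in> A"
  shows "comp_fn 2 (\<lambda>\<rho>. q (pr (set_decode (\<rho> 0)) (\<lambda>u. al (digit b (\<rho> 1) u))))"
proof -
  define x where "x m = (\<lambda>u. al (digit b m u))" for m
  have digit: "digit b m u < b" for m u using b by (simp add: digit_def)
  have x: "range (x m) \<subseteq> A" for m using al digit by (auto simp: x_def)
  define H where "H j \<rho> = q (pr (set_decode (\<rho> 0) \<inter> {..<j}) (x (\<rho> 1)))" for j and \<rho> :: "nat \<Rightarrow> nat"
  obtain e rq where rq: "\<And>t u a. t \<in> finite_maps A \<Longrightarrow> a \<in> A \<Longrightarrow> eval rq [q t, u, e a] = Some (q (t(u \<mapsto> a)))"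
    using assms(1) unfolding finite_map_enumeration_def by metis
  have "comp_fn 4 (\<lambda>\<rho>. digit b (\<rho> 3) (\<rho> 0))"
    by (intro comp_fn_digit comp_intros) auto
  \<comment> \<open>The numbering \<open>e\<close> composed with \<open>al\<close> is an arbitrary
    function on \<open>b\<close> values, hence a finite table.\<close>
  then have "comp_fn 4 (\<lambda>\<rho>. (\<lambda>d. e (al d)) (digit b (\<rho> 3) (\<rho> 0)))"
    by (rule comp_fn_finite_table) (rule digit)
  then obtain rd where rd: "\<And>\<rho>. eval rd (map \<rho> [0..<4]) = Some (e (x (\<rho> 3) (\<rho> 0)))"
    by (auto simp: comp_fn_def x_def)
  have "comp_pred 4 (\<lambda>\<rho>. \<rho> 0 \<in> set_decode (\<rho> 2))"
    by (intro comp_intros) auto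
  from eval_if[OF this, of "Comp rq [Proj 1, Proj 0, rd]" "Proj 1"]
  obtain r where r: "\<And>\<rho> y z. eval (Comp rq [Proj 1, Proj 0, rd]) (map \<rho> [0..<4]) = Some y \<Longrightarrow>
      eval (Proj 1) (map \<rho> [0..<4]) = Some z \<Longrightarrow>
      eval r (map \<rho> [0..<4]) = Some (if \<rho> 0 \<in> set_decode (\<rho> 2) then y else z)"
    by blast
  have step: "eval r (j # H j \<rho> # map \<rho> [0..<2]) = Some (H (Suc j) \<rho>)" for \<rho> j
  proof -
    define E where "E = set_decode (\<rho> 0) \<inter> {..<j}"
    have *: "map (case_nat j (case_nat (H j \<rho>) \<rho>)) [0..<4] = j # H j \<rho> # map \<rho> [0..<2]"
      using map_case_nat_upt2[of j "H j \<rho>" \<rho> 2] by (simp add: eval_nat_numeral)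
    have rd': "eval rd (j # H j \<rho> # map \<rho> [0..<2]) = Some (e (x (\<rho> 1) j))"
      using rd[of "case_nat j (case_nat (H j \<rho>) \<rho>)"] unfolding * by (simp add: eval_nat_numeral)
    have E: "pr E (x (\<rho> 1)) \<in> finite_maps A"
      by (rule pr_in_finite_maps) (simp add: E_def, rule x)
    have "x (\<rho> 1) j \<in> A" using x by blast
    define xs where "xs = j # H j \<rho> # map \<rho> [0..<2]"
    have "eval (Comp rq [Proj 1, Proj 0, rd]) xs = Some (q ((pr E (x (\<rho> 1)))(j \<mapsto> x (\<rho> 1) j)))"
    proof -
      have "xs ! 0 = j" "xs ! 1 = q (pr E (x (\<rho> 1)))" "2 < length xs" "xs \<noteq> []"
        by (simp_all add: xs_def H_def E_def)
      then show ?thesis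
        using rd' rq[OF E \<open>x (\<rho> 1) j \<in> A\<close>, of j] by (simp flip: xs_def)
    qed
    moreover have "eval (Proj 1) xs = Some (H j \<rho>)" by (simp add: xs_def)
    ultimately have "eval r (j # H j \<rho> # map \<rho> [0..<2]) = Some (if j \<in> set_decode (\<rho> 0)
        then q ((pr E (x (\<rho> 1)))(j \<mapsto> x (\<rho> 1) j)) else H j \<rho>)"
      using r[of "case_nat j (case_nat (H j \<rho>) \<rho>)"] unfolding * xs_def[symmetric]
      by (simp add: numeral_2_eq_2)
    also have "\<dots> = Some (H (Suc j) \<rho>)"
    proof (cases "j \<in> set_decode (\<rho> 0)")
      case True
      then have "set_decode (\<rho> 0) \<inter> {..<Suc j} = insert j E" by (auto simp: E_def)
      moreover have "pr (insert j E) y = (pr E y)(j \<mapsto> y j)" for y :: "nat \<Rightarrow> 'a"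
        by (auto simp: pr_def restrict_map_def fun_eq_iff)
      ultimately show ?thesis using True by (simp add: H_def)
    next
      case False
      then have "set_decode (\<rho> 0) \<inter> {..<Suc j} = set_decode (\<rho> 0) \<inter> {..<j}"
        by (auto simp: less_Suc_eq)
      with False show ?thesis by (simp add: H_def)
    qed
    finally show ?thesis .
  qed
  have "comp_fn 2 (\<lambda>\<rho>. H (\<rho> 0) \<rho>)"
  proof (rule comp_fn_recursion[where H = H])
    have empty: "pr {} y = Map.empty" for y :: "nat \<Rightarrow> 'a" by (auto simp: pr_def)
    have "H 0 = (\<lambda>_. q Map.empty)" by (rule ext) (simp only: H_def lessThan_0 Int_empty_right empty)
    then show "comp_fn 2 (H 0)" by (simp only: comp_fn_const)
    show "\<exists>r. \<forall>\<rho> j. eval r (j # H j \<rho> # map \<rho> [0..<2]) = Some (H (Suc j) \<rho>)"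
      using step by blast
  qed (simp add: comp_fn_var)
  moreover have "set_decode k \<inter> {..<k} = set_decode k" for k
    using set_decode_less by auto
  ultimately show ?thesis by (simp add: H_def x_def)
qed

text \<open>A computable substitute for \<open>X\<close>: in the applications \<open>L\<close> is
  the set of patterns of \<open>X\<close> on \<open>S\<close>, and since \<open>S\<close> and
  \<open>L\<close> are finite they can be written into a program. Only windows that lie inside
  \<open>E\<close> are tested, so membership depends on the pattern on \<open>E\<close> alone, apart
  from the range condition.\<close>

definition locally_admissible ::
  "'a set \<Rightarrow> (nat \<Rightarrow> nat \<Rightarrow> nat) \<Rightarrow> nat set \<Rightarrow> (nat \<Rightarrow> 'a option) set \<Rightarrow> nat set \<Rightarrow> (nat \<Rightarrow> 'a) set" where
  "locally_admissible A mu S L E =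
     {x. range x \<subseteq> A \<and> (\<forall>g\<in>E. (\<lambda>s. mu s g) ` S \<subseteq> E \<longrightarrow> pr S (\<lambda>s. x (mu s g)) \<in> L)}"

lemma pr_eq_map_iff: "dom p = S \<Longrightarrow> pr S y = p \<longleftrightarrow> (\<forall>s\<in>S. p s = Some (y s))"
  by (auto simp: pr_def fun_eq_iff restrict_map_def domIff) (metis domI option.inject)

text \<open>The search for a pattern is bounded: all points of the set with binary code
  \<open>k\<close> lie below \<open>k\<close>, so a pattern on it is given by the digits of some
  number below \<open>b ^ Suc k\<close>.\<close>

lemma comp_pred_admissible_code:
  fixes q :: "(nat \<Rightarrow> 'a option) \<Rightarrow> nat"
  assumes q: "finite_map_enumeration A q" and A: "finite A" "A \<noteq> {}"
    and mu: "computable2 mu" and S: "finite S" and L: "finite L" "\<And>p. p \<in> L \<Longrightarrow> dom p = S"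
  shows "comp_pred 2 (\<lambda>\<rho>. \<rho> 1 \<in> q ` pr (set_decode (\<rho> 0)) ` locally_admissible A mu S L (set_decode (\<rho> 0)))"
proof -
  obtain al where al: "bij_betw al {0..<card A} A"
    using ex_bij_betw_nat_finite[OF A(1)] by blast
  define b where "b = card A"
  have b: "0 < b" using A by (simp add: b_def card_gt_0_iff)
  have al_mem: "al d \<in> A" if "d < b" for d
    using al that by (auto simp: bij_betw_def b_def)
  have digit: "digit b m u < b" for m u using b by (simp add: digit_def)
  \<comment> \<open>The digits that agree with \<open>p\<close> at \<open>s\<close>. Membership in
    this finite set replaces a comparison of symbols of \<open>'a\<close>, which a program cannot
    handle directly.\<close>
  define M where "M p s = {d. d < b \<and> p s = Some (al d)}" for p :: "nat \<Rightarrow> 'a option" and s :: nat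
  have M: "finite (M p s)" for p s unfolding M_def by (rule finite_subset[of _ "{..<b}"]) auto
  define V where "V k v = (\<exists>m < b ^ Suc k. q (pr (set_decode k) (\<lambda>u. al (digit b m u))) = v \<and>
      (\<forall>g < Suc k. g \<in> set_decode k \<longrightarrow> (\<forall>s\<in>S. mu s g \<in> set_decode k) \<longrightarrow>
         (\<exists>p\<in>L. \<forall>s\<in>S. digit b m (mu s g) \<in> M p s)))" for k v
  note qmap = comp_fn_app2[where h = "\<lambda>k m. q (pr (set_decode k) (\<lambda>u. al (digit b m u)))",
      OF comp_fn_map_code[OF q b al_mem]]
  note mu' = comp_fn_app2[where h = mu, OF comp_fn_computable2[OF mu]]
  have "comp_pred 2 (\<lambda>\<rho>. V (\<rho> 0) (\<rho> 1))"
    unfolding V_def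
    by (intro comp_pred_bex comp_pred_conj comp_pred_ball comp_pred_imp comp_pred_finite_Ball[OF S]
        comp_pred_finite_Bex[OF L(1)] comp_pred_in_finite[OF M] comp_fn_digit comp_pred_eq qmap mu'
        comp_pred_set_decode comp_fn_power comp_fn_Suc comp_fn_const comp_fn_var) auto
  moreover have "V k v \<longleftrightarrow> v \<in> q ` pr E ` locally_admissible A mu S L E" if E: "E = set_decode k" for k v E
  proof
    assume "V k v"
    then obtain m where m: "q (pr E (\<lambda>u. al (digit b m u))) = v"
      and loc: "\<And>g. g < Suc k \<Longrightarrow> g \<in> E \<Longrightarrow> (\<forall>s\<in>S. mu s g \<in> E) \<Longrightarrow>
        (\<exists>p\<in>L. \<forall>s\<in>S. digit b m (mu s g) \<in> M p s)"
      unfolding V_def E by blast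
    have "(\<lambda>u. al (digit b m u)) \<in> locally_admissible A mu S L E"
      unfolding locally_admissible_def
    proof (intro CollectI conjI ballI impI)
      show "range (\<lambda>u. al (digit b m u)) \<subseteq> A" using al_mem digit by auto
      fix g assume g: "g \<in> E" "(\<lambda>s. mu s g) ` S \<subseteq> E"
      then have "g < Suc k" using set_decode_less E by (simp add: less_SucI)
      then obtain p where "p \<in> L" "\<forall>s\<in>S. digit b m (mu s g) \<in> M p s"
        using loc g by blast
      moreover from this have "pr S (\<lambda>s. al (digit b m (mu s g))) = p"
        using pr_eq_map_iff[OF L(2)] by (auto simp: M_def)
      ultimately show "pr S (\<lambda>s. al (digit b m (mu s g))) \<in> L" by simp
    qed
    then show "v \<in> q ` pr E ` locally_admissible A mu S L E" using m by blast
  next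
    assume "v \<in> q ` pr E ` locally_admissible A mu S L E"
    then obtain x where x: "range x \<subseteq> A" "v = q (pr E x)"
      and loc: "\<And>g. g \<in> E \<Longrightarrow> (\<lambda>s. mu s g) ` S \<subseteq> E \<Longrightarrow> pr S (\<lambda>s. x (mu s g)) \<in> L"
      by (auto simp: locally_admissible_def)
    define d where "d u = the_inv_into {0..<b} al (x u)" for u
    have alA: "inj_on al {0..<b}" "al ` {0..<b} = A" using al by (auto simp: bij_betw_def b_def)
    have xA: "x u \<in> al ` {0..<b}" for u using x alA by auto
    have d: "d u < b" "al (d u) = x u" for u
      using the_inv_into_into[OF alA(1) xA subset_refl, of u] f_the_inv_into_f[OF alA(1) xA, of u]
      by (auto simp: d_def)
    obtain m where m: "m < b ^ Suc k" "\<And>u. u < Suc k \<Longrightarrow> digit b m u = d u"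
      using exists_digits[of "Suc k" d b] d b by blast
    have xm: "al (digit b m u) = x u" if "u \<in> E" for u
      using that m(2)[of u] d set_decode_less[of u k] E by simp
    have "pr E (\<lambda>u. al (digit b m u)) = pr E x" using xm by (simp add: pr_eq_iff)
    moreover have "\<exists>p\<in>L. \<forall>s\<in>S. digit b m (mu s g) \<in> M p s" if g: "g \<in> E" "\<forall>s\<in>S. mu s g \<in> E" for g
    proof
      show "pr S (\<lambda>s. x (mu s g)) \<in> L" by (rule loc) (use g in auto)
      show "\<forall>s\<in>S. digit b m (mu s g) \<in> M (pr S (\<lambda>s. x (mu s g))) s"
        using g xm digit by (auto simp: M_def pr_def)
    qed
    ultimately show "V k v" unfolding V_def E[symmetric] using m(1) x(2) by auto
  qed
  ultimately show ?thesis by simp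
qed

section \<open>Decompression of locally admissible patterns\<close>

lemma complexity_le: "f y = Some x \<Longrightarrow> complexity f x \<le> enat (length y)"
  unfolding complexity_def by (rule INF_lower) simp

lemma complexity_attained:
  assumes "complexity f x = enat m"
  obtains y where "f y = Some x" "length y = m"
proof -
  let ?Z = "(\<lambda>y. enat (length y)) ` {y. f y = Some x}"
  have "?Z \<noteq> {}"
  proof
    assume "?Z = {}"
    then have "complexity f x = \<infinity>"
      unfolding complexity_def by (simp only: Inf_enat_def) simp
    with assms show False by simp
  qed
  then have "Inf ?Z \<in> ?Z"
    unfolding Inf_enat_def by (simp only: if_False) (metis LeastI ex_in_conv)
  then have "enat m \<in> ?Z" using assms by (simp add: complexity_def)
  then show thesis using that by auto
qed

lemma str_index_inv: "str_index (inv_into UNIV str_index n) = n"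
  using bij_str_index by (simp add: bij_is_surj surj_f_inv_f)

text \<open>A self-delimiting pairing of \<open>P < 2 ^ l\<close> with \<open>n\<close>: the lowest nonzero binary digit
  of the pair marks \<open>l\<close>, which costs about \<open>2 * l + log 2 n\<close> digits in total.\<close>

definition pair_code :: "nat \<Rightarrow> nat \<Rightarrow> nat \<Rightarrow> nat" where
  "pair_code l P n = 2 ^ l * (2 * (2 ^ l * n + P) + 1)"

text \<open>The exponent of 2 in a positive \<open>z\<close>, written as a bounded sum so that the
  closure rules apply to it.\<close>

definition code_exp :: "nat \<Rightarrow> nat" where
  "code_exp z = (\<Sum>j<z. of_bool (z mod 2 ^ Suc j = 0))"

lemma code_exp_pair_code: "code_exp (pair_code l P n) = l"
proof -
  define z where "z = pair_code l P n"
  have "z mod 2 ^ Suc j = 0 \<longleftrightarrow> j < l" for j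
  proof
    assume "j < l"
    then have "(2::nat) ^ Suc j dvd 2 ^ l" by (intro le_imp_power_dvd) auto
    then show "z mod 2 ^ Suc j = 0" by (simp add: z_def pair_code_def mod_eq_0_iff_dvd)
  next
    assume "z mod 2 ^ Suc j = 0"
    then have dvd: "2 ^ Suc j dvd z" by (simp add: mod_eq_0_iff_dvd)
    show "j < l"
    proof (rule ccontr)
      assume "\<not> j < l"
      then have "(2::nat) ^ Suc l dvd 2 ^ Suc j" by (intro le_imp_power_dvd) auto
      then have "2 ^ l * 2 dvd 2 ^ l * (2 * (2 ^ l * n + P) + 1)"
        using dvd unfolding z_def pair_code_def by (metis dvd_trans power_Suc2)
      then have "2 dvd 2 * (2 ^ l * n + P) + 1" by (subst (asm) nat_mult_dvd_cancel1) auto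
      then show False by simp
    qed
  qed
  moreover have "l < z"
  proof -
    have "l < 2 ^ l" by (rule less_exp)
    also have "2 ^ l * 1 \<le> z" unfolding z_def pair_code_def by (intro mult_le_mono2) simp
    finally show ?thesis by simp
  qed
  then have "{..<z} \<inter> {j. j < l} = {..<l}" by auto
  ultimately show ?thesis by (simp add: code_exp_def flip: z_def)
qed

lemma pair_code_div: "pair_code l P n div 2 ^ Suc l = 2 ^ l * n + P"
proof -
  have "pair_code l P n = 2 ^ l + (2 ^ l * n + P) * 2 ^ Suc l"
    by (simp add: pair_code_def algebra_simps)
  then show ?thesis by simp
qed

lemma comp_fn_code_exp: "comp_fn 1 (\<lambda>\<rho>. code_exp (\<rho> 0))"
  unfolding code_exp_def by (intro comp_intros) auto

lemma pair_code_bound: "P < 2 ^ l \<Longrightarrow> pair_code l P n + 1 \<le> 2 ^ (2 * l + 1) * (n + 1)"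
proof -
  assume P: "P < 2 ^ l"
  define a where "a = (2::nat) ^ l"
  have "a * (2 * P + 2) \<le> a * (2 * a)"
    using P by (intro mult_le_mono2) (simp add: a_def)
  moreover have "1 \<le> a" by (simp add: a_def)
  moreover have "(2::nat) ^ (2 * l + 1) = a * (2 * a)" by (simp add: a_def power_add mult_2 distrib_left)
  moreover have "pair_code l P n = a * (2 * (a * n + P) + 1)" by (simp add: pair_code_def a_def)
  ultimately show ?thesis
    by (simp only: distrib_left distrib_right mult_1_right mult_1_left ac_simps)
qed

text \<open>A member of a decidable set is recovered from the number of smaller members, which is
  how a pattern is named by its rank.\<close>

lemma rank_Least:
  fixes V :: "nat \<Rightarrow> bool"
  assumes "V v"
  shows "(LEAST u. V u \<and> (\<Sum>j<u. of_bool (V j)) = (\<Sum>j<v. of_bool (V j) :: nat)) = v"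
proof (rule Least_equality)
  fix u assume u: "V u \<and> (\<Sum>j<u. of_bool (V j)) = (\<Sum>j<v. of_bool (V j) :: nat)"
  show "v \<le> u"
  proof (rule ccontr)
    assume "\<not> v \<le> u"
    then have "{..<Suc u} \<subseteq> {..<v}" by auto
    then have "(\<Sum>j<Suc u. of_bool (V j) :: nat) \<le> (\<Sum>j<v. of_bool (V j))"
      by (intro sum_mono2) auto
    then show False using u by simp
  qed
qed (use assms in simp)

text \<open>The program first finds the binary code of \<open>E\<close> by trying all codes until
  the enumeration gives \<open>qs E\<close>; injectivity of \<open>qs\<close> makes the hit correct.
  It then searches for the admissible pattern code that has exactly \<open>n\<close> smaller ones.
  The rank \<open>n\<close> is below the number of patterns.\<close>

lemma exists_enumerator:
  fixes qm :: "(nat \<Rightarrow> 'a option) \<Rightarrow> nat"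
  assumes qs: "finite_set_enumeration qs" and qm: "finite_map_enumeration A qm"
    and A: "finite A" "A \<noteq> {}"
    and mu: "computable2 mu" and S: "finite S" and L: "finite L" "\<And>p. p \<in> L \<Longrightarrow> dom p = S"
  shows "\<exists>r. \<forall>E x. finite E \<longrightarrow> x \<in> locally_admissible A mu S L E \<longrightarrow>
    (\<exists>n < npat E (locally_admissible A mu S L E). eval r [qs E, n] = Some (qm (pr E x)))"
proof -
  define V where "V k v \<longleftrightarrow> v \<in> qm ` pr (set_decode k) ` locally_admissible A mu S L (set_decode k)" for k v
  have V: "comp_fn 2 (\<lambda>\<rho>. of_bool (V (\<rho> 0) (\<rho> 1)))"
    unfolding V_def by (rule comp_pred_admissible_code[OF qm A mu S L])
  note V' = comp_fn_app2[where h = "\<lambda>k v. of_bool (V k v)", OF V]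
  have "comp_fn (Suc 1) (\<lambda>\<rho>. of_bool (qs (set_decode (\<rho> 0)) \<noteq> \<rho> (Suc 0)))"
    by (intro comp_pred_not comp_pred_eq
        comp_fn_app1[where h = "\<lambda>k. qs (set_decode k)", OF comp_fn_set_code[OF qs]] comp_fn_var) auto
  from comp_fn_Mu[where P = "\<lambda>k \<rho>. qs (set_decode k) \<noteq> \<rho> 0", OF this]
  obtain r1 where r1: "\<And>\<rho>. \<exists>k. qs (set_decode k) = \<rho> 0 \<Longrightarrow>
      eval r1 (map \<rho> [0..<1]) = Some (LEAST k. qs (set_decode k) = \<rho> 0)"
    by auto
  have r1': "eval r1 [qs E] = Some (set_encode E)" if E: "finite E" for E
  proof -
    have inj: "inj_on qs {w. finite w}" using qs by (simp add: finite_set_enumeration_def)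
    then have "(qs (set_decode k) = qs E) = (k = set_encode E)" for k
      using E by (auto simp: inj_on_eq_iff)
    then have "(LEAST k. qs (set_decode k) = qs E) = set_encode E"
      by (simp add: Least_equality)
    moreover have "\<exists>k. qs (set_decode k) = qs E"
      using E by (intro exI[of _ "set_encode E"]) simp
    ultimately show ?thesis using r1[of "\<lambda>_. qs E"] by simp
  qed
  define R where "R k v = (\<Sum>j<v. of_bool (V k j) :: nat)" for k v
  have "comp_fn (Suc 2) (\<lambda>\<rho>. of_bool (\<not> (V (\<rho> 1) (\<rho> 0) \<and> R (\<rho> 1) (\<rho> 0) = \<rho> (Suc 1))))"
    unfolding R_def
    by (intro comp_pred_not comp_pred_eq comp_pred_conj comp_fn_sum V' comp_fn_var) auto
  then have "comp_fn (Suc 2) (\<lambda>\<rho>. of_bool (\<not> (V (\<rho> (Suc 0)) (\<rho> 0) \<and> R (\<rho> (Suc 0)) (\<rho> 0) = \<rho> (Suc 1))))"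
    by simp
  from comp_fn_Mu[where P = "\<lambda>v \<rho>. \<not> (V (\<rho> 0) v \<and> R (\<rho> 0) v = \<rho> 1)", OF this]
  obtain r2 where r2: "\<And>\<rho>. \<exists>v. V (\<rho> 0) v \<and> R (\<rho> 0) v = \<rho> 1 \<Longrightarrow>
      eval r2 (map \<rho> [0..<2]) = Some (LEAST v. V (\<rho> 0) v \<and> R (\<rho> 0) v = \<rho> 1)"
    by auto
  have r2': "eval r2 [k, R k v] = Some v" if "V k v" for k v
  proof -
    have "(LEAST u. V k u \<and> R k u = R k v) = v"
      unfolding R_def by (rule rank_Least[of "V k", OF that])
    then show ?thesis using r2[of "\<lambda>i. [k, R k v] ! i"] that by (auto simp: upt_rec)
  qed
  show ?thesis
  proof (intro exI[of _ "Comp r2 [Comp r1 [Proj 0], Proj 1]"] allI impI)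
    fix E x assume E: "finite E" and x: "x \<in> locally_admissible A mu S L E"
    define k where "k = set_encode E"
    define v where "v = qm (pr E x)"
    have V_iff: "V k u \<longleftrightarrow> u \<in> qm ` pr E ` locally_admissible A mu S L E" for u
      unfolding V_def k_def using E by simp
    then have v: "V k v" using x by (auto simp: v_def)
    have rg: "range y \<subseteq> A" if "y \<in> locally_admissible A mu S L E" for y
      using that by (simp add: locally_admissible_def)
    have fin: "finite (pr E ` locally_admissible A mu S L E)"
      by (rule finite_pr_image[OF E A(1) rg])
    have "R k v = card ({..<v} \<inter> {j. V k j})" by (simp add: R_def)
    also have "\<dots> < card (qm ` pr E ` locally_admissible A mu S L E)"
      by (rule psubset_card_mono) (use fin v V_iff in auto)
    also have "\<dots> \<le> npat E (locally_admissible A mu S L E)"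
      unfolding npat_def by (rule card_image_le[OF fin])
    finally show "\<exists>n < npat E (locally_admissible A mu S L E).
        eval (Comp r2 [Comp r1 [Proj 0], Proj 1]) [qs E, n] = Some (qm (pr E x))"
      using r1'[OF E] r2'[OF v] by (intro exI[of _ "R k v"]) (auto simp: k_def v_def)
  qed
qed

text \<open>A pattern is described by a shortest program for \<open>E\<close> together with its rank
  among the admissible patterns on \<open>E\<close>. The program must be self-delimiting, whence the
  factor 2 in front of \<open>m\<close>; the passage from this decompressor to the optimal
  \<open>f\<close> costs a constant.\<close>

theorem complexity_pattern_le:
  fixes qm :: "(nat \<Rightarrow> 'a option) \<Rightarrow> nat"
  assumes f: "optimal f"
    and qs: "finite_set_enumeration qs" and qm: "finite_map_enumeration A qm"
    and A: "finite A" "A \<noteq> {}"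
    and mu: "computable2 mu" and S: "finite S" and L: "finite L" "\<And>p. p \<in> L \<Longrightarrow> dom p = S"
  shows "\<exists>c::nat. \<forall>E x m. finite E \<longrightarrow> x \<in> locally_admissible A mu S L E \<longrightarrow>
    nat_complexity f (qs E) = enat m \<longrightarrow>
    (\<exists>m'. nat_complexity f (qm (pr E x)) = enat m' \<and>
      real m' \<le> 2 * real m + log 2 (real (npat E (locally_admissible A mu S L E))) + real c)"
proof -
  from exists_enumerator[OF qs qm A mu S L]
  obtain re where re: "\<And>E x. finite E \<Longrightarrow> x \<in> locally_admissible A mu S L E \<Longrightarrow>
    (\<exists>n < npat E (locally_admissible A mu S L E). eval re [qs E, n] = Some (qm (pr E x)))"
    by blast
  obtain rf where rf: "\<And>w. eval rf [str_index w] = map_option str_index (f w)"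
    using f by (auto simp: optimal_def partial_computable_def)
  have "comp_fn 1 (\<lambda>\<rho>. (\<rho> 0 div 2 ^ Suc (code_exp (\<rho> 0))) mod 2 ^ code_exp (\<rho> 0))"
    by (intro comp_fn_mod comp_fn_div comp_fn_power comp_fn_Suc comp_fn_const comp_fn_code_exp comp_fn_var) auto
  then obtain rP where "\<And>\<rho>. eval rP (map \<rho> [0..<1]) =
      Some ((\<rho> 0 div 2 ^ Suc (code_exp (\<rho> 0))) mod 2 ^ code_exp (\<rho> 0))"
    by (auto simp: comp_fn_def)
  from this[of "\<lambda>_. pair_code l P n" for l P n]
  have rP: "eval rP [pair_code l P n] = Some P" if "P < 2 ^ l" for l P n
    using that by (simp add: code_exp_pair_code pair_code_div del: power_Suc)
  have "comp_fn 1 (\<lambda>\<rho>. (\<rho> 0 div 2 ^ Suc (code_exp (\<rho> 0))) div 2 ^ code_exp (\<rho> 0))"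
    by (intro comp_fn_div comp_fn_power comp_fn_Suc comp_fn_const comp_fn_code_exp comp_fn_var) auto
  then obtain rn where "\<And>\<rho>. eval rn (map \<rho> [0..<1]) =
      Some ((\<rho> 0 div 2 ^ Suc (code_exp (\<rho> 0))) div 2 ^ code_exp (\<rho> 0))"
    by (auto simp: comp_fn_def)
  from this[of "\<lambda>_. pair_code l P n" for l P n]
  have rn: "eval rn [pair_code l P n] = Some n" if "P < 2 ^ l" for l P n
    using that by (simp add: code_exp_pair_code pair_code_div del: power_Suc)
  define r where "r = Comp re [Comp rf [rP], rn]"
  define f' where "f' w = map_option (inv_into UNIV str_index) (eval r [str_index w])" for w
  have "partial_computable f'"
    unfolding partial_computable_def
  proof (intro exI[of _ r] allI)
    fix w show "eval r [str_index w] = map_option str_index (f' w)"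
      by (cases "eval r [str_index w]") (simp_all add: f'_def str_index_inv)
  qed
  then obtain K :: nat where K: "\<And>x. complexity f x < complexity f' x + enat K"
    using f by (auto simp: optimal_def)
  show ?thesis
  \<comment> \<open>The pairing costs \<open>2 * l + 1\<close> digits beyond the rank, and with
    \<open>l = Suc m\<close> this is \<open>2 * m + 3\<close>.\<close>
  proof (rule exI[of _ "3 + K"], intro allI impI)
    fix E x m
    assume E: "finite E" and x: "x \<in> locally_admissible A mu S L E" and m: "nat_complexity f (qs E) = enat m"
    obtain p where p: "f p = Some (inv_into UNIV str_index (qs E))" "length p = m"
      using m complexity_attained unfolding nat_complexity_def by metis
    obtain n where n: "n < npat E (locally_admissible A mu S L E)" "eval re [qs E, n] = Some (qm (pr E x))"
      using re[OF E x] by blast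
    \<comment> \<open>A string of length \<open>m\<close> has an index below
      \<open>2 ^ Suc m\<close>, so this \<open>l\<close> is large enough for the pairing.\<close>
    define l where "l = Suc m"
    have P: "str_index p < 2 ^ l" using str_index_bounds[of p] p(2) by (simp add: l_def)
    define z where "z = pair_code l (str_index p) n"
    define w where "w = inv_into UNIV str_index z"
    have w: "str_index w = z" by (simp add: w_def str_index_inv)
    have "eval r [z] = Some (qm (pr E x))"
      using rP[OF P, of n] rn[OF P, of n] rf[of p] p(1) n(2) by (simp add: r_def str_index_inv flip: z_def)
    then have "f' w = Some (inv_into UNIV str_index (qm (pr E x)))"
      by (simp add: f'_def w)
    then have "complexity f' (inv_into UNIV str_index (qm (pr E x))) \<le> enat (length w)"
      by (rule complexity_le)
    with K[of "inv_into UNIV str_index (qm (pr E x))"]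
    have "nat_complexity f (qm (pr E x)) < enat (length w) + enat K"
      unfolding nat_complexity_def by (meson add_right_mono order_less_le_trans)
    then obtain m' where m': "nat_complexity f (qm (pr E x)) = enat m'" "m' < length w + K"
      by (cases "nat_complexity f (qm (pr E x))") auto
    have "2 ^ length w \<le> z + 1" using str_index_bounds[of w] w by simp
    also have "\<dots> \<le> 2 ^ (2 * l + 1) * (n + 1)"
      unfolding z_def by (rule pair_code_bound[OF P])
    also have "\<dots> \<le> 2 ^ (2 * l + 1) * npat E (locally_admissible A mu S L E)"
      using n(1) by (intro mult_le_mono2) simp
    finally have "real (2 ^ length w) \<le> real (2 ^ (2 * l + 1) * npat E (locally_admissible A mu S L E))"
      by (simp only: of_nat_le_iff)
    then have "log 2 (2 ^ length w) \<le> log 2 (2 ^ (2 * l + 1) * real (npat E (locally_admissible A mu S L E)))"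
      by (subst log_le_cancel_iff) (use n(1) in auto)
    then have "real (length w) \<le> real (2 * l + 1) + log 2 (real (npat E (locally_admissible A mu S L E)))"
      using n(1) by (subst (asm) log_mult) (simp_all add: log_nat_power del: power_add power_Suc)
    then show "\<exists>m'. nat_complexity f (qm (pr E x)) = enat m' \<and>
      real m' \<le> 2 * real m + log 2 (real (npat E (locally_admissible A mu S L E))) + real (3 + K)"
      using m' by (auto simp: l_def)
  qed
qed

section \<open>Entropy of subshifts\<close>

lemma card_image_cong:
  assumes "\<And>x y. x \<in> Y \<Longrightarrow> y \<in> Y \<Longrightarrow> u x = u y \<longleftrightarrow> v x = v y"
  shows "card (u ` Y) = card (v ` Y)"
proof (rule bij_betw_same_card)
  show "bij_betw (\<lambda>p. v (inv_into Y u p)) (u ` Y) (v ` Y)"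
  proof (rule bij_betw_imageI)
    have *: "v (inv_into Y u (u x)) = v x" if "x \<in> Y" for x
      using assms[of "inv_into Y u (u x)" x] that by (simp add: inv_into_into f_inv_into_f)
    show "inj_on (\<lambda>p. v (inv_into Y u p)) (u ` Y)"
      using assms * by (auto simp: inj_on_def)
    show "(\<lambda>p. v (inv_into Y u p)) ` u ` Y = v ` Y"
      using * by (auto simp: image_image)
  qed
qed

section \<open>Translates, boundaries and Folner sequences\<close>

locale nat_group = group G for G :: "nat monoid" (structure) +
  assumes carrier_UNIV [simp]: "carrier G = UNIV"
begin

lemma closed [simp]: "x \<in> carrier G" by simp

lemma mult_cancel [simp]: "x \<otimes> z = y \<otimes> z \<longleftrightarrow> x = y" "z \<otimes> x = z \<otimes> y \<longleftrightarrow> x = y"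
  by auto

lemma assoc: "(x \<otimes> y) \<otimes> z = x \<otimes> (y \<otimes> z)"
  by (rule m_assoc) auto

lemma inv_mult_cancel [simp]: "inv x \<otimes> (x \<otimes> y) = y" "x \<otimes> (inv x \<otimes> y) = y"
  using assoc[of "inv x" x y] assoc[of x "inv x" y] by (simp_all add: l_inv r_inv)

text \<open>Tiles are translated on the right because \<open>shift G g x\<close> reads
  \<open>x\<close> at \<open>h \<otimes> g\<close>: its pattern on \<open>S\<close> is the pattern
  of \<open>x\<close> on \<open>rtr S g\<close>.\<close>

abbreviation rtr :: "nat set \<Rightarrow> nat \<Rightarrow> nat set" where
  "rtr S g \<equiv> (\<lambda>s. s \<otimes> g) ` S"

definition inv_mul :: "nat set \<Rightarrow> nat set \<Rightarrow> nat set" where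
  "inv_mul S E = (\<Union>s\<in>S. (\<lambda>d. inv s \<otimes> d) ` E)"

lemma inv_mul_iff: "g \<in> inv_mul S E \<longleftrightarrow> (\<exists>s\<in>S. s \<otimes> g \<in> E)"
proof
  assume "\<exists>s\<in>S. s \<otimes> g \<in> E"
  then obtain s where "s \<in> S" "s \<otimes> g \<in> E" by blast
  then show "g \<in> inv_mul S E"
    unfolding inv_mul_def by (intro UN_I[of s] image_eqI[of _ _ "s \<otimes> g"]) auto
next
  assume "g \<in> inv_mul S E"
  then obtain s d where "s \<in> S" "d \<in> E" "g = inv s \<otimes> d" by (auto simp: inv_mul_def)
  then show "\<exists>s\<in>S. s \<otimes> g \<in> E" by (intro bexI[of _ s]) auto
qed

lemma finite_inv_mul: "finite S \<Longrightarrow> finite E \<Longrightarrow> finite (inv_mul S E)"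
  by (simp add: inv_mul_def)

lemma card_rtr [simp]: "card (rtr S g) = card S"
  by (rule card_image) (simp add: inj_on_def)

text \<open>Each \<open>s\<close> in \<open>S\<close> yields its own translate through
  \<open>d\<close>, the one by \<open>inv s \<otimes> d\<close>. This is the covering hypothesis of
  Shearer's inequality with multiplicity \<open>card S\<close>.\<close>

lemma rtr_cover:
  assumes "finite S" "finite E" "d \<in> E"
  shows "card S \<le> card {g \<in> inv_mul S E. d \<in> rtr S g}"
proof (rule card_inj_on_le)
  show "inj_on (\<lambda>s. inv s \<otimes> d) S"
    by (rule inj_onI) (metis inv_inv closed mult_cancel(1))
  show "(\<lambda>s. inv s \<otimes> d) ` S \<subseteq> {g \<in> inv_mul S E. d \<in> rtr S g}"
  proof clarify
    fix s assume s: "s \<in> S"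
    then have "d \<in> rtr S (inv s \<otimes> d)" by (intro image_eqI[of _ _ s]) auto
    with s assms(3) show "inv s \<otimes> d \<in> inv_mul S E \<and> d \<in> rtr S (inv s \<otimes> d)"
      by (auto simp: inv_mul_def)
  qed
  show "finite {g \<in> inv_mul S E. d \<in> rtr S g}"
    using finite_inv_mul assms by simp
qed

text \<open>The outer part counts the translates of \<open>S\<close> that Shearer's inequality uses
  beyond those based in \<open>E\<close>; the inner part collects the base points in
  \<open>E\<close> whose window leaves \<open>E\<close>.\<close>

definition bdry :: "nat set \<Rightarrow> nat set \<Rightarrow> nat set" where
  "bdry S E = (inv_mul S E - E) \<union> {g\<in>E. \<exists>s\<in>S. s \<otimes> g \<notin> E}"

lemma finite_bdry: "finite S \<Longrightarrow> finite E \<Longrightarrow> finite (bdry S E)"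
  by (simp add: bdry_def finite_inv_mul)

text \<open>The outer part lies in translates of \<open>E\<close> by inverses of elements of
  \<open>S\<close>; the inner part is moved out of \<open>E\<close> by left multiplication with some
  \<open>s\<close>. Both are thus measured by Folner quotients.\<close>

lemma card_bdry_le:
  assumes "finite S" "finite E"
  shows "card (bdry S E) \<le> (\<Sum>s\<in>S. card ((inv s <# E) - E)) + (\<Sum>s\<in>S. card ((s <# E) - E))"
proof -
  have fin: "finite (g <# E)" for g using assms by (simp add: l_coset_def)
  have "inv_mul S E - E = (\<Union>s\<in>S. (inv s <# E) - E)"
    by (auto simp: inv_mul_def l_coset_def)
  then have "card (inv_mul S E - E) \<le> (\<Sum>s\<in>S. card ((inv s <# E) - E))"
    by (simp only:) (rule card_UN_le[OF assms(1)])
  moreover have "card {g\<in>E. \<exists>s\<in>S. s \<otimes> g \<notin> E} \<le> (\<Sum>s\<in>S. card ((s <# E) - E))"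
  proof -
    have "{g\<in>E. \<exists>s\<in>S. s \<otimes> g \<notin> E} = (\<Union>s\<in>S. {g\<in>E. s \<otimes> g \<notin> E})" by auto
    then have "card {g\<in>E. \<exists>s\<in>S. s \<otimes> g \<notin> E} \<le> (\<Sum>s\<in>S. card {g\<in>E. s \<otimes> g \<notin> E})"
      by (simp only:) (rule card_UN_le[OF assms(1)])
    also have "\<dots> \<le> (\<Sum>s\<in>S. card ((s <# E) - E))"
    proof (rule sum_mono)
      fix s
      show "card {g\<in>E. s \<otimes> g \<notin> E} \<le> card ((s <# E) - E)"
        by (rule card_inj_on_le[of "\<lambda>g. s \<otimes> g"]) (auto simp: inj_on_def l_coset_def assms)
    qed
    finally show ?thesis .
  qed
  ultimately show ?thesis
    unfolding bdry_def by (meson add_mono card_Un_le order_trans)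
qed

lemma Folner_finite: "Folner_sequence G F \<Longrightarrow> finite (F i)"
  and Folner_card_pos: "Folner_sequence G F \<Longrightarrow> 0 < card (F i)"
  by (auto simp: Folner_sequence_def card_gt_0_iff)

lemma Folner_bdry:
  assumes "Folner_sequence G F" "finite S"
  shows "(\<lambda>i. real (card (bdry S (F i))) / real (card (F i))) \<longlonglongrightarrow> 0"
proof (rule tendsto_sandwich[OF _ _ tendsto_const])
  let ?r = "\<lambda>g i. real (card ((g <# F i) - F i)) / real (card (F i))"
  have "?r g \<longlonglongrightarrow> 0" for g using assms(1) by (simp add: Folner_sequence_def)
  then have "(\<lambda>i. (\<Sum>s\<in>S. ?r (inv s) i) + (\<Sum>s\<in>S. ?r s i)) \<longlonglongrightarrow> (\<Sum>s\<in>S. 0) + (\<Sum>s\<in>S. 0)"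
    by (intro tendsto_add tendsto_sum)
  then show "(\<lambda>i. (\<Sum>s\<in>S. ?r (inv s) i) + (\<Sum>s\<in>S. ?r s i)) \<longlonglongrightarrow> 0" by simp
  show "\<forall>\<^sub>F i in sequentially. real (card (bdry S (F i))) / real (card (F i))
      \<le> (\<Sum>s\<in>S. ?r (inv s) i) + (\<Sum>s\<in>S. ?r s i)"
  proof (intro always_eventually allI)
    fix i
    have "real (card (bdry S (F i))) \<le> (\<Sum>s\<in>S. real (card ((inv s <# F i) - F i))) + (\<Sum>s\<in>S. real (card ((s <# F i) - F i)))"
      using card_bdry_le[OF assms(2) Folner_finite[OF assms(1)], of i]
      by (simp only: flip: of_nat_sum of_nat_add)
    then show "real (card (bdry S (F i))) / real (card (F i))
      \<le> (\<Sum>s\<in>S. ?r (inv s) i) + (\<Sum>s\<in>S. ?r s i)"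
      by (simp only: flip: sum_divide_distrib add_divide_distrib) (simp add: divide_right_mono)
  qed
  show "\<forall>\<^sub>F i in sequentially. 0 \<le> real (card (bdry S (F i))) / real (card (F i))"
    by (simp add: always_eventually)
qed

text \<open>The group is infinite, so windows \<open>S\<close> of any size \<open>n\<close> exist.
  Once the boundary of \<open>F i\<close> is smaller than \<open>F i\<close>, some whole translate
  of \<open>S\<close> fits into \<open>F i\<close>, which forces at least \<open>n\<close>
  elements.\<close>

lemma Folner_card_at_top:
  assumes F: "Folner_sequence G F"
  shows "filterlim (\<lambda>i. real (card (F i))) at_top sequentially"
proof (rule filterlim_at_top[THEN iffD2], rule allI)
  fix Z :: real
  define n where "n = nat \<lceil>Z\<rceil>"
  let ?S = "{..<n}"
  have "eventually (\<lambda>i. real (card (bdry ?S (F i))) / real (card (F i)) < 1) sequentially"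
    by (rule order_tendstoD(2)[OF Folner_bdry[OF F]]) auto
  then show "eventually (\<lambda>i. Z \<le> real (card (F i))) sequentially"
  proof eventually_elim
    case (elim i)
    then have lt: "card (bdry ?S (F i)) < card (F i)"
      using Folner_card_pos[OF F, of i] by (simp add: divide_less_eq)
    have "\<exists>g\<in>F i. rtr ?S g \<subseteq> F i"
    proof (rule ccontr)
      assume "\<not> (\<exists>g\<in>F i. rtr ?S g \<subseteq> F i)"
      then have "F i \<subseteq> bdry ?S (F i)" by (auto simp: bdry_def)
      then have "card (F i) \<le> card (bdry ?S (F i))"
        by (rule card_mono[rotated]) (simp add: finite_bdry Folner_finite[OF F])
      with lt show False by simp
    qed
    then obtain g where "rtr ?S g \<subseteq> F i" by blast
    then have "card (rtr ?S g) \<le> card (F i)"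
      by (rule card_mono[OF Folner_finite[OF F]])
    then have "n \<le> card (F i)" by simp
    then show ?case unfolding n_def by linarith
  qed
qed

lemma npat_Shearer:
  assumes "finite A" "\<And>x. x \<in> Y \<Longrightarrow> range x \<subseteq> A" "finite S" "S \<noteq> {}" "finite E"
  shows "npat E Y ^ card S \<le> (\<Prod>g\<in>inv_mul S E. npat (rtr S g) Y)"
  by (rule Shearer_counting[where A = A])
    (use assms rtr_cover finite_inv_mul in \<open>auto simp: card_gt_0_iff\<close>)

end

section \<open>Pattern counts and entropy of the subshift\<close>

locale group_subshift = nat_group +
  fixes A :: "'a set" and X :: "(nat \<Rightarrow> 'a) set"
  assumes finite_A: "finite A" and subshift: "subshift G A X" and X_nonempty: "X \<noteq> {}"
begin

lemma X_range: "x \<in> X \<Longrightarrow> range x \<subseteq> A"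
proof -
  assume "x \<in> X"
  then have "x \<in> topspace (product_topology (\<lambda>_. discrete_topology A) (carrier G))"
    using subshift closedin_subset unfolding subshift_def by blast
  then show ?thesis by (auto simp: PiE_iff)
qed

lemma A_nonempty: "A \<noteq> {}"
  using X_nonempty X_range by fastforce

lemma shift_mem: "x \<in> X \<Longrightarrow> shift G g x \<in> X"
  using subshift by (simp add: subshift_def)

lemma shift_shift: "shift G g (shift G h x) = shift G (g \<otimes> h) x"
  by (simp add: shift_def assoc)

lemma shift_one: "shift G \<one> x = x"
  by (simp add: shift_def)

lemma shift_image: "shift G g ` X = X"
proof
  have "x = shift G g (shift G (inv g) x)" for x
    by (simp add: shift_shift shift_one)
  then show "X \<subseteq> shift G g ` X" using shift_mem by blast
qed (use shift_mem in auto)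

lemma fin_pr: "finite E \<Longrightarrow> Y \<subseteq> X \<Longrightarrow> finite (pr E ` Y)"
  by (rule finite_pr_image[OF _ finite_A X_range]) auto

lemma npat_X_pos: "finite E \<Longrightarrow> 0 < npat E X"
  by (rule npat_pos[OF fin_pr X_nonempty]) auto

lemma npat_rtr: "npat (rtr S g) X = npat S X"
proof -
  have "card (pr (rtr S g) ` X) = card ((pr S \<circ> shift G g) ` X)"
    by (rule card_image_cong) (simp add: pr_eq_iff shift_def)
  then show ?thesis by (simp only: npat_def image_comp[symmetric] shift_image)
qed

text \<open>As an infimum over all finite windows rather than a limit, it gives a lower bound for
  the number of patterns on every finite set at once.\<close>

definition entropy :: real where
  "entropy = (INF S\<in>{S. finite S \<and> S \<noteq> {}}. log 2 (real (npat S X)) / real (card S))"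

lemma log_npat_nonneg: "finite E \<Longrightarrow> 0 \<le> log 2 (real (npat E X))"
  using npat_X_pos[of E] by simp

lemma entropy_bdd: "bdd_below ((\<lambda>S. log 2 (real (npat S X)) / real (card S)) ` {S. finite S \<and> S \<noteq> {}})"
  by (rule bdd_belowI2[of _ 0]) (simp add: log_npat_nonneg)

lemma entropy_nonneg: "0 \<le> entropy"
  unfolding entropy_def by (rule cINF_greatest) (auto simp: log_npat_nonneg)

lemma entropy_lower: 
  assumes "finite E"
  shows "entropy * real (card E) \<le> log 2 (real (npat E X))"
proof (cases "E = {}")
  case False
  then have "entropy \<le> log 2 (real (npat E X)) / real (card E)"
    unfolding entropy_def using assms by (intro cINF_lower entropy_bdd) auto
  then show ?thesis using False assms by (simp add: field_simps card_gt_0_iff)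
qed (use log_npat_nonneg in simp)

lemma entropy_approx:
  assumes "0 < \<eta>"
  obtains S where "finite S" "S \<noteq> {}" "log 2 (real (npat S X)) < (entropy + \<eta>) * real (card S)"
proof -
  have "entropy < entropy + \<eta>" using assms by simp
  then obtain S where "finite S" "S \<noteq> {}" "log 2 (real (npat S X)) / real (card S) < entropy + \<eta>"
    unfolding entropy_def by (subst (asm) cINF_less_iff) (auto intro: entropy_bdd)
  then show thesis using that by (auto simp: field_simps card_gt_0_iff)
qed

lemma log_npat_le:
  assumes "finite S" "S \<noteq> {}" "finite E"
  shows "log 2 (real (npat E X)) * real (card S) \<le> real (card (inv_mul S E)) * log 2 (real (npat S X))"
proof -
  have "npat E X ^ card S \<le> npat S X ^ card (inv_mul S E)"
    using npat_Shearer[OF finite_A X_range assms, of X] by (simp add: npat_rtr)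
  then have "real (npat E X) ^ card S \<le> real (npat S X) ^ card (inv_mul S E)"
    by (simp only: flip: of_nat_power)
  then have "log 2 (real (npat E X) ^ card S) \<le> log 2 (real (npat S X) ^ card (inv_mul S E))"
    using npat_X_pos assms by (subst log_le_cancel_iff) auto
  then show ?thesis
    using npat_X_pos assms by (simp add: log_nat_power mult.commute)
qed

text \<open>A rate \<open>c\<close> observed on one window \<open>S\<close> transfers to any finite
  \<open>E\<close>, where \<open>inv_mul S E\<close> exceeds \<open>E\<close> only by boundary
  points.\<close>

lemma log_npat_le':
  assumes "finite S" "S \<noteq> {}" "finite E" "log 2 (real (npat S X)) \<le> c * real (card S)"
  shows "log 2 (real (npat E X)) \<le> c * real (card (inv_mul S E))"
proof -
  have "log 2 (real (npat E X)) * real (card S) \<le> real (card (inv_mul S E)) * (c * real (card S))"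
    using log_npat_le[OF assms(1-3)] mult_left_mono[OF assms(4), of "real (card (inv_mul S E))"] by simp
  moreover have "0 < real (card S)" using assms by (simp add: card_gt_0_iff)
  ultimately show ?thesis by (simp add: mult.assoc[symmetric] mult.commute)
qed

lemma entropy_limit:
  assumes F: "Folner_sequence G F"
  shows "(\<lambda>i. log 2 (real (npat (F i) X)) / real (card (F i))) \<longlonglongrightarrow> entropy"
proof (rule order_tendstoI)
  note pos = Folner_card_pos[OF F] and fin = Folner_finite[OF F]
  fix a assume "a < entropy"
  moreover have "entropy \<le> log 2 (real (npat (F i) X)) / real (card (F i))" for i
    using entropy_lower[OF fin, of i] pos[of i] by (simp add: field_simps)
  ultimately show "\<forall>\<^sub>F i in sequentially. a < log 2 (real (npat (F i) X)) / real (card (F i))"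
    by (intro always_eventually allI) (meson order_less_le_trans)
next
  note pos = Folner_card_pos[OF F] and fin = Folner_finite[OF F]
  fix a assume a: "entropy < a"
  define c where "c = (entropy + a) / 2"
  have c: "entropy < c" "c < a" "0 < c" using a entropy_nonneg by (auto simp: c_def)
  obtain S where S: "finite S" "S \<noteq> {}" "log 2 (real (npat S X)) < c * real (card S)"
    using entropy_approx[of "c - entropy"] c by auto
  have "(\<lambda>i. c * (1 + real (card (bdry S (F i))) / real (card (F i)))) \<longlonglongrightarrow> c * (1 + 0)"
    by (intro tendsto_intros Folner_bdry F S)
  then have "\<forall>\<^sub>F i in sequentially. c * (1 + real (card (bdry S (F i))) / real (card (F i))) < a"
    using c by (intro order_tendstoD(2)) auto
  then show "\<forall>\<^sub>F i in sequentially. log 2 (real (npat (F i) X)) / real (card (F i)) < a"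
  proof eventually_elim
    case (elim i)
    have "inv_mul S (F i) \<subseteq> F i \<union> bdry S (F i)" by (auto simp: bdry_def)
    then have "card (inv_mul S (F i)) \<le> card (F i \<union> bdry S (F i))"
      by (intro card_mono) (simp_all add: fin finite_bdry S)
    also have "\<dots> \<le> card (F i) + card (bdry S (F i))" by (rule card_Un_le)
    finally have "c * real (card (inv_mul S (F i))) \<le> c * (real (card (F i)) + real (card (bdry S (F i))))"
      using c by (intro mult_left_mono) auto
    moreover have "log 2 (real (npat (F i) X)) \<le> c * real (card (inv_mul S (F i)))"
      by (rule log_npat_le') (use S fin in auto)
    ultimately have "log 2 (real (npat (F i) X)) / real (card (F i))
        \<le> c * (real (card (F i)) + real (card (bdry S (F i)))) / real (card (F i))"
      by (intro divide_right_mono) auto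
    also have "\<dots> = c * (1 + real (card (bdry S (F i))) / real (card (F i)))"
      using pos[of i] by (simp add: field_simps)
    finally show ?case using elim by simp
  qed
qed

text \<open>The given sequence \<open>F\<close> secures uniqueness in the definite description:
  without any Folner sequence every real number would satisfy it.\<close>

lemma top_entropy_eq:
  assumes F: "Folner_sequence G F"
  shows "top_entropy G X = entropy"
  unfolding top_entropy_def
proof (rule the_equality)
  show "\<forall>F. Folner_sequence G F \<longrightarrow> (\<lambda>i. log 2 (real (card (pr (F i) ` X))) / real (card (F i))) \<longlonglongrightarrow> entropy"
    using entropy_limit by (simp add: npat_def)
  show "h = entropy" if "\<forall>F. Folner_sequence G F \<longrightarrow>
      (\<lambda>i. log 2 (real (card (pr (F i) ` X))) / real (card (F i))) \<longlonglongrightarrow> h" for h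
    using that F entropy_limit[OF F] by (auto simp: npat_def intro: LIMSEQ_unique)
qed

end

section \<open>A covering lemma for tempered sequences\<close>

context nat_group
begin

lemma rtr_iff: "u \<in> rtr B g \<longleftrightarrow> u \<otimes> inv g \<in> B"
proof
  assume "u \<in> rtr B g"
  then show "u \<otimes> inv g \<in> B" by (auto simp: assoc r_inv)
next
  assume "u \<otimes> inv g \<in> B"
  then show "u \<in> rtr B g"
    by (intro image_eqI[of _ _ "u \<otimes> inv g"]) (auto simp: assoc l_inv)
qed

text \<open>\<open>T\<close> is a maximal subset of \<open>E\<close> whose tiles are almost disjoint
  in the sense of the first bound. By maximality every tile based in \<open>E\<close> has a
  proportion \<delta> of its points in the union over \<open>T\<close>, and a double count turns
  this into the second bound.\<close>

lemma same_scale_cover: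
  assumes "finite E" "finite B" "B \<noteq> {}" and \<delta>: "0 < \<delta>" "\<delta> < (1::real)"
  shows "\<exists>T\<subseteq>E. (1 - \<delta>) * (real (card T) * real (card B)) \<le> real (card (\<Union>g\<in>T. rtr B g)) \<and>
    \<delta> * real (card E) \<le> real (card (\<Union>g\<in>T. rtr B g))"
proof -
  define U where "U T = (\<Union>g\<in>T. rtr B g)" for T
  define P where "P T \<longleftrightarrow> (1 - \<delta>) * (real (card T) * real (card B)) \<le> real (card (U T))" for T
  have "finite {T. T \<subseteq> E \<and> P T}"
    by (rule finite_subset[OF _ finite_Pow_iff[THEN iffD2, OF assms(1)]]) auto
  moreover have "{T. T \<subseteq> E \<and> P T} \<noteq> {}"
    by (auto simp: P_def U_def intro!: exI[of _ "{}"])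
  ultimately obtain T where "T \<in> {T. T \<subseteq> E \<and> P T}" "\<forall>T'\<in>{T. T \<subseteq> E \<and> P T}. T \<subseteq> T' \<longrightarrow> T = T'"
    using finite_has_maximal[of "{T. T \<subseteq> E \<and> P T}"] by blast
  then have T: "T \<subseteq> E" "P T" and max: "\<And>T'. T' \<subseteq> E \<Longrightarrow> P T' \<Longrightarrow> T \<subseteq> T' \<Longrightarrow> T' = T"
    by blast+
  have finT: "finite T" using T assms finite_subset by blast
  have finU: "finite (U T)" using finT assms by (simp add: U_def)
  have overlap: "\<delta> * real (card B) \<le> real (card (U T \<inter> rtr B g))" if g: "g \<in> E" for g
  proof (cases "g \<in> T")
    case True
    then have "U T \<inter> rtr B g = rtr B g" by (auto simp: U_def)
    then show ?thesis using \<delta> by (simp add: mult_left_le_one_le)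
  next
    case False
    then have "insert g T \<noteq> T" by auto
    then have "\<not> P (insert g T)" using max[of "insert g T"] g T by auto
    moreover have "U (insert g T) = U T \<union> (rtr B g - U T)" by (auto simp: U_def)
    then have "card (U (insert g T)) = card (U T) + card (rtr B g - U T)"
      using finU assms by (simp only:) (rule card_Un_disjoint, auto)
    ultimately have "real (card (U T)) + real (card (rtr B g - U T)) < (1 - \<delta>) * ((1 + real (card T)) * real (card B))"
      using False finT by (simp add: P_def)
    moreover have "(1 - \<delta>) * (real (card T) * real (card B)) \<le> real (card (U T))"
      using T(2) by (simp add: P_def)
    ultimately have "real (card (rtr B g - U T)) < (1 - \<delta>) * real (card B)"
      by (simp add: algebra_simps)
    moreover have "card (rtr B g) = card (U T \<inter> rtr B g) + card (rtr B g - U T)"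
      using assms by (simp add: card_Diff_subset_Int Int_commute[of "U T"] card_mono del: card_rtr)
    ultimately show ?thesis by (simp add: algebra_simps)
  qed
  \<comment> \<open>The pairs of a base point \<open>g\<close> in \<open>E\<close> and a covered
    point \<open>u\<close> of its tile are counted in two ways; each \<open>u\<close> lies in at
    most \<open>card B\<close> tiles, because \<open>u \<otimes> inv g\<close> is a point of
    \<open>B\<close> that determines \<open>g\<close>.\<close>
  have "(\<Sum>g\<in>E. \<Sum>u\<in>{u. u \<in> U T \<and> u \<in> rtr B g}. (1::nat)) = (\<Sum>u\<in>U T. \<Sum>g\<in>{g. g \<in> E \<and> u \<in> rtr B g}. 1)"
    by (rule sum.swap_restrict[OF assms(1) finU])
  then have "(\<Sum>g\<in>E. card (U T \<inter> rtr B g)) = (\<Sum>u\<in>U T. card {g. g \<in> E \<and> u \<in> rtr B g})"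
    by (simp add: Int_def)
  also have "\<dots> \<le> (\<Sum>u\<in>U T. card B)"
  proof (rule sum_mono)
    fix u
    show "card {g. g \<in> E \<and> u \<in> rtr B g} \<le> card B"
    proof (rule card_inj_on_le)
      show "inj_on (\<lambda>g. u \<otimes> inv g) {g. g \<in> E \<and> u \<in> rtr B g}"
        by (rule inj_onI) (metis inv_inv closed mult_cancel(2))
      show "(\<lambda>g. u \<otimes> inv g) ` {g. g \<in> E \<and> u \<in> rtr B g} \<subseteq> B"
        using rtr_iff by blast
    qed fact
  qed
  also have "\<dots> = card (U T) * card B" by simp
  finally have "(\<Sum>g\<in>E. real (card (U T \<inter> rtr B g))) \<le> real (card (U T)) * real (card B)"
    by (simp only: flip: of_nat_sum of_nat_mult)
  moreover have "(\<Sum>g\<in>E. \<delta> * real (card B)) \<le> (\<Sum>g\<in>E. real (card (U T \<inter> rtr B g)))"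
    by (intro sum_mono overlap)
  ultimately have "(\<delta> * real (card E)) * real (card B) \<le> real (card (U T)) * real (card B)"
    by (simp add: algebra_simps)
  then have "\<delta> * real (card E) \<le> real (card (U T))"
    using assms(2,3) by (simp add: card_gt_0_iff)
  with T show ?thesis by (auto simp: P_def U_def)
qed

text \<open>A Vitali selection from the largest index downwards. At the top index \<open>i\<close>
  the single-scale lemma chooses \<open>T1\<close>; a tile of smaller index \<open>j\<close> that
  meets a chosen tile \<open>rtr (F i) h\<close> has its base point in the translate by
  \<open>h\<close> of \<open>inv_mul (F j) (F i)\<close>. Temperedness bounds the number of base
  points lost in this way by \<open>K * card (F i)\<close> for each chosen tile.\<close>

lemma tempered_cover:
  fixes F :: "nat \<Rightarrow> nat set" and K \<delta> :: real
  assumes F: "\<And>i. finite (F i)" "\<And>i. F i \<noteq> {}"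
    and temp: "\<And>i. real (card (\<Union>j<i. inv_mul (F j) (F i))) \<le> K * real (card (F i))"
    and \<delta>: "0 < \<delta>" "\<delta> < 1"
    and "finite I" "finite E" "\<And>g. g \<in> E \<Longrightarrow> \<iota> g \<in> I"
  shows "\<exists>T\<subseteq>E. (1 - \<delta>) * (\<Sum>g\<in>T. real (card (F (\<iota> g)))) \<le> real (card (\<Union>g\<in>T. rtr (F (\<iota> g)) g)) \<and>
    real (card E) \<le> real (card (\<Union>g\<in>T. rtr (F (\<iota> g)) g)) / \<delta> + K * (\<Sum>g\<in>T. real (card (F (\<iota> g))))"
  using assms(6-)
proof (induction I arbitrary: E rule: finite_linorder_max_induct)
  case empty
  then have "E = {}" by auto
  then show ?case by auto
next
  case (insert i I)
  define U where "U T = (\<Union>g\<in>T. rtr (F (\<iota> g)) g)" for T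
  define E1 where "E1 = {g\<in>E. \<iota> g = i}"
  have finE1: "finite E1" using insert.prems by (simp add: E1_def)
  obtain T1 where T1: "T1 \<subseteq> E1" "(1 - \<delta>) * (real (card T1) * real (card (F i))) \<le> real (card (\<Union>g\<in>T1. rtr (F i) g))"
      "\<delta> * real (card E1) \<le> real (card (\<Union>g\<in>T1. rtr (F i) g))"
    using same_scale_cover[OF finE1 F(1) F(2) \<delta>, of i] by blast
  have finT1: "finite T1" using T1 finE1 finite_subset by blast
  have UT1: "(\<Union>g\<in>T1. rtr (F i) g) = U T1" using T1 by (auto simp: U_def E1_def)
  have sum1: "(\<Sum>g\<in>T1. real (card (F (\<iota> g)))) = real (card T1) * real (card (F i))"
    using T1 by (subst sum.cong[OF refl, of _ _ "\<lambda>_. real (card (F i))"]) (auto simp: E1_def)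
  \<comment> \<open>Only smaller tiles disjoint from everything chosen so far are passed on, so the
    two unions add up without loss.\<close>
  define E2 where "E2 = {g\<in>E. \<iota> g \<noteq> i \<and> rtr (F (\<iota> g)) g \<inter> U T1 = {}}"
  have finE2: "finite E2" using insert.prems by (simp add: E2_def)
  have "\<exists>T\<subseteq>E2. (1 - \<delta>) * (\<Sum>g\<in>T. real (card (F (\<iota> g)))) \<le> real (card (\<Union>g\<in>T. rtr (F (\<iota> g)) g)) \<and>
    real (card E2) \<le> real (card (\<Union>g\<in>T. rtr (F (\<iota> g)) g)) / \<delta> + K * (\<Sum>g\<in>T. real (card (F (\<iota> g))))"
    by (rule insert.IH[OF finE2]) (use insert.prems in \<open>auto simp: E2_def\<close>)
  then obtain T2 where T2: "T2 \<subseteq> E2" "(1 - \<delta>) * (\<Sum>g\<in>T2. real (card (F (\<iota> g)))) \<le> real (card (U T2))"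
    "real (card E2) \<le> real (card (U T2)) / \<delta> + K * (\<Sum>g\<in>T2. real (card (F (\<iota> g))))"
    unfolding U_def by blast
  have finT2: "finite T2" using T2 finE2 finite_subset by blast
  have disj: "T1 \<inter> T2 = {}" using T1 T2 by (auto simp: E1_def E2_def)
  have Udisj: "U T1 \<inter> U T2 = {}" using T2(1) by (auto simp: U_def E2_def)
  have finU: "finite (U T)" if "finite T" for T using that F by (simp add: U_def)
  have "U (T1 \<union> T2) = U T1 \<union> U T2" by (auto simp: U_def)
  then have cardU: "card (U (T1 \<union> T2)) = card (U T1) + card (U T2)"
    using card_Un_disjoint[OF finU[OF finT1] finU[OF finT2] Udisj] by simp
  have sumT: "(\<Sum>g\<in>T1 \<union> T2. real (card (F (\<iota> g)))) = (\<Sum>g\<in>T1. real (card (F (\<iota> g)))) + (\<Sum>g\<in>T2. real (card (F (\<iota> g))))"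
    by (rule sum.union_disjoint[OF finT1 finT2 disj])
  define Q where "Q = (\<Union>j<i. inv_mul (F j) (F i))"
  have finQ: "finite Q" by (simp add: Q_def finite_inv_mul F)
  have "E \<subseteq> E1 \<union> E2 \<union> (\<Union>h\<in>T1. rtr Q h)"
  proof
    fix g assume g: "g \<in> E"
    show "g \<in> E1 \<union> E2 \<union> (\<Union>h\<in>T1. rtr Q h)"
    proof (cases "\<iota> g = i \<or> rtr (F (\<iota> g)) g \<inter> U T1 = {}")
      case False
      then have "\<iota> g < i" using insert.prems(2)[OF g] insert.hyps by auto
      from False obtain a where a: "a \<in> F (\<iota> g)" "a \<otimes> g \<in> U T1" by auto
      then obtain h where h: "h \<in> T1" "a \<otimes> g \<in> rtr (F i) h" by (auto simp: UT1[symmetric])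
      then have "a \<otimes> (g \<otimes> inv h) \<in> F i" by (simp add: rtr_iff assoc)
      then have "g \<otimes> inv h \<in> Q" using a \<open>\<iota> g < i\<close> by (auto simp: Q_def inv_mul_iff)
      then show ?thesis using h by (auto simp only: rtr_iff Un_iff UN_iff)
    qed (use g in \<open>auto simp: E1_def E2_def\<close>)
  qed
  then have "card E \<le> card (E1 \<union> E2 \<union> (\<Union>h\<in>T1. rtr Q h))"
    by (rule card_mono[rotated]) (simp add: finE1 finE2 finT1 finQ)
  also have "\<dots> \<le> card E1 + card E2 + card (\<Union>h\<in>T1. rtr Q h)"
    by (meson add_mono card_Un_le order_trans order_refl)
  also have "card (\<Union>h\<in>T1. rtr Q h) \<le> (\<Sum>h\<in>T1. card (rtr Q h))"
    by (rule card_UN_le[OF finT1])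
  finally have "card E \<le> card E1 + card E2 + card T1 * card Q" by simp
  then have "real (card E) \<le> real (card E1) + real (card E2) + real (card T1) * real (card Q)"
    by (simp only: flip: of_nat_add of_nat_mult)
  also have "real (card T1) * real (card Q) \<le> real (card T1) * (K * real (card (F i)))"
    unfolding Q_def by (intro mult_left_mono temp) auto
  also have "real (card E1) \<le> real (card (U T1)) / \<delta>"
    using T1(3) \<delta> UT1 by (simp add: field_simps)
  finally have "real (card E) \<le> real (card (U (T1 \<union> T2))) / \<delta> + K * (\<Sum>g\<in>T1 \<union> T2. real (card (F (\<iota> g))))"
    using T2(3) unfolding cardU sumT sum1 by (simp add: add_divide_distrib algebra_simps)
  moreover have "(1 - \<delta>) * (\<Sum>g\<in>T1 \<union> T2. real (card (F (\<iota> g)))) \<le> real (card (U (T1 \<union> T2)))"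
    using T1(2) T2(2) unfolding UT1 cardU sumT sum1 by (simp add: distrib_left)
  moreover have "T1 \<union> T2 \<subseteq> E" using T1 T2 by (auto simp: E1_def E2_def)
  ultimately show ?case unfolding U_def by blast
qed

end

section \<open>Counting patterns with many bad translates\<close>

context nat_group
begin

text \<open>A configuration \<open>\<kappa>\<close> on \<open>D\<close> places the tile \<open>F i\<close>, carrying the pattern \<open>p\<close>, at each
  \<open>g\<close> with \<open>\<kappa> g = Some (i, p)\<close>.\<close>

definition tiled :: "(nat \<Rightarrow> nat set) \<Rightarrow> nat set \<Rightarrow> (nat \<Rightarrow> (nat \<times> 'p) option) \<Rightarrow> nat set" where
  "tiled F D \<kappa> = (\<Union>g\<in>{g\<in>D. \<kappa> g \<noteq> None}. rtr (F (fst (the (\<kappa> g)))) g)"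

definition tile_mass :: "(nat \<Rightarrow> nat set) \<Rightarrow> nat set \<Rightarrow> (nat \<Rightarrow> (nat \<times> 'p) option) \<Rightarrow> real" where
  "tile_mass F D \<kappa> = (\<Sum>g\<in>{g\<in>D. \<kappa> g \<noteq> None}. real (card (F (fst (the (\<kappa> g))))))"

text \<open>The weights form a generating function: each tile is charged \<open>s\<close> bits per
  cell, overlaps counted repeatedly, so the product over \<open>D\<close> depends only on
  \<open>tile_mass\<close>.\<close>

definition tile_weight :: "(nat \<Rightarrow> nat set) \<Rightarrow> real \<Rightarrow> (nat \<times> 'p) option \<Rightarrow> real" where
  "tile_weight F s o' = (case o' of None \<Rightarrow> 1 | Some (i, p) \<Rightarrow> 2 powr (- s * real (card (F i))))"

lemma prod_tile_weight:
  assumes "finite D"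
  shows "(\<Prod>g\<in>D. tile_weight F s (\<kappa> g)) = 2 powr (- s * tile_mass F D \<kappa>)"
proof -
  have "(\<Prod>g\<in>D. tile_weight F s (\<kappa> g)) = (\<Prod>g\<in>{g\<in>D. \<kappa> g \<noteq> None}. tile_weight F s (\<kappa> g))"
    by (rule prod.mono_neutral_right) (use assms in \<open>auto simp: tile_weight_def split: option.splits\<close>)
  also have "\<dots> = (\<Prod>g\<in>{g\<in>D. \<kappa> g \<noteq> None}. 2 powr (- s * real (card (F (fst (the (\<kappa> g)))))))"
    by (rule prod.cong[OF refl]) (auto simp: tile_weight_def)
  also have "\<dots> = 2 powr (- s * tile_mass F D \<kappa>)"
    by (simp add: tile_mass_def powr_sum[symmetric] sum_distrib_left assms)
  finally show ?thesis .
qed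

text \<open>The choices at different points of \<open>D\<close> are independent, so the weighted sum
  over all configurations is a power of the sum at a single point. No separate estimate for the
  number of tile placements is required.\<close>

lemma sum_configurations:
  fixes V :: "nat \<Rightarrow> 'p set"
  assumes "finite D" "finite I" "\<And>i. i \<in> I \<Longrightarrow> finite (V i)"
  shows "(\<Sum>\<kappa>\<in>D \<rightarrow>\<^sub>E insert None (Some ` Sigma I V). \<Prod>g\<in>D. tile_weight F s (\<kappa> g)) =
    (1 + (\<Sum>i\<in>I. real (card (V i)) * 2 powr (- s * real (card (F i))))) ^ card D"
proof -
  have fin: "finite (Sigma I V)" using assms by (intro finite_SigmaI) auto
  have "(\<Sum>\<kappa>\<in>D \<rightarrow>\<^sub>E insert None (Some ` Sigma I V). \<Prod>g\<in>D. tile_weight F s (\<kappa> g)) =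
    (\<Prod>g\<in>D. \<Sum>o'\<in>insert None (Some ` Sigma I V). tile_weight F s o')"
    by (rule prod_sum_PiE[symmetric]) (use assms fin in auto)
  also have "(\<Sum>o'\<in>insert None (Some ` Sigma I V). tile_weight F s o') =
      1 + (\<Sum>z\<in>Sigma I V. tile_weight F s (Some z))"
    by (subst sum.insert) (use fin in \<open>auto simp: sum.reindex tile_weight_def\<close>)
  also have "(\<Sum>z\<in>Sigma I V. tile_weight F s (Some z)) =
      (\<Sum>i\<in>I. \<Sum>p\<in>V i. tile_weight F s (Some (i, p)))"
    by (subst sum.Sigma) (use assms in auto)
  also have "\<dots> = (\<Sum>i\<in>I. real (card (V i)) * 2 powr (- s * real (card (F i))))"
    by (simp add: tile_weight_def)
  finally show ?thesis by simp
qed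

end

context group_subshift
begin

definition frequently_bad ::
  "(nat \<Rightarrow> nat set) \<Rightarrow> (nat \<Rightarrow> (nat \<Rightarrow> 'a option) set) \<Rightarrow> nat set \<Rightarrow> nat set \<Rightarrow> real \<Rightarrow> (nat \<Rightarrow> 'a) set" where
  "frequently_bad F V I D \<epsilon> =
     {x \<in> X. \<epsilon> * real (card D) \<le> real (card {g\<in>D. \<exists>i\<in>I. pr (F i) (shift G g x) \<in> V i})}"

text \<open>The untiled part \<open>D - U\<close> is irregular, but its boundary is controlled: if a
  window based at \<open>u\<close> meets \<open>D - U\<close>, then \<open>u\<close> lies in
  \<open>D - U\<close>, in the boundary of \<open>D\<close>, or in a tile that the window leaves.
  The last case puts \<open>u\<close> into the translated boundary of that tile.\<close>

lemma npat_complement_tiled: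
  fixes \<kappa> :: "nat \<Rightarrow> (nat \<times> (nat \<Rightarrow> 'a option)) option"
  assumes D: "finite D" and S: "finite S" "S \<noteq> {}"
    and c: "log 2 (real (npat S X)) \<le> c * real (card S)" "0 \<le> c"
    and F: "\<And>i. finite (F i)"
    and sub: "tiled F D \<kappa> \<subseteq> D"
    and inv_tile: "\<And>g. g \<in> D \<Longrightarrow> \<kappa> g \<noteq> None \<Longrightarrow>
      real (card (bdry S (F (fst (the (\<kappa> g)))))) \<le> \<eta> * real (card (F (fst (the (\<kappa> g)))))"
    and inv_D: "real (card (bdry S D)) \<le> \<eta> * real (card D)"
  shows "log 2 (real (npat (D - tiled F D \<kappa>) X)) \<le>
    c * (real (card D) - real (card (tiled F D \<kappa>)) + \<eta> * real (card D) + \<eta> * tile_mass F D \<kappa>)"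
proof -
  define U where "U = tiled F D \<kappa>"
  define T where "T = {g\<in>D. \<kappa> g \<noteq> None}"
  define i where "i g = fst (the (\<kappa> g))" for g
  have finT: "finite T" using D by (simp add: T_def)
  have finU: "finite U" using sub D finite_subset U_def by blast
  have "inv_mul S (D - U) \<subseteq> (D - U) \<union> bdry S D \<union> (\<Union>g\<in>T. rtr (bdry S (F (i g))) g)"
  proof
    fix u assume u: "u \<in> inv_mul S (D - U)"
    then obtain s where s: "s \<in> S" "s \<otimes> u \<in> D" "s \<otimes> u \<notin> U" by (auto simp: inv_mul_iff)
    show "u \<in> (D - U) \<union> bdry S D \<union> (\<Union>g\<in>T. rtr (bdry S (F (i g))) g)"
    proof (cases "u \<in> U")
      case True
      then obtain g f where g: "g \<in> T" "f \<in> F (i g)" "u = f \<otimes> g"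
        by (auto simp: U_def tiled_def T_def i_def)
      have "s \<otimes> f \<notin> F (i g)"
      proof
        assume "s \<otimes> f \<in> F (i g)"
        then have "s \<otimes> u \<in> rtr (F (i g)) g" using g by (simp add: assoc[symmetric])
        then have "s \<otimes> u \<in> U" using g by (auto simp: U_def tiled_def T_def i_def)
        with s show False by simp
      qed
      then have "f \<in> bdry S (F (i g))" using s g by (auto simp: bdry_def)
      then show ?thesis using g by auto
    next
      case False
      then show ?thesis using s by (auto simp: bdry_def inv_mul_iff)
    qed
  qed
  then have "card (inv_mul S (D - U)) \<le> card ((D - U) \<union> bdry S D \<union> (\<Union>g\<in>T. rtr (bdry S (F (i g))) g))"
    by (rule card_mono[rotated]) (simp add: D S F finT finite_bdry)
  also have "\<dots> \<le> card (D - U) + card (bdry S D) + card (\<Union>g\<in>T. rtr (bdry S (F (i g))) g)"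
    by (meson add_mono card_Un_le order_trans order_refl)
  also have "card (\<Union>g\<in>T. rtr (bdry S (F (i g))) g) \<le> (\<Sum>g\<in>T. card (rtr (bdry S (F (i g))) g))"
    by (rule card_UN_le[OF finT])
  finally have "card (inv_mul S (D - U)) \<le> card (D - U) + card (bdry S D) + (\<Sum>g\<in>T. card (bdry S (F (i g))))"
    by simp
  then have "real (card (inv_mul S (D - U))) \<le> real (card (D - U)) + real (card (bdry S D)) + (\<Sum>g\<in>T. real (card (bdry S (F (i g)))))"
    by (simp only: flip: of_nat_add of_nat_sum)
  also have "\<dots> \<le> real (card (D - U)) + \<eta> * real (card D) + (\<Sum>g\<in>T. \<eta> * real (card (F (i g))))"
    by (intro add_mono sum_mono inv_D order_refl) (auto simp: T_def i_def intro: inv_tile)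
  also have "real (card (D - U)) = real (card D) - real (card U)"
    using sub finU D by (simp add: U_def card_Diff_subset card_mono of_nat_diff)
  also have "(\<Sum>g\<in>T. \<eta> * real (card (F (i g)))) = \<eta> * tile_mass F D \<kappa>"
    by (simp add: tile_mass_def sum_distrib_left T_def i_def)
  finally have "c * real (card (inv_mul S (D - U))) \<le> c * (real (card D) - real (card U) + \<eta> * real (card D) + \<eta> * tile_mass F D \<kappa>)"
    by (rule mult_left_mono) fact
  moreover have "log 2 (real (npat (D - U) X)) \<le> c * real (card (inv_mul S (D - U)))"
    by (rule log_npat_le') (use S c D in auto)
  ultimately show ?thesis by (simp add: U_def)
qed

text \<open>Half of the proportion \<epsilon> is spent on bad positions whose tiles might stick out
  of \<open>D\<close>. Each remaining bad position gets one bad index, the covering lemma selects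
  positions, and \<kappa> records the tiles there with their patterns in \<open>x\<close>.\<close>

lemma frequently_bad_configuration:
  fixes F :: "nat \<Rightarrow> nat set" and K \<delta> :: real
  assumes F: "\<And>i. finite (F i)" "\<And>i. F i \<noteq> {}"
    and temp: "\<And>i. real (card (\<Union>j<i. inv_mul (F j) (F i))) \<le> K * real (card (F i))"
    and \<delta>: "0 < \<delta>" "\<delta> < 1" and I: "finite I" and D: "finite D"
    and inner: "real (card {g\<in>D. \<exists>i\<in>I. \<not> rtr (F i) g \<subseteq> D}) \<le> \<epsilon> / 2 * real (card D)"
    and x: "x \<in> frequently_bad F V I D \<epsilon>"
  obtains \<kappa> where "\<kappa> \<in> D \<rightarrow>\<^sub>E insert None (Some ` Sigma I V)"
    and "tiled F D \<kappa> \<subseteq> D" and "(1 - \<delta>) * tile_mass F D \<kappa> \<le> real (card (tiled F D \<kappa>))"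
    and "\<epsilon> / 2 * real (card D) \<le> real (card (tiled F D \<kappa>)) / \<delta> + K * tile_mass F D \<kappa>"
    and "\<And>g i p. g \<in> D \<Longrightarrow> \<kappa> g = Some (i, p) \<Longrightarrow> pr (F i) (shift G g x) = p"
proof -
  define B where "B = {g\<in>D. \<exists>i\<in>I. pr (F i) (shift G g x) \<in> V i}"
  define N where "N = {g\<in>D. \<exists>i\<in>I. \<not> rtr (F i) g \<subseteq> D}"
  define E where "E = B - N"
  have fin: "finite B" "finite N" "finite E" using D by (auto simp: B_def N_def E_def)
  define \<iota> where "\<iota> g = (SOME i. i \<in> I \<and> pr (F i) (shift G g x) \<in> V i)" for g
  have \<iota>: "\<iota> g \<in> I \<and> pr (F (\<iota> g)) (shift G g x) \<in> V (\<iota> g)" if "g \<in> E" for g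
    unfolding \<iota>_def by (rule someI_ex) (use that in \<open>auto simp: E_def B_def\<close>)
  have "card B \<le> card (E \<union> N)" by (rule card_mono) (use fin in \<open>auto simp: E_def\<close>)
  also have "\<dots> \<le> card E + card N" by (rule card_Un_le)
  finally have "\<epsilon> * real (card D) \<le> real (card E) + real (card N)"
    using x by (simp add: frequently_bad_def B_def)
  then have E: "\<epsilon> / 2 * real (card D) \<le> real (card E)" using inner by (simp add: N_def)
  obtain T where T: "T \<subseteq> E"
    "(1 - \<delta>) * (\<Sum>g\<in>T. real (card (F (\<iota> g)))) \<le> real (card (\<Union>g\<in>T. rtr (F (\<iota> g)) g))"
    "real (card E) \<le> real (card (\<Union>g\<in>T. rtr (F (\<iota> g)) g)) / \<delta> + K * (\<Sum>g\<in>T. real (card (F (\<iota> g))))"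
    using tempered_cover[OF F temp \<delta> I fin(3), of \<iota>] \<iota> by blast
  define \<kappa> where "\<kappa> = restrict (\<lambda>g. if g \<in> T then Some (\<iota> g, pr (F (\<iota> g)) (shift G g x)) else None) D"
  have TD: "T \<subseteq> D" using T by (auto simp: E_def B_def)
  then have dom: "{g\<in>D. \<kappa> g \<noteq> None} = T" by (auto simp: \<kappa>_def)
  have fst: "fst (the (\<kappa> g)) = \<iota> g" if "g \<in> T" for g using that TD by (auto simp: \<kappa>_def)
  have tiled: "tiled F D \<kappa> = (\<Union>g\<in>T. rtr (F (\<iota> g)) g)" unfolding tiled_def dom by (simp add: fst)
  have mass: "tile_mass F D \<kappa> = (\<Sum>g\<in>T. real (card (F (\<iota> g))))" unfolding tile_mass_def dom by (simp add: fst)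
  show thesis
  proof (rule that)
    show "\<kappa> \<in> D \<rightarrow>\<^sub>E insert None (Some ` Sigma I V)"
      using \<iota> T(1) unfolding \<kappa>_def by (intro restrict_PiE_iff[THEN iffD2] ballI) auto
    show "tiled F D \<kappa> \<subseteq> D"
    proof -
      have "rtr (F (\<iota> g)) g \<subseteq> D" if "g \<in> T" for g
        using that T(1) \<iota>[of g] by (auto simp: E_def N_def B_def)
      then show ?thesis unfolding tiled by blast
    qed
    show "(1 - \<delta>) * tile_mass F D \<kappa> \<le> real (card (tiled F D \<kappa>))" unfolding tiled mass by fact
    show "\<epsilon> / 2 * real (card D) \<le> real (card (tiled F D \<kappa>)) / \<delta> + K * tile_mass F D \<kappa>"
      unfolding tiled mass using E T(3) by linarith
    show "pr (F i) (shift G g x) = p" if "g \<in> D" "\<kappa> g = Some (i, p)" for g i p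
      using that by (auto simp: \<kappa>_def split: if_splits)
  qed
qed

text \<open>A tiled cell is paid for with about \<open>s / (1 - \<delta>)\<close> bits instead of
  \<open>h\<close>, and the covering lemma gives a lower bound for the proportion of tiled cells;
  their product is the gain in the exponent. The power of \<open>1 + a\<close> accounts for the
  choice of the configuration, and the terms with \<eta> are boundary errors.\<close>

lemma npat_frequently_bad:
  fixes F :: "nat \<Rightarrow> nat set" and K \<delta> :: real
  assumes F: "\<And>i. finite (F i)" "\<And>i. F i \<noteq> {}"
    and temp: "\<And>i. real (card (\<Union>j<i. inv_mul (F j) (F i))) \<le> K * real (card (F i))" and K: "0 \<le> K"
    and \<delta>: "0 < \<delta>" "\<delta> < 1" and I: "finite I" and D: "finite D"
    and inner: "real (card {g\<in>D. \<exists>i\<in>I. \<not> rtr (F i) g \<subseteq> D}) \<le> \<epsilon> / 2 * real (card D)"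
    and S: "finite S" "S \<noteq> {}" "log 2 (real (npat S X)) \<le> (h + \<eta>) * real (card S)"
    and h: "0 \<le> h" "0 \<le> \<eta>" and s: "0 \<le> s" "s / (1 - \<delta>) \<le> h"
    and inv_F: "\<And>i. i \<in> I \<Longrightarrow> real (card (bdry S (F i))) \<le> \<eta> * real (card (F i))"
    and inv_D: "real (card (bdry S D)) \<le> \<eta> * real (card D)"
    and V: "\<And>i. i \<in> I \<Longrightarrow> finite (V i)"
    and wt: "(\<Sum>i\<in>I. real (card (V i)) * 2 powr (- s * real (card (F i)))) \<le> a"
  shows "real (npat D (frequently_bad F V I D \<epsilon>)) \<le>
    (1 + a) ^ card D * 2 powr (((h + \<eta>) * (1 + \<eta> + \<eta> / (1 - \<delta>)) -
      (h - s / (1 - \<delta>)) * (\<epsilon> / 2 / (1 / \<delta> + K / (1 - \<delta>)))) * real (card D))"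
    (is "_ \<le> _ * 2 powr (?e * _)")
proof -
  let ?O = "insert None (Some ` Sigma I V)"
  define \<K> where "\<K> = {\<kappa> \<in> D \<rightarrow>\<^sub>E ?O. tiled F D \<kappa> \<subseteq> D \<and> (1 - \<delta>) * tile_mass F D \<kappa> \<le> real (card (tiled F D \<kappa>)) \<and>
    \<epsilon> / 2 * real (card D) \<le> real (card (tiled F D \<kappa>)) / \<delta> + K * tile_mass F D \<kappa>}"
  define Z where "Z \<kappa> = {x\<in>X. \<forall>g i p. g \<in> D \<longrightarrow> \<kappa> g = Some (i, p) \<longrightarrow> pr (F i) (shift G g x) = p}" for \<kappa>
  have finO: "finite ?O" using I V by (intro finite.insertI finite_imageI finite_SigmaI) auto
  have finP: "finite (D \<rightarrow>\<^sub>E ?O)" by (rule finite_PiE[OF D]) (rule finO)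
  then have finK: "finite \<K>" by (simp add: \<K>_def)
  have "pr D ` frequently_bad F V I D \<epsilon> \<subseteq> (\<Union>\<kappa>\<in>\<K>. pr D ` Z \<kappa>)"
  proof clarify
    fix x assume x: "x \<in> frequently_bad F V I D \<epsilon>"
    then have "x \<in> X" by (simp add: frequently_bad_def)
    show "pr D x \<in> (\<Union>\<kappa>\<in>\<K>. pr D ` Z \<kappa>)"
    proof (rule frequently_bad_configuration[OF F temp \<delta> I D inner x])
      fix \<kappa>
      assume "\<kappa> \<in> D \<rightarrow>\<^sub>E ?O" "tiled F D \<kappa> \<subseteq> D" "(1 - \<delta>) * tile_mass F D \<kappa> \<le> real (card (tiled F D \<kappa>))"
        "\<epsilon> / 2 * real (card D) \<le> real (card (tiled F D \<kappa>)) / \<delta> + K * tile_mass F D \<kappa>"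
      then have "\<kappa> \<in> \<K>" by (simp add: \<K>_def)
      moreover assume "\<And>g i p. g \<in> D \<Longrightarrow> \<kappa> g = Some (i, p) \<Longrightarrow> pr (F i) (shift G g x) = p"
      then have "x \<in> Z \<kappa>" using \<open>x \<in> X\<close> by (simp add: Z_def)
      ultimately show ?thesis by blast
    qed
  qed
  then have "npat D (frequently_bad F V I D \<epsilon>) \<le> card (\<Union>\<kappa>\<in>\<K>. pr D ` Z \<kappa>)"
    unfolding npat_def by (rule card_mono[rotated]) (use finK fin_pr[OF D] in \<open>auto simp: Z_def\<close>)
  also have "\<dots> \<le> (\<Sum>\<kappa>\<in>\<K>. npat D (Z \<kappa>))"
    unfolding npat_def by (rule card_UN_le[OF finK])
  finally have le1: "real (npat D (frequently_bad F V I D \<epsilon>)) \<le> (\<Sum>\<kappa>\<in>\<K>. real (npat D (Z \<kappa>)))"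
    by (simp only: flip: of_nat_sum)
  have le2: "real (npat D (Z \<kappa>)) \<le> (\<Prod>g\<in>D. tile_weight F s (\<kappa> g)) * 2 powr (?e * real (card D))"
    if \<kappa>: "\<kappa> \<in> \<K>" for \<kappa>
  proof -
    define U where "U = tiled F D \<kappa>"
    define u where "u = real (card U)"
    define d where "d = real (card D)"
    define m where "m = tile_mass F D \<kappa>"
    \<comment> \<open>With \<open>m \<le> u / (1 - \<delta>)\<close> the density bound
      \<open>u / \<delta> + K * m\<close> becomes \<open>u * b\<close>, so at least the proportion
      \<open>\<epsilon> / 2 / b\<close> of \<open>D\<close> is tiled.\<close>
    define b where "b = 1 / \<delta> + K / (1 - \<delta>)"
    have b: "0 < b" using \<delta> K by (simp add: b_def add_pos_nonneg)
    have UD: "U \<subseteq> D" and mass: "(1 - \<delta>) * m \<le> u" and dens: "\<epsilon> / 2 * d \<le> u / \<delta> + K * m"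
      using \<kappa> by (auto simp: \<K>_def U_def u_def d_def m_def)
    have u: "0 \<le> u" "u \<le> d" using card_mono[OF D UD] by (auto simp: u_def d_def)
    have m: "m \<le> u / (1 - \<delta>)" using mass \<delta> by (simp add: field_simps)
    have m0: "0 \<le> m" by (simp add: m_def tile_mass_def sum_nonneg)
    \<comment> \<open>The configuration prescribes the point on all of \<open>U\<close>, so only the
      symbols outside \<open>U\<close> are free.\<close>
    have "npat D (Z \<kappa>) = npat (D - U) (Z \<kappa>)"
      unfolding npat_def
    proof (rule card_image_cong)
      fix x y assume x: "x \<in> Z \<kappa>" and y: "y \<in> Z \<kappa>"
      have "x v = y v" if v: "v \<in> U" for v
      proof -
        obtain g where g: "g \<in> D" "\<kappa> g \<noteq> None" "v \<in> rtr (F (fst (the (\<kappa> g)))) g"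
          using v by (auto simp: U_def tiled_def)
        then obtain i p where ip: "\<kappa> g = Some (i, p)" by auto
        with g obtain w where w: "w \<in> F i" "v = w \<otimes> g" by auto
        have "pr (F i) (shift G g x) = pr (F i) (shift G g y)"
          using x y g(1) ip by (auto simp: Z_def)
        then show ?thesis using w by (auto simp: pr_eq_iff shift_def)
      qed
      then show "pr D x = pr D y \<longleftrightarrow> pr (D - U) x = pr (D - U) y" by (auto simp: pr_eq_iff)
    qed
    also have "\<dots> \<le> npat (D - U) X"
      by (rule npat_mono) (use fin_pr D in \<open>auto simp: Z_def\<close>)
    finally have "real (npat D (Z \<kappa>)) \<le> real (npat (D - U) X)" by simp
    also have "\<dots> = 2 powr log 2 (real (npat (D - U) X))"
      using npat_X_pos[of "D - U"] D by simp
    also have "\<dots> \<le> 2 powr ((h + \<eta>) * (d - u + \<eta> * d + \<eta> * m))"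
    proof (rule powr_mono)
      show "log 2 (real (npat (D - U) X)) \<le> (h + \<eta>) * (d - u + \<eta> * d + \<eta> * m)"
        unfolding U_def u_def d_def m_def
      proof (rule npat_complement_tiled[OF D S _ F(1) _ _ inv_D])
        show "real (card (bdry S (F (fst (the (\<kappa> g)))))) \<le> \<eta> * real (card (F (fst (the (\<kappa> g)))))"
          if g: "g \<in> D" "\<kappa> g \<noteq> None" for g
        proof (rule inv_F)
          have "\<kappa> g \<in> ?O" using \<kappa> g(1) by (auto simp: \<K>_def PiE_iff)
          then show "fst (the (\<kappa> g)) \<in> I" using g(2) by auto
        qed
      qed (use h UD U_def in auto)
    qed simp
    \<comment> \<open>The factor \<open>2 powr (- s * m)\<close> is split off as the weight of the
      configuration, to be summed later; the matching term \<open>s * m\<close> is charged against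
      the saving \<open>h * u\<close>.\<close>
    also have "\<dots> \<le> 2 powr (- s * m + ?e * d)"
    proof (rule powr_mono)
      have "(h + \<eta>) * (d - u + \<eta> * d + \<eta> * m) \<le> (h + \<eta>) * (d - u + \<eta> * d + \<eta> * (d / (1 - \<delta>)))"
        using m u \<delta> h by (intro mult_left_mono add_left_mono order_trans[OF m] divide_right_mono) auto
      also have "\<dots> = (h + \<eta>) * (1 + \<eta> + \<eta> / (1 - \<delta>)) * d - h * u - \<eta> * u" by (simp add: algebra_simps)
      also have "\<dots> \<le> (h + \<eta>) * (1 + \<eta> + \<eta> / (1 - \<delta>)) * d - h * u" using h u by simp
      finally have 1: "(h + \<eta>) * (d - u + \<eta> * d + \<eta> * m) \<le> (h + \<eta>) * (1 + \<eta> + \<eta> / (1 - \<delta>)) * d - h * u" .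
      have "s * m \<le> s * (u / (1 - \<delta>))" using m s by (intro mult_left_mono) auto
      then have 2: "s * m \<le> s / (1 - \<delta>) * u" by simp
      have "K * m \<le> K * (u / (1 - \<delta>))" using m K by (rule mult_left_mono)
      moreover have "u * b = u / \<delta> + K * (u / (1 - \<delta>))" by (simp add: b_def distrib_left mult.commute)
      ultimately have "\<epsilon> / 2 * d \<le> u * b" using dens by linarith
      then have "\<epsilon> / 2 / b * d \<le> u" using b by (simp add: field_simps)
      then have 3: "(h - s / (1 - \<delta>)) * (\<epsilon> / 2 / b * d) \<le> (h - s / (1 - \<delta>)) * u"
        using s by (intro mult_left_mono) auto
      have "(h - s / (1 - \<delta>)) * u = h * u - s / (1 - \<delta>) * u" by (rule left_diff_distrib)
      with 1 2 3 show "(h + \<eta>) * (d - u + \<eta> * d + \<eta> * m) \<le> - s * m + ?e * d"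
        unfolding b_def[symmetric] by (simp add: left_diff_distrib mult.assoc)
    qed simp
    also have "\<dots> = (\<Prod>g\<in>D. tile_weight F s (\<kappa> g)) * 2 powr (?e * real (card D))"
      unfolding prod_tile_weight[OF D] by (simp only: powr_add m_def d_def)
    finally show ?thesis .
  qed
  have "(\<Sum>\<kappa>\<in>\<K>. real (npat D (Z \<kappa>))) \<le> (\<Sum>\<kappa>\<in>\<K>. (\<Prod>g\<in>D. tile_weight F s (\<kappa> g)) * 2 powr (?e * real (card D)))"
    by (rule sum_mono) (rule le2)
  also have "\<dots> = (\<Sum>\<kappa>\<in>\<K>. \<Prod>g\<in>D. tile_weight F s (\<kappa> g)) * 2 powr (?e * real (card D))"
    by (simp add: sum_distrib_right)
  also have "\<dots> \<le> (1 + a) ^ card D * 2 powr (?e * real (card D))"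
  proof (rule mult_right_mono)
    have "(\<Sum>\<kappa>\<in>\<K>. \<Prod>g\<in>D. tile_weight F s (\<kappa> g)) \<le> (\<Sum>\<kappa>\<in>D \<rightarrow>\<^sub>E ?O. \<Prod>g\<in>D. tile_weight F s (\<kappa> g))"
      by (rule sum_mono2[OF finP]) (auto simp: \<K>_def prod_tile_weight[OF D])
    also have "\<dots> = (1 + (\<Sum>i\<in>I. real (card (V i)) * 2 powr (- s * real (card (F i))))) ^ card D"
      by (rule sum_configurations[OF D I V])
    also have "\<dots> \<le> (1 + a) ^ card D"
      by (intro power_mono add_left_mono wt) (auto intro!: add_nonneg_nonneg sum_nonneg)
    finally show "(\<Sum>\<kappa>\<in>\<K>. \<Prod>g\<in>D. tile_weight F s (\<kappa> g)) \<le> (1 + a) ^ card D" .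
  qed simp
  finally show ?thesis using le1 by linarith
qed

end

section \<open>Avoiding rare families of patterns\<close>

context group_subshift
begin

text \<open>The comparison is with \<open>2 powr (entropy * card (F m))\<close>, a lower bound for
  the number of all patterns of \<open>X\<close> on \<open>F m\<close>, so finitely many rare
  families cannot exhaust these patterns for large \<open>m\<close>. Finite sets \<open>I\<close>
  suffice because compactness deals with finitely many indices at a time.\<close>

definition rare :: "(nat \<Rightarrow> nat set) \<Rightarrow> real \<Rightarrow> (nat \<Rightarrow> (nat \<Rightarrow> 'a option) set) \<Rightarrow> bool" where
  "rare F \<epsilon> V \<longleftrightarrow> (\<exists>c>0. \<forall>I. finite I \<longrightarrow> (\<forall>\<^sub>F m in sequentially.
     real (npat (F m) (frequently_bad F V I (F m) \<epsilon>)) \<le> 2 powr ((entropy - c) * real (card (F m)))))"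

text \<open>The exponential gain \<open>b\<close> of the counting bound is fixed first; then \<eta>
  and the weight bound \<open>a\<close> are taken so small that each uses up at most a quarter of
  it.\<close>

lemma rare_tail:
  fixes F :: "nat \<Rightarrow> nat set"
  assumes F: "Folner_sequence G F"
    and temp: "\<And>i. real (card (\<Union>j<i. inv_mul (F j) (F i))) \<le> K * real (card (F i))" and K: "0 \<le> K"
    and s: "0 \<le> s" "s < entropy" and \<epsilon>: "0 < \<epsilon>"
    and V: "\<And>i. finite (V i)" "\<And>i j. F i = F j \<Longrightarrow> V i = V j"
    and wt: "\<And>a. 0 < a \<Longrightarrow> \<exists>N. \<forall>I. finite I \<longrightarrow> I \<subseteq> {N..} \<longrightarrow> inj_on F I \<longrightarrow>
      (\<Sum>i\<in>I. real (card (V i)) * 2 powr (- s * real (card (F i)))) \<le> a"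
  shows "\<exists>N. rare F \<epsilon> (\<lambda>i. if i < N then {} else V i)"
proof -
  note fin = Folner_finite[OF F] and pos = Folner_card_pos[OF F]
  have ne: "F i \<noteq> {}" for i using pos[of i] by auto
  \<comment> \<open>With this choice \<open>s / (1 - \<delta>)\<close> equals
    \<open>2 * s * entropy / (entropy + s)\<close>, a harmonic mean, which lies below
    \<open>entropy\<close> because \<open>s\<close> does.\<close>
  define \<delta> where "\<delta> = (entropy - s) / (2 * entropy)"
  have h0: "0 < entropy" using s by linarith
  have \<delta>: "0 < \<delta>" "\<delta> < 1" using s h0 by (auto simp: \<delta>_def field_simps)
  have "1 - \<delta> = (entropy + s) / (2 * entropy)" using h0 by (simp add: \<delta>_def field_simps)
  then have "s / (1 - \<delta>) = 2 * s * entropy / (entropy + s)" by simp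
  also have "\<dots> < entropy" using s h0 by (simp add: field_simps)
  finally have sh: "s / (1 - \<delta>) < entropy" .
  define b where "b = (entropy - s / (1 - \<delta>)) * (\<epsilon> / 2 / (1 / \<delta> + K / (1 - \<delta>)))"
  have b: "0 < b" unfolding b_def using sh \<epsilon> \<delta> K by (intro mult_pos_pos divide_pos_pos add_pos_nonneg) auto
  have "((\<lambda>\<eta>. (entropy + \<eta>) * (1 + \<eta> + \<eta> / (1 - \<delta>))) \<longlongrightarrow> (entropy + 0) * (1 + 0 + 0 / (1 - \<delta>))) (at_right 0)"
    by (intro tendsto_intros) (use \<delta> in auto)
  then have "\<forall>\<^sub>F \<eta> in at_right 0. (entropy + \<eta>) * (1 + \<eta> + \<eta> / (1 - \<delta>)) < entropy + b / 4"
    using b by (intro order_tendstoD(2)) auto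
  moreover have "\<forall>\<^sub>F \<eta> in at_right (0::real). 0 < \<eta>" by (simp add: eventually_at_right_less)
  ultimately have "\<forall>\<^sub>F \<eta> in at_right 0. (entropy + \<eta>) * (1 + \<eta> + \<eta> / (1 - \<delta>)) < entropy + b / 4 \<and> 0 < \<eta>"
    by (rule eventually_conj)
  then obtain \<eta> where \<eta>: "(entropy + \<eta>) * (1 + \<eta> + \<eta> / (1 - \<delta>)) < entropy + b / 4" "0 < \<eta>"
    using eventually_happens[of _ "at_right (0::real)"] by fastforce
  \<comment> \<open>Then \<open>(1 + a) ^ card D\<close> is \<open>2 powr (b / 4 * card D)\<close>;
    together with the error \<open>b / 4\<close> from \<eta>, the gain that remains is
    \<open>b / 2\<close>.\<close>
  define a where "a = 2 powr (b / 4) - 1"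
  have a: "0 < a" using b by (simp add: a_def)
  obtain S where S: "finite S" "S \<noteq> {}" "log 2 (real (npat S X)) < (entropy + \<eta>) * real (card S)"
    using entropy_approx[OF \<eta>(2)] by blast
  have inv: "\<forall>\<^sub>F m in sequentially. real (card (bdry T (F m))) \<le> t * real (card (F m))" if "finite T" "0 < t" for T t
  proof -
    have "\<forall>\<^sub>F m in sequentially. real (card (bdry T (F m))) / real (card (F m)) < t"
      by (rule order_tendstoD(2)[OF Folner_bdry[OF F that(1)] that(2)])
    then show ?thesis
    proof eventually_elim
      case (elim m)
      then show ?case using pos[of m] by (simp add: field_simps)
    qed
  qed
  obtain N1 where N1: "\<And>i. N1 \<le> i \<Longrightarrow> real (card (bdry S (F i))) \<le> \<eta> * real (card (F i))"
    using inv[OF S(1) \<eta>(2)] by (auto simp: eventually_sequentially)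
  obtain N2 where N2: "\<And>I. finite I \<Longrightarrow> I \<subseteq> {N2..} \<Longrightarrow> inj_on F I \<Longrightarrow>
      (\<Sum>i\<in>I. real (card (V i)) * 2 powr (- s * real (card (F i)))) \<le> a"
    using wt[OF a] by blast
  define N where "N = max N1 N2"
  show ?thesis
    unfolding rare_def
  proof (intro exI[of _ N], rule exI[of _ "b / 2"], intro conjI allI impI)
    show "0 < b / 2" using b by simp
    fix I :: "nat set" assume I: "finite I"
    \<comment> \<open>The sequence may repeat a set, which would count its weight several times.
      \<open>J\<close> keeps one index per set; nothing is lost since \<open>V\<close> depends only
      on the set \<open>F i\<close>.\<close>
    obtain J where J: "J \<subseteq> I \<inter> {N..}" "inj_on F J" "F ` (I \<inter> {N..}) = F ` J"
      using subset_image_inj[of "F ` (I \<inter> {N..})" F "I \<inter> {N..}"] by auto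
    have finJ: "finite J" using J(1) I finite_subset by blast
    have finUJ: "finite (\<Union>i\<in>J. F i)" using finJ fin by auto
    show "\<forall>\<^sub>F m in sequentially. real (npat (F m) (frequently_bad F (\<lambda>i. if i < N then {} else V i) I (F m) \<epsilon>))
        \<le> 2 powr ((entropy - b / 2) * real (card (F m)))"
      using inv[OF S(1) \<eta>(2)] inv[OF finUJ half_gt_zero[OF \<epsilon>]]
    proof eventually_elim
      case (elim m)
      define D where "D = F m"
      have finD: "finite D" by (simp add: D_def fin)
      have "frequently_bad F (\<lambda>i. if i < N then {} else V i) I D \<epsilon> \<subseteq> frequently_bad F V J D \<epsilon>"
      proof
        fix x assume x: "x \<in> frequently_bad F (\<lambda>i. if i < N then {} else V i) I D \<epsilon>"
        have "{g\<in>D. \<exists>i\<in>I. pr (F i) (shift G g x) \<in> (if i < N then {} else V i)}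
          \<subseteq> {g\<in>D. \<exists>i\<in>J. pr (F i) (shift G g x) \<in> V i}"
        proof clarify
          fix g i assume i: "i \<in> I" "pr (F i) (shift G g x) \<in> (if i < N then {} else V i)"
          then have "i \<in> I \<inter> {N..}" "pr (F i) (shift G g x) \<in> V i" by (auto split: if_splits)
          moreover from this J(3) obtain j where j: "j \<in> J" "F i = F j" by blast
          ultimately show "\<exists>i\<in>J. pr (F i) (shift G g x) \<in> V i" using V(2)[OF j(2)] by auto
        qed
        then have "card {g\<in>D. \<exists>i\<in>I. pr (F i) (shift G g x) \<in> (if i < N then {} else V i)}
          \<le> card {g\<in>D. \<exists>i\<in>J. pr (F i) (shift G g x) \<in> V i}"
          by (rule card_mono[rotated]) (simp add: finD)
        then show "x \<in> frequently_bad F V J D \<epsilon>"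
          using x unfolding frequently_bad_def by auto
      qed
      then have "npat D (frequently_bad F (\<lambda>i. if i < N then {} else V i) I D \<epsilon>) \<le> npat D (frequently_bad F V J D \<epsilon>)"
        by (intro npat_mono fin_pr finD) (auto simp: frequently_bad_def)
      then have "real (npat D (frequently_bad F (\<lambda>i. if i < N then {} else V i) I D \<epsilon>)) \<le> real (npat D (frequently_bad F V J D \<epsilon>))"
        by simp
      also have "\<dots> \<le> (1 + a) ^ card D * 2 powr (((entropy + \<eta>) * (1 + \<eta> + \<eta> / (1 - \<delta>)) - b) * real (card D))"
        unfolding b_def
      proof (rule npat_frequently_bad[OF fin ne temp K \<delta> finJ finD _ S(1,2)])
        have "{g\<in>D. \<exists>i\<in>J. \<not> rtr (F i) g \<subseteq> D} \<subseteq> bdry (\<Union>i\<in>J. F i) D"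
          by (auto simp: bdry_def)
        then have "card {g\<in>D. \<exists>i\<in>J. \<not> rtr (F i) g \<subseteq> D} \<le> card (bdry (\<Union>i\<in>J. F i) D)"
          by (rule card_mono[rotated]) (rule finite_bdry[OF finUJ finD])
        then show "real (card {g\<in>D. \<exists>i\<in>J. \<not> rtr (F i) g \<subseteq> D}) \<le> \<epsilon> / 2 * real (card D)"
          using elim by (simp add: D_def)
        show "(\<Sum>i\<in>J. real (card (V i)) * 2 powr (- s * real (card (F i)))) \<le> a"
          by (rule N2) (use J finJ in \<open>auto simp: N_def\<close>)
        show "real (card (bdry S (F i))) \<le> \<eta> * real (card (F i))" if "i \<in> J" for i
          by (rule N1) (use J that in \<open>auto simp: N_def\<close>)
        show "real (card (bdry S D)) \<le> \<eta> * real (card D)" using elim by (simp add: D_def)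
      qed (use S(3) \<eta>(2) s(1) sh V(1) entropy_nonneg in \<open>simp_all add: less_imp_le\<close>)
      also have "(1 + a) ^ card D = 2 powr (b / 4 * real (card D))"
        by (simp add: a_def powr_realpow[symmetric] powr_powr)
      also have "2 powr (b / 4 * real (card D)) * 2 powr (((entropy + \<eta>) * (1 + \<eta> + \<eta> / (1 - \<delta>)) - b) * real (card D))
        = 2 powr ((b / 4 + ((entropy + \<eta>) * (1 + \<eta> + \<eta> / (1 - \<delta>)) - b)) * real (card D))"
        by (simp only: powr_add distrib_right)
      also have "\<dots> \<le> 2 powr ((entropy - b / 2) * real (card D))"
        using \<eta>(1) by (intro powr_mono mult_right_mono) auto
      finally show ?case by (simp add: D_def)
    qed
  qed
qed

section \<open>Cylinders and compactness in the configuration space\<close>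

abbreviation conf_top :: "(nat \<Rightarrow> 'a) topology" where
  "conf_top \<equiv> product_topology (\<lambda>_. discrete_topology A) UNIV"

lemma closedin_X: "closedin conf_top X"
  using subshift by (simp add: subshift_def)

lemma compact_conf_top: "compact_space conf_top"
  by (simp add: compact_space_product_topology compact_space_discrete_topology finite_A)

lemma openin_pattern:
  assumes "finite E"
  shows "openin conf_top {x \<in> topspace conf_top. Q (pr E x)}"
proof (subst openin_subopen, intro ballI)
  fix x assume x: "x \<in> {x \<in> topspace conf_top. Q (pr E x)}"
  define B where "B = (\<Pi>\<^sub>E j\<in>UNIV. if j \<in> E then {x j} else A)"
  have "finite {j\<in>UNIV. (if j \<in> E then {x j} else A) \<noteq> topspace (discrete_topology A)}"
    by (rule finite_subset[OF _ assms]) auto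
  then have "openin conf_top B"
    unfolding B_def using x by (subst openin_PiE_gen) (auto simp: PiE_iff)
  moreover have "x \<in> B" using x by (auto simp: B_def PiE_iff)
  moreover have "B \<subseteq> {x \<in> topspace conf_top. Q (pr E x)}"
  proof
    fix y assume y: "y \<in> B"
    have yj: "y j \<in> (if j \<in> E then {x j} else A)" for j using y by (auto simp: B_def PiE_iff)
    have "y d = x d" if "d \<in> E" for d using yj[of d] that by simp
    then have "pr E y = pr E x" by (simp add: pr_eq_iff)
    moreover have "y j \<in> A" for j using yj[of j] x by (auto simp: PiE_iff split: if_splits)
    ultimately show "y \<in> {x \<in> topspace conf_top. Q (pr E x)}" using x by (auto simp: PiE_iff)
  qed
  ultimately show "\<exists>T. openin conf_top T \<and> x \<in> T \<and> T \<subseteq> {x \<in> topspace conf_top. Q (pr E x)}" by blast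
qed

lemma closedin_pattern:
  assumes "finite E"
  shows "closedin conf_top {x \<in> X. Q (pr E x)}"
proof -
  have "topspace conf_top - {x \<in> topspace conf_top. \<not> Q (pr E x)} = {x \<in> topspace conf_top. Q (pr E x)}"
    by auto
  then have "closedin conf_top {x \<in> topspace conf_top. Q (pr E x)}"
    using closedin_diff[OF closedin_topspace openin_pattern[OF assms, of "\<lambda>p. \<not> Q p"]] by simp
  then have "closedin conf_top (X \<inter> {x \<in> topspace conf_top. Q (pr E x)})"
    by (rule closedin_Int[OF closedin_X])
  moreover have "X \<inter> {x \<in> topspace conf_top. Q (pr E x)} = {x \<in> X. Q (pr E x)}"
    using closedin_subset[OF closedin_X] by auto
  ultimately show ?thesis by simp
qed

text \<open>Two pigeonhole arguments on a large \<open>D = F m\<close>. The frequently bad patterns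
  of all \<open>n\<close> families are fewer than the patterns of \<open>X\<close>, so some
  \<open>x\<close> is frequently bad for none. Its bad positions then make up less than the sum of
  the \<open>\<epsilon> k\<close>, hence not all of \<open>D\<close>, and shifting \<open>x\<close>
  by a remaining position gives the point.\<close>

lemma rare_finite_avoid:
  fixes V :: "nat \<Rightarrow> nat \<Rightarrow> (nat \<Rightarrow> 'a option) set" and n :: nat
  assumes F: "Folner_sequence G F" and rare: "\<And>k. k < n \<Longrightarrow> rare F (\<epsilon> k) (V k)"
    and \<epsilon>: "(\<Sum>k<n. \<epsilon> k) < 1" and I: "finite I"
  shows "\<exists>x\<in>X. \<forall>k<n. \<forall>i\<in>I. pr (F i) x \<notin> V k i"
proof -
  note fin = Folner_finite[OF F] and pos = Folner_card_pos[OF F]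
  have "\<forall>k\<in>{..<n}. \<exists>c>0. \<forall>\<^sub>F m in sequentially.
     real (npat (F m) (frequently_bad F (V k) I (F m) (\<epsilon> k))) \<le> 2 powr ((entropy - c) * real (card (F m)))"
    using rare I by (auto simp: rare_def)
  from bchoice[OF this] obtain c where "\<forall>k\<in>{..<n}. 0 < c k \<and> (\<forall>\<^sub>F m in sequentially.
     real (npat (F m) (frequently_bad F (V k) I (F m) (\<epsilon> k))) \<le> 2 powr ((entropy - c k) * real (card (F m))))"
    by blast
  then have c: "\<And>k. k < n \<Longrightarrow> 0 < c k" "\<And>k. k < n \<Longrightarrow> \<forall>\<^sub>F m in sequentially.
     real (npat (F m) (frequently_bad F (V k) I (F m) (\<epsilon> k))) \<le> 2 powr ((entropy - c k) * real (card (F m)))"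
    by auto
  have "((\<lambda>m. \<Sum>k<n. 2 powr (- c k * real (card (F m)))) \<longlongrightarrow> (\<Sum>k<n. 0)) sequentially"
  proof (rule tendsto_sum)
    fix k assume "k \<in> {..<n}"
    then have "0 < c k" using c by simp
    then have "filterlim (\<lambda>m. - c k * ln 2 * real (card (F m))) at_bot sequentially"
      by (intro filterlim_tendsto_neg_mult_at_bot[OF tendsto_const _ Folner_card_at_top[OF F]]) simp
    then have "((\<lambda>m. exp (- c k * ln 2 * real (card (F m)))) \<longlongrightarrow> 0) sequentially"
      by (rule filterlim_compose[OF exp_at_bot])
    then show "((\<lambda>m. 2 powr (- c k * real (card (F m)))) \<longlongrightarrow> 0) sequentially"
      by (simp add: powr_def ac_simps)
  qed
  then have "\<forall>\<^sub>F m in sequentially. (\<Sum>k<n. 2 powr (- c k * real (card (F m)))) < 1"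
    by (intro order_tendstoD(2)) auto
  moreover have "\<forall>\<^sub>F m in sequentially. \<forall>k\<in>{..<n}.
     real (npat (F m) (frequently_bad F (V k) I (F m) (\<epsilon> k))) \<le> 2 powr ((entropy - c k) * real (card (F m)))"
    by (rule eventually_ball_finite) (use c in auto)
  ultimately have "\<forall>\<^sub>F m in sequentially. (\<Sum>k<n. 2 powr (- c k * real (card (F m)))) < 1 \<and> (\<forall>k\<in>{..<n}.
     real (npat (F m) (frequently_bad F (V k) I (F m) (\<epsilon> k))) \<le> 2 powr ((entropy - c k) * real (card (F m))))"
    by (rule eventually_conj)
  then obtain m where m: "(\<Sum>k<n. 2 powr (- c k * real (card (F m)))) < 1" "\<And>k. k < n \<Longrightarrow>
     real (npat (F m) (frequently_bad F (V k) I (F m) (\<epsilon> k))) \<le> 2 powr ((entropy - c k) * real (card (F m)))"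
    using eventually_happens[of _ sequentially] by fastforce
  define D where "D = F m"
  define B where "B k = frequently_bad F (V k) I D (\<epsilon> k)" for k
  have D: "finite D" "0 < card D" using fin pos by (auto simp: D_def)
  have BX: "B k \<subseteq> X" for k by (auto simp: B_def frequently_bad_def)
  have "real (card (\<Union>k<n. pr D ` B k)) \<le> (\<Sum>k<n. real (npat D (B k)))"
    unfolding npat_def of_nat_sum[symmetric] of_nat_le_iff by (rule card_UN_le) simp
  also have "\<dots> \<le> (\<Sum>k<n. 2 powr (entropy * real (card D)) * 2 powr (- c k * real (card D)))"
    using m(2) by (intro sum_mono) (simp add: B_def D_def powr_add[symmetric] left_diff_distrib)
  also have "\<dots> = 2 powr (entropy * real (card D)) * (\<Sum>k<n. 2 powr (- c k * real (card D)))"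
    by (simp add: sum_distrib_left)
  also have "\<dots> < 2 powr (entropy * real (card D)) * 1"
    using m(1) by (intro mult_strict_left_mono) (auto simp: D_def)
  also have "\<dots> \<le> 2 powr log 2 (real (npat D X))"
    using entropy_lower[OF D(1)] by simp
  also have "\<dots> = real (card (pr D ` X))" using npat_X_pos[OF D(1)] by (simp add: npat_def)
  finally have "card (\<Union>k<n. pr D ` B k) < card (pr D ` X)" by simp
  then have "\<not> pr D ` X \<subseteq> (\<Union>k<n. pr D ` B k)"
    using card_mono[of "\<Union>k<n. pr D ` B k" "pr D ` X"] fin_pr[OF D(1) BX] by (auto simp: not_le[symmetric])
  then obtain x where x: "x \<in> X" "\<And>k. k < n \<Longrightarrow> x \<notin> B k" by blast
  define W where "W k = {g\<in>D. \<exists>i\<in>I. pr (F i) (shift G g x) \<in> V k i}" for k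
  have W: "real (card (W k)) \<le> \<epsilon> k * real (card D)" if "k < n" for k
    using x(1) x(2)[OF that] by (simp add: B_def frequently_bad_def W_def)
  have "real (card (\<Union>k<n. W k)) \<le> (\<Sum>k<n. real (card (W k)))"
    unfolding of_nat_sum[symmetric] of_nat_le_iff by (rule card_UN_le) simp
  also have "\<dots> \<le> (\<Sum>k<n. \<epsilon> k) * real (card D)"
    unfolding sum_distrib_right by (intro sum_mono W) auto
  also have "\<dots> < 1 * real (card D)"
    using \<epsilon> D by (intro mult_strict_right_mono) auto
  finally have "card (\<Union>k<n. W k) < card D" by simp
  then have "\<not> D \<subseteq> (\<Union>k<n. W k)"
    using card_mono[of "\<Union>k<n. W k" D] D by (auto simp: W_def not_le[symmetric])
  then obtain g where "g \<in> D" "\<And>k. k < n \<Longrightarrow> g \<notin> W k" by blast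
  then show ?thesis using x(1) shift_mem by (intro bexI[of _ "shift G g x"]) (auto simp: W_def)
qed

lemma rare_avoid:
  fixes V :: "nat \<Rightarrow> nat \<Rightarrow> (nat \<Rightarrow> 'a option) set"
  assumes F: "Folner_sequence G F" and rare: "\<And>k. rare F (\<epsilon> k) (V k)"
    and \<epsilon>: "\<And>n. (\<Sum>k<n. \<epsilon> k) < 1"
  shows "\<exists>x\<in>X. \<forall>k i. pr (F i) x \<notin> V k i"
proof -
  define C where "C n = (\<Inter>k\<in>{..n}. \<Inter>i\<in>{..n}. {x \<in> X. pr (F i) x \<notin> V k i})" for n
  have mem: "x \<in> C n \<longleftrightarrow> x \<in> X \<and> (\<forall>k\<le>n. \<forall>i\<le>n. pr (F i) x \<notin> V k i)" for x n
    by (auto simp: C_def)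
  have "(\<Inter>n. C n) \<noteq> {}"
  proof (rule compact_space_imp_nest[OF compact_conf_top])
    show "closedin conf_top (C n)" for n
      unfolding C_def by (intro closedin_INT closedin_pattern Folner_finite[OF F]) auto
    show "C n \<noteq> {}" for n
    proof -
      obtain x where "x \<in> X" "\<forall>k<Suc n. \<forall>i\<in>{..n}. pr (F i) x \<notin> V k i"
        using rare_finite_avoid[where n = "Suc n" and I = "{..n}", OF F rare \<epsilon>] by auto
      then have "x \<in> C n" by (simp add: mem less_Suc_eq_le)
      then show ?thesis by blast
    qed
    show "decseq C" by (rule decseq_SucI) (auto simp: mem)
  qed
  then obtain x where x: "\<And>n. x \<in> C n" by auto
  have "pr (F i) x \<notin> V k i" for k i
    using x[of "max k i"] by (simp add: mem)
  moreover have "x \<in> X" using x by (simp add: mem)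
  ultimately show ?thesis by blast
qed

end

section \<open>Perfect sets, locally admissible patterns, and short programs\<close>

context nat_group
begin

lemma set_inv_mult: "set_inv E <#> D = inv_mul E D"
  by (auto simp: SET_INV_def set_mult_def inv_mul_def)

end

context group_subshift
begin

lemma open_contains_cylinder:
  assumes "openin conf_top T" "x \<in> T"
  shows "\<exists>n. {y \<in> topspace conf_top. pr {..<n} y = pr {..<n} x} \<subseteq> T"
proof -
  obtain B where B: "x \<in> (\<Pi>\<^sub>E i\<in>UNIV. B i)" "finite {i. B i \<noteq> topspace (discrete_topology A)}" "(\<Pi>\<^sub>E i\<in>UNIV. B i) \<subseteq> T"
    using product_topology_open_contains_basis[OF assms] by blast
  obtain n where n: "{i. B i \<noteq> A} \<subseteq> {..<n}"
    using B(2) by (auto simp: finite_nat_iff_bounded)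
  have "{y \<in> topspace conf_top. pr {..<n} y = pr {..<n} x} \<subseteq> (\<Pi>\<^sub>E i\<in>UNIV. B i)"
  proof
    fix y assume y: "y \<in> {y \<in> topspace conf_top. pr {..<n} y = pr {..<n} x}"
    have "y i \<in> B i" for i
    proof (cases "i < n")
      case True
      then have "y i = x i" using y by (simp add: pr_eq_iff)
      then show ?thesis using B(1) by (auto simp: PiE_iff)
    next
      case False
      then have "B i = A" using n by auto
      then show ?thesis using y by (auto simp: PiE_iff)
    qed
    then show "y \<in> (\<Pi>\<^sub>E i\<in>UNIV. B i)" by auto
  qed
  with B(3) show ?thesis by blast
qed

text \<open>Cantor--Bendixson: the condensation points of \<open>Z\<close> form a nonempty perfect set.\<close>

lemma uncountable_closed_lepoll:
  assumes Z: "closedin conf_top Z" "Z \<subseteq> X" and unc: "uncountable Z"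
  shows "(UNIV :: real set) \<lesssim> Z"
proof -
  define cyl where "cyl n p = {y \<in> Z. pr {..<n} y = p}" for n p
  define P where "P = {x \<in> Z. \<forall>n. uncountable (cyl n (pr {..<n} x))}"
  \<comment> \<open>There are finitely many patterns for each length, so the countable cylinders
    form a countable collection and their union is countable.\<close>
  have "Z - P \<subseteq> (\<Union>n. \<Union>p\<in>{p \<in> pr {..<n} ` Z. countable (cyl n p)}. cyl n p)"
    by (auto simp: P_def cyl_def)
  moreover have "countable (\<Union>n. \<Union>p\<in>{p \<in> pr {..<n} ` Z. countable (cyl n p)}. cyl n p)"
    by (intro countable_UN) (auto intro!: countable_finite finite_subset[OF _ fin_pr[OF _ Z(2)]])
  ultimately have cnt: "countable (Z - P)" using countable_subset by blast
  have "P \<noteq> {}" using cnt unc by auto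
  have perfect: "conf_top derived_set_of P = P"
  proof
    show "P \<subseteq> conf_top derived_set_of P"
    proof
      fix x assume x: "x \<in> P"
      have "x \<in> topspace conf_top" using x closedin_subset[OF Z(1)] by (auto simp: P_def)
      moreover have "\<exists>y. y \<noteq> x \<and> y \<in> P \<and> y \<in> T" if T: "x \<in> T" "openin conf_top T" for T
      proof -
        obtain n where n: "{y \<in> topspace conf_top. pr {..<n} y = pr {..<n} x} \<subseteq> T"
          using open_contains_cylinder[OF T(2,1)] by blast
        have "uncountable (cyl n (pr {..<n} x) - ((Z - P) \<union> {x}))"
          using x cnt by (intro uncountable_minus_countable) (auto simp: P_def)
        then have "cyl n (pr {..<n} x) - ((Z - P) \<union> {x}) \<noteq> {}"
          using countable_empty by metis
        then obtain y where y: "y \<in> cyl n (pr {..<n} x)" "y \<in> P" "y \<noteq> x" by (auto simp: cyl_def)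
        then have "y \<in> T" using n closedin_subset[OF Z(1)] by (auto simp: cyl_def)
        with y show ?thesis by blast
      qed
      ultimately show "x \<in> conf_top derived_set_of P" by (simp only: in_derived_set_of) blast
    qed
    show "conf_top derived_set_of P \<subseteq> P"
    proof
      fix x assume x: "x \<in> conf_top derived_set_of P"
      have PZ: "P \<subseteq> Z" by (auto simp: P_def)
      have "conf_top derived_set_of P \<subseteq> conf_top derived_set_of Z"
        by (rule derived_set_of_mono[OF PZ])
      also have "\<dots> \<subseteq> Z" using Z(1) by (simp add: closedin_contains_derived_set)
      finally have xZ: "x \<in> Z" using x by blast
      have xtop: "x \<in> topspace conf_top" using xZ closedin_subset[OF Z(1)] by blast
      have "uncountable (cyl n (pr {..<n} x))" for n
      proof -
        have "openin conf_top {y \<in> topspace conf_top. pr {..<n} y = pr {..<n} x}"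
          by (rule openin_pattern[where Q = "\<lambda>p. p = pr {..<n} x"]) simp
        then obtain y where y: "y \<in> P" and eq: "pr {..<n} y = pr {..<n} x"
          using x xtop unfolding in_derived_set_of by (metis (mono_tags, lifting) mem_Collect_eq)
        have "uncountable (cyl n (pr {..<n} y))" using y by (simp add: P_def)
        then show ?thesis unfolding eq .
      qed
      with xZ show "x \<in> P" by (simp add: P_def)
    qed
  qed
  have "Hausdorff_space conf_top"
    by (simp add: Hausdorff_space_product_topology)
  moreover have "locally_compact_space conf_top"
    by (rule compact_imp_locally_compact_space[OF compact_conf_top])
  ultimately have "(UNIV :: real set) \<lesssim> P"
    using lepoll_perfect_set[OF _ perfect \<open>P \<noteq> {}\<close>] by blast
  also have "P \<lesssim> Z" by (rule subset_imp_lepoll) (auto simp: P_def)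
  finally show ?thesis .
qed

section \<open>Counting locally admissible patterns\<close>

lemma npat_le_power:
  assumes "finite T" and Y: "\<And>x. x \<in> Y \<Longrightarrow> range x \<subseteq> A"
  shows "npat T Y \<le> card A ^ card T"
proof -
  have "npat T Y ^ 1 \<le> (\<Prod>j\<in>T. npat {j} Y)"
  proof (rule Shearer_counting[OF finite_A assms(1) assms(1)])
    fix d assume "d \<in> T"
    then have "{j \<in> T. d \<in> {j}} = {d}" by auto
    then show "1 \<le> card {j \<in> T. d \<in> {j}}" by simp
  qed (use Y in auto)
  also have "\<dots> \<le> (\<Prod>j\<in>T. card A)"
  proof (rule prod_mono, intro conjI)
    fix j
    have "pr {j} x = [j \<mapsto> x j]" for x :: "nat \<Rightarrow> 'a"
      by (auto simp: pr_def restrict_map_def fun_eq_iff)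
    then have "pr {j} ` Y \<subseteq> (\<lambda>a. [j \<mapsto> a]) ` A" using Y by fastforce
    then show "npat {j} Y \<le> card A"
      unfolding npat_def using finite_A by (metis card_image_le card_mono finite_imageI order_trans)
  qed simp
  finally show ?thesis by simp
qed

lemma X_locally_admissible: "X \<subseteq> locally_admissible A (mult G) S (pr S ` X) E"
proof
  fix x assume x: "x \<in> X"
  have "pr S (\<lambda>s. x (s \<otimes> g)) \<in> pr S ` X" for g
    using shift_mem[OF x, of g] unfolding shift_def by (rule imageI)
  then show "x \<in> locally_admissible A (mult G) S (pr S ` X) E"
    using X_range[OF x] by (simp add: locally_admissible_def)
qed

text \<open>The count for \<open>X\<close> survives the enlargement: a translate of \<open>S\<close>
  based in \<open>E\<close> and contained in \<open>E\<close> still shows at most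
  \<open>npat S X\<close> patterns. The other translates meeting \<open>E\<close> are based in
  \<open>bdry S E\<close>, and for them the trivial bound \<open>card A ^ card S\<close> costs
  little.\<close>

lemma log_npat_locally_admissible:
  assumes S: "finite S" "S \<noteq> {}" and E: "finite E"
    and c: "log 2 (real (npat S X)) \<le> c * real (card S)"
  shows "log 2 (real (npat E (locally_admissible A (mult G) S (pr S ` X) E)))
    \<le> c * real (card E) + log 2 (real (card A)) * real (card (bdry S E))"
proof -
  define Y where "Y = locally_admissible A (mult G) S (pr S ` X) E"
  have Y: "range x \<subseteq> A" if "x \<in> Y" for x using that by (simp add: Y_def locally_admissible_def)
  have XY: "X \<subseteq> Y" unfolding Y_def by (rule X_locally_admissible)
  define H where "H = {g\<in>inv_mul S E. g \<in> E \<and> rtr S g \<subseteq> E}"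
  have finM: "finite (inv_mul S E)" by (rule finite_inv_mul[OF S(1) E])
  have cS: "0 < card S" using S by (simp add: card_gt_0_iff)
  have cA: "0 < card A" using finite_A A_nonempty by (simp add: card_gt_0_iff)
  have pX: "0 < npat S X" by (rule npat_X_pos[OF S(1)])
  have HE: "card H \<le> card E" by (rule card_mono[OF E]) (auto simp: H_def)
  have HB: "card (inv_mul S E - H) \<le> card (bdry S E)"
    by (rule card_mono) (auto simp: H_def bdry_def inv_mul_iff finite_inv_mul S E)
  have good: "npat (rtr S g) Y \<le> npat S X" if g: "g \<in> H" for g
  proof -
    have "npat (rtr S g) Y = card ((\<lambda>x. pr S (\<lambda>s. x (s \<otimes> g))) ` Y)"
      unfolding npat_def by (rule card_image_cong) (simp add: pr_eq_iff)
    also have "(\<lambda>x. pr S (\<lambda>s. x (s \<otimes> g))) ` Y \<subseteq> pr S ` X"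
      using g by (auto simp: Y_def locally_admissible_def H_def)
    then have "card ((\<lambda>x. pr S (\<lambda>s. x (s \<otimes> g))) ` Y) \<le> npat S X"
      unfolding npat_def by (rule card_mono[rotated]) (simp add: fin_pr S)
    finally show ?thesis .
  qed
  have bad: "npat (rtr S g) Y \<le> card A ^ card S" for g
    using npat_le_power[of "rtr S g" Y, OF _ Y] S by simp
  have "npat E Y ^ card S \<le> (\<Prod>g\<in>inv_mul S E. npat (rtr S g) Y)"
    by (rule npat_Shearer[OF finite_A Y S E])
  also have "\<dots> = (\<Prod>g\<in>inv_mul S E - H. npat (rtr S g) Y) * (\<Prod>g\<in>H. npat (rtr S g) Y)"
    by (rule prod.subset_diff) (auto simp: H_def finM)
  also have "\<dots> \<le> (\<Prod>g\<in>inv_mul S E - H. card A ^ card S) * (\<Prod>g\<in>H. npat S X)"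
    by (intro mult_le_mono prod_mono conjI good bad) auto
  also have "\<dots> = (card A ^ card S) ^ card (inv_mul S E - H) * npat S X ^ card H"
    by simp
  also have "\<dots> \<le> (card A ^ card S) ^ card (bdry S E) * npat S X ^ card E"
    by (intro mult_le_mono power_increasing HE HB) (use cA pX in auto)
  finally have "real (npat E Y) ^ card S \<le> (real (card A) ^ card S) ^ card (bdry S E) * real (npat S X) ^ card E"
    by (simp only: flip: of_nat_power of_nat_mult)
  moreover have "0 < npat E Y"
    by (rule npat_pos[OF finite_pr_image[OF E finite_A Y]]) (use XY X_nonempty in auto)
  ultimately have "log 2 (real (npat E Y) ^ card S) \<le> log 2 ((real (card A) ^ card S) ^ card (bdry S E) * real (npat S X) ^ card E)"
    using cA pX by (subst log_le_cancel_iff) auto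
  also have "\<dots> = real (card (bdry S E)) * (real (card S) * log 2 (real (card A))) + real (card E) * log 2 (real (npat S X))"
    using cA pX by (simp add: log_mult log_nat_power)
  also have "\<dots> \<le> real (card (bdry S E)) * (real (card S) * log 2 (real (card A))) + real (card E) * (c * real (card S))"
    by (intro add_left_mono mult_left_mono c) simp
  also have "\<dots> = (c * real (card E) + log 2 (real (card A)) * real (card (bdry S E))) * real (card S)"
    by (simp add: algebra_simps)
  finally have "log 2 (real (npat E Y)) * real (card S) \<le> (c * real (card E) + log 2 (real (card A)) * real (card (bdry S E))) * real (card S)"
    using \<open>0 < npat E Y\<close> by (simp add: log_nat_power mult.commute)
  then show ?thesis using cS by (simp add: Y_def)
qed

end

text \<open>The 2^n strings of length n contribute 2^(-n) in total. This plays the part of Kraft's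
  inequality; programs here need not be prefix-free, so the base is 4 instead of 2.\<close>

lemma sum_quarter_power_length_le:
  fixes P :: "bool list set"
  assumes "finite P"
  shows "(\<Sum>p\<in>P. (1 / 4 :: real) ^ length p) \<le> 2"
proof -
  have fin: "finite {p :: bool list. length p \<le> L}" for L
    using finite_lists_length_le[of "UNIV :: bool set" L] by simp
  have len: "finite {p :: bool list. length p = n}" "card {p :: bool list. length p = n} = 2 ^ n" for n
    using finite_lists_length_eq[of "UNIV :: bool set" n] card_lists_length_eq[of "UNIV :: bool set" n] by auto
  have eq: "(\<Sum>p\<in>{p :: bool list. length p \<le> L}. (1 / 4 :: real) ^ length p) = 2 - (1 / 2) ^ L" for L
  proof (induction L)
    case (Suc L)
    have "{p :: bool list. length p \<le> Suc L} = {p. length p \<le> L} \<union> {p. length p = Suc L}" by auto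
    then have "(\<Sum>p\<in>{p :: bool list. length p \<le> Suc L}. (1 / 4 :: real) ^ length p) =
      (\<Sum>p\<in>{p :: bool list. length p \<le> L}. (1 / 4) ^ length p) + (\<Sum>p\<in>{p :: bool list. length p = Suc L}. (1 / 4) ^ length p)"
      by (simp only:) (rule sum.union_disjoint, use fin len in auto)
    also have "(\<Sum>p\<in>{p :: bool list. length p = Suc L}. (1 / 4 :: real) ^ length p) = 2 ^ Suc L * (1 / 4) ^ Suc L"
      using len[of "Suc L"] by simp
    also have "\<dots> = (1 / 2) ^ Suc L" by (simp add: power_mult_distrib[symmetric] del: power_Suc)
    finally show ?case using Suc by simp
  qed simp
  define L where "L = Max (insert 0 (length ` P))"
  have "P \<subseteq> {p. length p \<le> L}" using assms by (auto simp: L_def)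
  then have "(\<Sum>p\<in>P. (1 / 4 :: real) ^ length p) \<le> (\<Sum>p\<in>{p :: bool list. length p \<le> L}. (1 / 4) ^ length p)"
    by (intro sum_mono2) (auto intro: fin)
  then show ?thesis unfolding eq using zero_le_power[of "1 / 2 :: real" L] by linarith
qed

text \<open>Distinct patterns have distinct shortest programs, and strings of length at most
  \<open>L\<close> have indices below \<open>2 ^ Suc L\<close>.\<close>

lemma card_low_complexity_le:
  assumes "finite P" "inj_on q P" "\<And>p. p \<in> P \<Longrightarrow> nat_complexity f (q p) \<le> enat L"
  shows "card P \<le> 2 ^ Suc L"
proof -
  have "\<exists>w. f w = Some (inv_into UNIV str_index (q p)) \<and> length w \<le> L" if "p \<in> P" for p
  proof -
    have *: "complexity f (inv_into UNIV str_index (q p)) \<le> enat L"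
      using assms(3)[OF that] by (simp add: nat_complexity_def)
    then obtain m where m: "complexity f (inv_into UNIV str_index (q p)) = enat m"
      by (cases "complexity f (inv_into UNIV str_index (q p))") auto
    then show ?thesis using * complexity_attained[OF m] by auto
  qed
  then obtain w where w: "\<And>p. p \<in> P \<Longrightarrow> f (w p) = Some (inv_into UNIV str_index (q p)) \<and> length (w p) \<le> L"
    by metis
  have "card P \<le> card {..<(2::nat) ^ Suc L}"
  proof (rule card_inj_on_le)
    show "inj_on (\<lambda>p. str_index (w p)) P"
    proof (rule inj_onI)
      fix p p' assume p: "p \<in> P" "p' \<in> P" "str_index (w p) = str_index (w p')"
      then have "w p = w p'" using bij_str_index by (simp add: bij_def inj_eq)
      then have "str_index (inv_into UNIV str_index (q p)) = str_index (inv_into UNIV str_index (q p'))"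
        using w[OF p(1)] w[OF p(2)] by simp
      then show "p = p'" using p assms(2) by (simp add: str_index_inv inj_on_eq_iff)
    qed
    show "(\<lambda>p. str_index (w p)) ` P \<subseteq> {..<2 ^ Suc L}"
    proof (rule image_subsetI)
      fix p assume "p \<in> P"
      then have "(2::nat) ^ Suc (length (w p)) \<le> 2 ^ Suc L" using w by (intro power_increasing) auto
      then show "str_index (w p) \<in> {..<2 ^ Suc L}"
        using str_index_bounds[of "w p"] unfolding lessThan_iff by linarith
    qed
  qed simp
  then show ?thesis by simp
qed

section \<open>Asymptotic complexity of points of a subshift\<close>

locale modest_subshift = group_subshift +
  fixes f :: "bool list \<Rightarrow> bool list option" and qs :: "nat set \<Rightarrow> nat"
    and qm :: "(nat \<Rightarrow> 'a option) \<Rightarrow> nat" and F :: "nat \<Rightarrow> nat set"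
  assumes optimal: "optimal f"
    and qs: "finite_set_enumeration qs" and qm: "finite_map_enumeration A qm"
    and computable_mult: "computable2 (mult G)"
    and Folner: "Folner_sequence G F" and modest: "modest f qs F"
begin

lemmas finF = Folner_finite[OF Folner] and posF = Folner_card_pos[OF Folner]

lemma eventually_modest:
  assumes "0 < \<kappa>"
  shows "\<forall>\<^sub>F i in sequentially. \<exists>m. nat_complexity f (qs (F i)) = enat m \<and> real m < \<kappa> * real (card (F i))"
proof -
  have "\<forall>\<^sub>F i in sequentially. ereal_of_enat (nat_complexity f (qs (F i))) / ereal (real (card (F i))) < ereal \<kappa>"
    using modest assms unfolding modest_def by (intro order_tendstoD(2)) auto
  then show ?thesis
  proof eventually_elim
    case (elim i)
    then show ?case using posF[of i] by (cases "nat_complexity f (qs (F i))") (auto simp: field_simps)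
  qed
qed

lemma upper_AC_le: 
  assumes x: "x \<in> X"
  shows "upper_AC f qm F x \<le> ereal entropy"
proof (rule ereal_le_epsilon2)
  fix e :: real assume e: "0 < e"
  \<comment> \<open>The error \<open>e\<close> has four equal shares: the rate on \<open>S\<close>,
    the boundary term, the constant \<open>c\<close>, and twice the description of
    \<open>F i\<close>, for which \<open>e / 8\<close> is allowed.\<close>
  obtain S where S: "finite S" "S \<noteq> {}" "log 2 (real (npat S X)) < (entropy + e / 4) * real (card S)"
    using entropy_approx[of "e / 4"] e by auto
  define Y where "Y = locally_admissible A (mult G) S (pr S ` X)"
  define a where "a = log 2 (real (card A))"
  have fin: "finite (pr S ` X)" by (rule fin_pr[OF S(1)]) simp
  have dom: "dom p = S" if "p \<in> pr S ` X" for p using that by (elim imageE) (simp only: dom_pr)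
  from complexity_pattern_le[OF optimal qs qm finite_A A_nonempty computable_mult S(1) fin dom]
  obtain c :: nat where c: "\<And>E x m. finite E \<Longrightarrow> x \<in> Y E \<Longrightarrow> nat_complexity f (qs E) = enat m \<Longrightarrow>
      \<exists>m'. nat_complexity f (qm (pr E x)) = enat m' \<and> real m' \<le> 2 * real m + log 2 (real (npat E (Y E))) + real c"
    unfolding Y_def by blast
  have "((\<lambda>i. a * (real (card (bdry S (F i))) / real (card (F i)))) \<longlongrightarrow> a * 0) sequentially"
    by (intro tendsto_intros Folner_bdry Folner S)
  then have "\<forall>\<^sub>F i in sequentially. a * (real (card (bdry S (F i))) / real (card (F i))) < e / 4"
    using e by (intro order_tendstoD(2)) auto
  moreover have "\<forall>\<^sub>F i in sequentially. 4 * real c / e \<le> real (card (F i))"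
    using Folner_card_at_top[OF Folner] by (simp add: filterlim_at_top)
  moreover have "\<forall>\<^sub>F i in sequentially. \<exists>m. nat_complexity f (qs (F i)) = enat m \<and> real m < e / 8 * real (card (F i))"
    using e by (intro eventually_modest) simp
  ultimately have "\<forall>\<^sub>F i in sequentially.
      ereal_of_enat (nat_complexity f (qm (pr (F i) x))) / ereal (real (card (F i))) \<le> ereal (entropy + e)"
  proof eventually_elim
    case (elim i)
    define n where "n = real (card (F i))"
    have n: "0 < n" using posF by (simp add: n_def)
    obtain m where m: "nat_complexity f (qs (F i)) = enat m" "real m < e / 8 * n" using elim by (auto simp: n_def)
    have "x \<in> Y (F i)" using X_locally_admissible x by (auto simp: Y_def)
    from c[OF finF this m(1)] obtain m' where m': "nat_complexity f (qm (pr (F i) x)) = enat m'"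
      "real m' \<le> 2 * real m + log 2 (real (npat (F i) (Y (F i)))) + real c" by blast
    have "log 2 (real (npat (F i) (Y (F i)))) \<le> (entropy + e / 4) * n + a * real (card (bdry S (F i)))"
      unfolding Y_def n_def a_def by (rule log_npat_locally_admissible[OF S(1,2) finF]) (use S(3) in simp)
    moreover have "a * real (card (bdry S (F i))) \<le> e / 4 * n"
      using elim(1) n by (simp add: n_def[symmetric] field_simps)
    moreover have "real c \<le> e / 4 * n"
      using elim(2) e by (simp add: n_def[symmetric] field_simps)
    ultimately have "real m' \<le> (entropy + e) * n" using m' m(2) by (simp add: distrib_right)
    then show ?case using m' n by (simp add: n_def[symmetric] divide_le_eq)
  qed
  then have "upper_AC f qm F x \<le> ereal (entropy + e)"
    unfolding upper_AC_def by (rule Limsup_bounded)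
  then show "upper_AC f qm F x \<le> ereal entropy + ereal e" by simp
qed

text \<open>Each weight is split into two equal factors. One is at most \<open>a / 2\<close> because
  the sets \<open>F i\<close> become large; modesty bounds the other by
  \<open>(1 / 4) ^ length (p i)\<close> with \<open>p i\<close> a shortest program for
  \<open>F i\<close>. Distinct sets have distinct programs, so these bounds sum to at most
  2.\<close>

lemma sum_tile_weights_small:
  assumes \<tau>: "0 < \<tau>" and a: "0 < a"
  shows "\<exists>N. \<forall>I. finite I \<longrightarrow> I \<subseteq> {N..} \<longrightarrow> inj_on F I \<longrightarrow> (\<Sum>i\<in>I. 2 powr (- \<tau> * real (card (F i)))) \<le> a"
proof -
  have "\<forall>\<^sub>F i in sequentially. \<exists>m. nat_complexity f (qs (F i)) = enat m \<and> real m < \<tau> / 4 * real (card (F i))"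
    using \<tau> by (intro eventually_modest) simp
  moreover have "\<forall>\<^sub>F i in sequentially. - log 2 (a / 2) / (\<tau> / 2) \<le> real (card (F i))"
    using Folner_card_at_top[OF Folner] by (simp only: filterlim_at_top)
  ultimately have "\<forall>\<^sub>F i in sequentially. (\<exists>m. nat_complexity f (qs (F i)) = enat m \<and> real m < \<tau> / 4 * real (card (F i)))
      \<and> - log 2 (a / 2) / (\<tau> / 2) \<le> real (card (F i))"
    by (rule eventually_conj)
  then obtain N where N: "\<And>i. N \<le> i \<Longrightarrow> \<exists>m. nat_complexity f (qs (F i)) = enat m \<and> real m < \<tau> / 4 * real (card (F i))"
    "\<And>i. N \<le> i \<Longrightarrow> - log 2 (a / 2) / (\<tau> / 2) \<le> real (card (F i))"
    unfolding eventually_sequentially by blast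
  have "\<exists>p. f p = Some (inv_into UNIV str_index (qs (F i))) \<and> real (length p) \<le> \<tau> / 4 * real (card (F i))" if i: "N \<le> i" for i
  proof -
    obtain m where m: "nat_complexity f (qs (F i)) = enat m" "real m < \<tau> / 4 * real (card (F i))" using N(1)[OF i] by blast
    obtain p where "f p = Some (inv_into UNIV str_index (qs (F i)))" "length p = m"
      using complexity_attained m(1) unfolding nat_complexity_def by metis
    with m(2) show ?thesis by (intro exI[of _ p]) simp
  qed
  then obtain p where p: "\<And>i. N \<le> i \<Longrightarrow> f (p i) = Some (inv_into UNIV str_index (qs (F i)))"
    "\<And>i. N \<le> i \<Longrightarrow> real (length (p i)) \<le> \<tau> / 4 * real (card (F i))"
    by metis
  have weight: "2 powr (- \<tau> * real (card (F i))) \<le> a / 2 * (1 / 4) ^ length (p i)" if i: "N \<le> i" for i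
  proof -
    define n where "n = real (card (F i))"
    have "- log 2 (a / 2) \<le> \<tau> / 2 * n" using N(2)[OF i] \<tau> by (simp add: n_def field_simps)
    then have "2 powr (- (\<tau> / 2) * n) \<le> 2 powr log 2 (a / 2)" by (intro powr_mono) auto
    also have "\<dots> = a / 2" using a by simp
    finally have 1: "2 powr (- (\<tau> / 2) * n) \<le> a / 2" .
    have "2 powr (- (\<tau> / 2) * n) \<le> 2 powr (- 2 * real (length (p i)))"
      using p(2)[OF i] by (intro powr_mono) (auto simp: n_def)
    also have "\<dots> = (2 powr - 2) powr real (length (p i))" by (simp only: powr_powr)
    also have "(2::real) powr - 2 = 1 / 4" by (simp add: powr_minus_divide)
    also have "(1 / 4 :: real) powr real (length (p i)) = (1 / 4) ^ length (p i)" by (rule powr_realpow) simp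
    finally have 2: "2 powr (- (\<tau> / 2) * n) \<le> (1 / 4) ^ length (p i)" .
    have "2 powr (- \<tau> * n) = 2 powr (- (\<tau> / 2) * n) * 2 powr (- (\<tau> / 2) * n)"
      by (simp add: powr_add[symmetric])
    also have "\<dots> \<le> a / 2 * (1 / 4) ^ length (p i)" using 1 2 a by (intro mult_mono) auto
    finally show ?thesis by (simp add: n_def)
  qed
  show ?thesis
  proof (rule exI[of _ N], intro allI impI)
    fix I assume I: "finite I" "I \<subseteq> {N..}" "inj_on F I"
    have "inj_on p I"
    proof (rule inj_onI)
      fix i j assume ij: "i \<in> I" "j \<in> I" "p i = p j"
      then have "inv_into UNIV str_index (qs (F i)) = inv_into UNIV str_index (qs (F j))"
        using p(1)[of i] p(1)[of j] subsetD[OF I(2) ij(1)] subsetD[OF I(2) ij(2)] by simp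
      then have "qs (F i) = qs (F j)" by (metis str_index_inv)
      moreover have "inj_on qs {w. finite w}" using qs by (simp add: finite_set_enumeration_def)
      ultimately have "F i = F j" using finF by (auto dest: inj_onD)
      then show "i = j" using I(3) ij by (auto dest: inj_onD)
    qed
    then have "(\<Sum>i\<in>I. (1 / 4 :: real) ^ length (p i)) = (\<Sum>w\<in>p ` I. (1 / 4) ^ length w)"
      by (simp add: sum.reindex)
    also have "\<dots> \<le> 2" by (rule sum_quarter_power_length_le) (use I in simp)
    finally have "a / 2 * (\<Sum>i\<in>I. (1 / 4 :: real) ^ length (p i)) \<le> a / 2 * 2" using a by (intro mult_left_mono) auto
    moreover have "(\<Sum>i\<in>I. 2 powr (- \<tau> * real (card (F i)))) \<le> (\<Sum>i\<in>I. a / 2 * (1 / 4) ^ length (p i))"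
      by (intro sum_mono weight) (use I in auto)
    ultimately show "(\<Sum>i\<in>I. 2 powr (- \<tau> * real (card (F i)))) \<le> a"
      by (simp add: sum_distrib_left)
  qed
qed

lemma rare_tail_card:
  assumes temp: "tempered G F" and s: "0 \<le> s" "s < entropy" and \<epsilon>: "0 < \<epsilon>"
    and V: "\<And>i. finite (V i)" "\<And>i j. F i = F j \<Longrightarrow> V i = V j"
    and card_V: "\<And>i. real (card (V i)) \<le> 2 * 2 powr (s * real (card (F i)))"
  shows "\<exists>N. rare F \<epsilon> (\<lambda>i. if i < N then {} else V i)"
proof -
  obtain K where K: "0 < K" "\<And>i. real (card (\<Union>j<i. inv_mul (F j) (F i))) \<le> K * real (card (F i))"
    using temp unfolding tempered_def set_inv_mult by blast
  \<comment> \<open>Tiles are charged at \<open>s + \<tau>\<close>, halfway between \<open>s\<close>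
    and the entropy: the surplus \<tau> over the growth rate of \<open>card (V i)\<close> makes the
    weights summable.\<close>
  define \<tau> where "\<tau> = (entropy - s) / 2"
  have \<tau>: "0 < \<tau>" using s by (simp add: \<tau>_def)
  show ?thesis
  proof (rule rare_tail[OF Folner K(2) _ _ _ \<epsilon> V, where s = "s + \<tau>"])
    show "0 \<le> K" "0 \<le> s + \<tau>" "s + \<tau> < entropy" using K s by (auto simp: \<tau>_def field_simps)
    fix a :: real assume "0 < a"
    then obtain N where N: "\<And>I. finite I \<Longrightarrow> I \<subseteq> {N..} \<Longrightarrow> inj_on F I \<Longrightarrow> (\<Sum>i\<in>I. 2 powr (- \<tau> * real (card (F i)))) \<le> a / 2"
      using sum_tile_weights_small[OF \<tau>, of "a / 2"] by auto
    have "(\<Sum>i\<in>I. real (card (V i)) * 2 powr (- (s + \<tau>) * real (card (F i)))) \<le> a"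
      if I: "finite I" "I \<subseteq> {N..}" "inj_on F I" for I
    proof -
      have "(\<Sum>i\<in>I. real (card (V i)) * 2 powr (- (s + \<tau>) * real (card (F i)))) \<le>
          (\<Sum>i\<in>I. 2 * 2 powr (- \<tau> * real (card (F i))))"
      proof (rule sum_mono)
        fix i
        have "real (card (V i)) * 2 powr (- (s + \<tau>) * real (card (F i))) \<le>
            (2 * 2 powr (s * real (card (F i)))) * 2 powr (- (s + \<tau>) * real (card (F i)))"
          by (rule mult_right_mono[OF card_V]) simp
        also have "\<dots> = 2 * 2 powr (s * real (card (F i)) + - (s + \<tau>) * real (card (F i)))"
          by (simp only: powr_add mult.assoc)
        also have "s * real (card (F i)) + - (s + \<tau>) * real (card (F i)) = - \<tau> * real (card (F i))"
          by (simp add: algebra_simps)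
        finally show "real (card (V i)) * 2 powr (- (s + \<tau>) * real (card (F i))) \<le> 2 * 2 powr (- \<tau> * real (card (F i)))" .
      qed
      also have "\<dots> \<le> a" using N[OF I] by (simp add: sum_distrib_left[symmetric])
      finally show ?thesis .
    qed
    then show "\<exists>N. \<forall>I. finite I \<longrightarrow> I \<subseteq> {N..} \<longrightarrow> inj_on F I \<longrightarrow>
      (\<Sum>i\<in>I. real (card (V i)) * 2 powr (- (s + \<tau>) * real (card (F i)))) \<le> a" by blast
  qed
qed

definition low :: "real \<Rightarrow> nat set \<Rightarrow> (nat \<Rightarrow> 'a option) set" where
  "low s E = {p \<in> pr E ` X. nat_complexity f (qm p) \<le> enat (nat \<lfloor>s * real (card E)\<rfloor>)}"

lemma finite_low: "finite E \<Longrightarrow> finite (low s E)"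
  by (simp add: low_def fin_pr)

lemma card_low_le:
  assumes "finite E" "0 \<le> s"
  shows "real (card (low s E)) \<le> 2 * 2 powr (s * real (card E))"
proof -
  define L where "L = nat \<lfloor>s * real (card E)\<rfloor>"
  have "low s E \<subseteq> finite_maps A"
    using pr_in_finite_maps[OF assms(1) X_range] by (auto simp: low_def)
  then have "inj_on qm (low s E)"
    using qm by (auto simp: finite_map_enumeration_def intro: inj_on_subset)
  then have "card (low s E) \<le> 2 ^ Suc L"
    by (rule card_low_complexity_le[where f = f, OF finite_low[OF assms(1)]]) (simp add: low_def L_def)
  then have "real (card (low s E)) \<le> real (2 ^ Suc L)" by (simp only: of_nat_le_iff)
  also have "\<dots> = 2 * 2 powr real L" by (simp add: powr_realpow)
  also have "real L \<le> s * real (card E)" using assms(2) by (simp add: L_def)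
  then have "2 * 2 powr real L \<le> 2 * 2 powr (s * real (card E))" by simp
  finally show ?thesis .
qed

lemma not_low_imp_le:
  assumes "finite E" "x \<in> X" "0 < card E" "pr E x \<notin> low s E"
  shows "ereal s \<le> ereal_of_enat (nat_complexity f (qm (pr E x))) / ereal (real (card E))"
proof (cases "nat_complexity f (qm (pr E x))")
  case (enat m)
  with assms have "nat \<lfloor>s * real (card E)\<rfloor> < m" by (auto simp: low_def)
  then have "s * real (card E) \<le> real m" by linarith
  with enat assms(3) show ?thesis by (simp add: field_simps)
next
  case infinity
  then show ?thesis using assms(3) by simp
qed

definition optimal_points :: "(nat \<Rightarrow> 'a) set" where
  "optimal_points = {y \<in> X. upper_AC f qm F y = ereal entropy \<and> lower_AC f qm F y = ereal entropy}"

lemma optimal_pointsI: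
  assumes "x \<in> X" "ereal entropy \<le> lower_AC f qm F x"
  shows "x \<in> optimal_points"
proof -
  have "lower_AC f qm F x \<le> upper_AC f qm F x"
    unfolding lower_AC_def upper_AC_def by (rule Liminf_le_Limsup) simp
  with assms upper_AC_le[OF assms(1)] show ?thesis
    by (auto simp: optimal_points_def)
qed

lemma optimal_points_zero_entropy:
  assumes "entropy = 0"
  shows "optimal_points = X"
proof
  show "X \<subseteq> optimal_points"
  proof
    fix x assume "x \<in> X"
    moreover have "0 \<le> lower_AC f qm F x"
      unfolding lower_AC_def
      by (rule Liminf_bounded) (use posF in \<open>auto intro!: always_eventually divide_nonneg_pos\<close>)
    ultimately show "x \<in> optimal_points" by (intro optimal_pointsI) (simp_all add: assms zero_ereal_def)
  qed
qed (auto simp: optimal_points_def)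

text \<open>The closed set \<open>Z\<close> of points that avoid all low-complexity families
  consists of optimal points. It is uncountable by a diagonal argument: avoiding one particular
  point is itself a rare condition, so every point of a countable list could be excluded in
  addition.\<close>

lemma lepoll_optimal_points:
  assumes temp: "tempered G F" and pos: "0 < entropy"
  shows "(UNIV :: real set) \<lesssim> optimal_points"
proof -
  define s where "s k = entropy * (1 - 1 / real (k + 2))" for k
  have s: "0 \<le> s k" "s k < entropy" for k using pos by (auto simp: s_def field_simps)
  \<comment> \<open>The even exponents serve the low-complexity families; the odd exponents
    \<open>2 * k + 3\<close> are reserved for the excluded points. Interleaved, they give
    \<open>(1 / 2) ^ (j + 2)\<close>, whose partial sums stay below \<open>1 / 2\<close>.\<close>
  have "\<exists>N. rare F ((1 / 2) ^ (2 * k + 2)) (\<lambda>i. if i < N then {} else low (s k) (F i))" for k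
    by (rule rare_tail_card[OF temp s]) (auto intro: finite_low finF card_low_le s)
  then obtain N where N: "\<And>k. rare F ((1 / 2) ^ (2 * k + 2)) (\<lambda>i. if i < N k then {} else low (s k) (F i))"
    by metis
  define Z where "Z = (\<Inter>k. \<Inter>i\<in>{N k..}. {x\<in>X. pr (F i) x \<notin> low (s k) (F i)})"
  have "closedin conf_top Z"
    unfolding Z_def by (intro closedin_INT closedin_pattern finF) auto
  moreover have ZX: "Z \<subseteq> X" by (auto simp: Z_def)
  moreover have "uncountable Z"
  proof
    assume cnt: "countable Z"
    define z where "z = from_nat_into Z"
    \<comment> \<open>A single pattern per set meets the cardinality bound with rate
      \<open>0\<close>, and positive entropy makes this rate admissible.\<close>
    have "\<exists>M. rare F ((1 / 2) ^ (2 * k + 3)) (\<lambda>i. if i < M then {} else {pr (F i) (z k)})" for k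
    proof (rule rare_tail_card[OF temp order_refl pos])
      show "{pr (F i) (z k)} = {pr (F j) (z k)}" if "F i = F j" for i j
        by (simp only: that)
    qed simp_all
    then have "\<forall>k. \<exists>M. rare F ((1 / 2) ^ (2 * k + 3)) (\<lambda>i. if i < M then {} else {pr (F i) (z k)})" ..
    from choice[OF this] obtain M where
      M: "rare F ((1 / 2) ^ (2 * k + 3)) (\<lambda>i. if i < M k then {} else {pr (F i) (z k)})" for k
      by blast
    define V where "V j = (if even j then (\<lambda>i. if i < N (j div 2) then {} else low (s (j div 2)) (F i))
      else (\<lambda>i. if i < M (j div 2) then {} else {pr (F i) (z (j div 2))}))" for j
    have "rare F ((1 / 2) ^ (j + 2)) (V j)" for j
    proof (cases "even j")
      case True
      then have "2 * (j div 2) = j" by simp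
      then show ?thesis using N[of "j div 2"] True by (simp add: V_def)
    next
      case False
      then have eq: "2 * (j div 2) + 3 = j + 2" by presburger
      have "V j = (\<lambda>i. if i < M (j div 2) then {} else {pr (F i) (z (j div 2))})"
        using False by (simp add: V_def)
      then show ?thesis using M[of "j div 2"] unfolding eq by (simp only:)
    qed
    moreover have "(\<Sum>j<n. (1 / 2 :: real) ^ (j + 2)) < 1" for n
    proof -
      have "(\<Sum>j<n. (1 / 2 :: real) ^ (j + 2)) = 1 / 2 - (1 / 2) ^ (n + 1)"
        by (induction n) (auto simp: field_simps)
      then show ?thesis using zero_less_power[of "1 / 2 :: real" "n + 1"] by linarith
    qed
    ultimately obtain x where x: "x \<in> X" "\<And>j i. pr (F i) x \<notin> V j i"
      using rare_avoid[OF Folner, of "\<lambda>j. (1 / 2) ^ (j + 2)" V] by blast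
    have "pr (F i) x \<notin> low (s k) (F i)" if "N k \<le> i" for k i
      using x(2)[of i "2 * k"] that by (simp add: V_def)
    then have "x \<in> Z" using x(1) by (auto simp: Z_def)
    then obtain k where "x = z k" unfolding z_def using cnt by (metis from_nat_into_surj)
    \<comment> \<open>At the index \<open>M k\<close> the family for \<open>z k\<close> contains
      exactly the pattern of \<open>z k\<close>, which \<open>x\<close> was chosen to avoid.\<close>
    then show False using x(2)[of "M k" "2 * k + 1"] by (simp add: V_def)
  qed
  ultimately have "(UNIV :: real set) \<lesssim> Z" by (rule uncountable_closed_lepoll)
  also have "Z \<subseteq> optimal_points"
  proof
    fix x assume x: "x \<in> Z"
    show "x \<in> optimal_points"
    proof (rule optimal_pointsI)
      show "x \<in> X" using x ZX by blast
      have le: "ereal (s k) \<le> lower_AC f qm F x" for k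
        unfolding lower_AC_def
      proof (rule Liminf_bounded)
        show "\<forall>\<^sub>F i in sequentially. ereal (s k) \<le> ereal_of_enat (nat_complexity f (qm (pr (F i) x))) / ereal (real (card (F i)))"
          using eventually_ge_at_top[of "N k"]
        proof eventually_elim
          case (elim i)
          then show ?case using x by (intro not_low_imp_le finF posF) (auto simp: Z_def)
        qed
      qed
      have "(\<lambda>k. entropy * (1 - 1 / real (k + 2))) \<longlonglongrightarrow> entropy * (1 - 0)"
        by (intro tendsto_intros LIMSEQ_ignore_initial_segment[OF lim_1_over_n])
      then have "(\<lambda>k. ereal (s k)) \<longlonglongrightarrow> ereal entropy" by (simp add: s_def)
      then show "ereal entropy \<le> lower_AC f qm F x"
        by (rule LIMSEQ_le_const2) (use le in auto)
    qed
  qed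
  then have "Z \<lesssim> optimal_points" by (rule subset_imp_lepoll)
  finally show ?thesis .
qed

end

theorem theorem1p1:
  fixes G :: "nat monoid"
    and A :: "'a set"
    and X :: "(nat \<Rightarrow> 'a) set"
    and F :: "nat \<Rightarrow> nat set"
    and f :: "bool list \<Rightarrow> bool list option"
    and qs :: "nat set \<Rightarrow> nat"
    and qm :: "(nat \<Rightarrow> 'a option) \<Rightarrow> nat"
  assumes "optimal f"
    and "finite_set_enumeration qs"
    and "finite_map_enumeration A qm"
    and "computable_group G"
    and "amenable G"
    and "finite A"
    and "subshift G A X"
    and "X \<noteq> {}"
    and "Folner_sequence G F"
    and "modest f qs F"
  shows "(\<forall>x\<in>X. upper_AC f qm F x \<le> ereal (top_entropy G X)) \<and>
    (tempered G F \<longrightarrow>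
       (\<exists>y\<in>X. upper_AC f qm F y = ereal (top_entropy G X) \<and>
              lower_AC f qm F y = ereal (top_entropy G X))) \<and>
    (tempered G F \<and> X \<approx> (UNIV :: real set) \<longrightarrow>
       {y \<in> X. upper_AC f qm F y = ereal (top_entropy G X) \<and>
               lower_AC f qm F y = ereal (top_entropy G X)} \<approx> (UNIV :: real set))"
proof -
  interpret group G using assms(4) by (simp add: computable_group_def)
  interpret modest_subshift G A X f qs qm F
    by unfold_locales (use assms in \<open>auto simp: computable_group_def\<close>)
  have top: "top_entropy G X = entropy" by (rule top_entropy_eq[OF assms(9)])
  have sub: "optimal_points \<subseteq> X" by (auto simp: optimal_points_def)
  have "optimal_points \<noteq> {}" if "tempered G F"
  proof (cases "entropy = 0")
    case False
    then have "(UNIV :: real set) \<lesssim> optimal_points"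
      using lepoll_optimal_points[OF that] entropy_nonneg by simp
    then show ?thesis by auto
  qed (simp add: optimal_points_zero_entropy assms(8))
  moreover have "optimal_points \<approx> (UNIV :: real set)" if "tempered G F" "X \<approx> (UNIV :: real set)"
  \<comment> \<open>For positive entropy the cardinality of \<open>X\<close> serves only as an upper
    bound; for zero entropy the optimal points are all of \<open>X\<close>, and its cardinality is
    the claim itself.\<close>
  proof (cases "entropy = 0")
    case False
    then have "(UNIV :: real set) \<lesssim> optimal_points"
      using lepoll_optimal_points[OF that(1)] entropy_nonneg by simp
    moreover have "optimal_points \<lesssim> (UNIV :: real set)"
      using subset_imp_lepoll[OF sub] that(2) by (meson eqpoll_imp_lepoll lepoll_trans)
    ultimately show ?thesis by (intro lepoll_antisym)
  qed (simp add: optimal_points_zero_entropy that)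
  ultimately show ?thesis
    unfolding top using upper_AC_le by (auto simp: optimal_points_def)
qed

end
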